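(* Consider $\mathbb{C}^2$ with coordinates $(z,w)$, $z=x+iy$, $w=u+iv$. For a fixed integer $k\ge 3$, let $$r(z,w) := u+\frac{1}{k^2}|z|^{2k}-\frac{2}{(k-1)^2}|z|^{2k-2}v+\frac{1}{(k-2)^2}|z|^{2k-4}v^2+|z|^{4k-2},$$ and set $\Omega:=\{(z,w)\in\mathbb{C}^2 : r(z,w)<0\}$. Then the following assertions hold. (i) There exists an open neighborhood $U\subset\mathbb{C}^2$ of $0\in b\Omega$ such that $\Omega\cap U$ is pseudoconvex, and such that the following holds. If $k=3$, then $0$ is the only weakly pseudoconvex boundary point of $\Omega$ in $b\Omega\cap U$. If $k>3$, then the set of weakly pseudoconvex boundary points of $\Omega$ in $b\Omega\cap U$ is $(b\Omega\cap U)\cap(\{0\}\times\mathbb{C})$. Moreover, $b\Omega$ is of finite type $c_0=2k$ at $0$. (ii) Let $V\subset\mathbb{C}^2$ be an open neighborhood of $0$ and let $\rho\colon V\to\mathbb{R}$ be a $\mathcal{C}^2$-smooth local defining function for $\Omega$. Then $\rho$ is not plurisubharmonic on $b\Omega\cap V$.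
   Context: $b\Omega$ denotes the boundary of $\Omega$. A $\mathcal{C}^2$-smooth function $\rho\colon V\to\mathbb{R}$ is a local defining function for $\Omega$ near $p_0\in b\Omega$ if $V$ is an open neighborhood of $p_0$, $\Omega\cap V=\{\rho<0\}$, and $d\rho\neq0$ on $b\Omega\cap V$. For a $\mathcal{C}^2$ function $f$ and vector fields $A=A^1\frac{\partial}{\partial z}+A^2\frac{\partial}{\partial w}$, $B=B^1\frac{\partial}{\partial z}+B^2\frac{\partial}{\partial w}$ of type $(1,0)$, write $H_f(A,B)=\sum_{j,k=1}^2\frac{\partial^2 f}{\partial z^j\partial\bar z^k}A^j\overline{B^k}$, where $(z^1,z^2)=(z,w)$. "$\rho$ is plurisubharmonic on $b\Omega\cap V$" means that $H_\rho(A,A)\ge0$ at every point of $b\Omega\cap V$ for every smooth $(1,0)$ vector field $A$ on $V$ (positivity of the complex Hessian is required only at points of $b\Omega\cap V$, but in all directions). A "holomorphic" tangential vector field is a smooth vector field $L$ of type $(1,0)$ with $Lr=0$ on $b\Omega$. $\Omega$ is pseudoconvex at $p\in b\Omega$ if $H_r(L,L)\ge0$ on $b\Omega$ near $p$ for all such $L$; strictly pseudoconvex at $p$ if in addition the inequality is strict whenever $L$ is nonvanishing; weakly pseudoconvex at $p$ if pseudoconvex but not strictly pseudoconvex at $p$. Type: let $L$ be a nonvanishing holomorphic tangential vector field near $p\in b\Omega$ and $\lambda:=H_r(L,L)|_{b\Omega}$. $b\Omega$ is of finite type $c_p=k$ at $p$ if $k\geq 2$ is the smallest integer for which there exist $L_1,\dots,L_{k-2}\in\{L,\bar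 L\}$ with $(L_{k-2}\cdots L_1\lambda)(p)\ne0$ (for $k=2$: $\lambda(p)\neq0$). This is independent of the choices of $r$ and $L$. *)

theory Defs
  imports "HOL-Analysis.Analysis"
begin

text \<open>Intended for open \<open>S\<close>, where only the values of \<open>f\<close> on \<open>S\<close> matter. In finite dimension,
  continuity of all iterated directional derivatives is the usual \<open>C\<^sup>n\<close> condition.\<close>

primrec Ck_on :: "nat \<Rightarrow> ('a::euclidean_space \<Rightarrow> 'b::real_normed_vector) \<Rightarrow> 'a set \<Rightarrow> bool" where
  "Ck_on 0 f S \<longleftrightarrow> continuous_on S f"
| "Ck_on (Suc n) f S \<longleftrightarrow>
     (\<forall>x\<in>S. f differentiable (at x)) \<and> (\<forall>v. Ck_on n (\<lambda>x. frechet_derivative f (at x) v) S)"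

definition smooth_on :: "('a::euclidean_space \<Rightarrow> 'b::real_normed_vector) \<Rightarrow> 'a set \<Rightarrow> bool" where
  "smooth_on f S \<longleftrightarrow> (\<forall>n. Ck_on n f S)"

text \<open>A point of \<open>\<complex>\<^sup>2\<close> is \<open>p :: complex ^ 2\<close> with \<open>z = p $ 1\<close> and \<open>w = p $ 2\<close>; the vectors
  \<open>axis j 1\<close> and \<open>axis j \<i>\<close> are the real and imaginary directions of the \<open>j\<close>-th coordinate.\<close>

type_synonym C2 = "complex ^ 2"

definition d_z :: "2 \<Rightarrow> (C2 \<Rightarrow> complex) \<Rightarrow> C2 \<Rightarrow> complex" where
  "d_z j f p =
     (frechet_derivative f (at p) (axis j 1) - \<i> * frechet_derivative f (at p) (axis j \<i>)) / 2"

definition d_zbar :: "2 \<Rightarrow> (C2 \<Rightarrow> complex) \<Rightarrow> C2 \<Rightarrow> complex" where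
  "d_zbar j f p =
     (frechet_derivative f (at p) (axis j 1) + \<i> * frechet_derivative f (at p) (axis j \<i>)) / 2"

text \<open>A vector field of type \<open>(1,0)\<close> is represented by its coefficients:
  \<open>A :: C2 \<Rightarrow> C2\<close> stands for \<open>A\<^sup>1 \<partial>/\<partial>z + A\<^sup>2 \<partial>/\<partial>w\<close>. The two functions below are the actions of
  this field and of its complex conjugate on functions.\<close>

definition vf_apply :: "(C2 \<Rightarrow> C2) \<Rightarrow> (C2 \<Rightarrow> complex) \<Rightarrow> C2 \<Rightarrow> complex" where
  "vf_apply A f p = (\<Sum>j\<in>UNIV. A p $ j * d_z j f p)"

definition vf_conj_apply :: "(C2 \<Rightarrow> C2) \<Rightarrow> (C2 \<Rightarrow> complex) \<Rightarrow> C2 \<Rightarrow> complex" where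
  "vf_conj_apply A f p = (\<Sum>j\<in>UNIV. cnj (A p $ j) * d_zbar j f p)"

text \<open>For real \<open>f\<close> of class \<open>C\<^sup>2\<close> this form is Hermitian, so \<open>hess f A A p\<close> is real; its sign is
  expressed below through \<open>Re\<close>.\<close>

definition hess :: "(C2 \<Rightarrow> real) \<Rightarrow> (C2 \<Rightarrow> C2) \<Rightarrow> (C2 \<Rightarrow> C2) \<Rightarrow> C2 \<Rightarrow> complex" where
  "hess f A B p =
     (\<Sum>j\<in>UNIV. \<Sum>k\<in>UNIV.
        d_z j (d_zbar k (\<lambda>q. complex_of_real (f q))) p * A p $ j * cnj (B p $ k))"

definition local_defining_function :: "C2 set \<Rightarrow> (C2 \<Rightarrow> real) \<Rightarrow> C2 set \<Rightarrow> C2 \<Rightarrow> bool" where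
  "local_defining_function \<Omega> \<rho> V p0 \<longleftrightarrow>
     p0 \<in> frontier \<Omega> \<and> open V \<and> p0 \<in> V \<and> Ck_on 2 \<rho> V \<and>
     \<Omega> \<inter> V = {p \<in> V. \<rho> p < 0} \<and>
     (\<forall>p \<in> frontier \<Omega> \<inter> V. frechet_derivative \<rho> (at p) \<noteq> (\<lambda>v. 0))"

definition psh_on_boundary :: "C2 set \<Rightarrow> (C2 \<Rightarrow> real) \<Rightarrow> C2 set \<Rightarrow> bool" where
  "psh_on_boundary \<Omega> \<rho> V \<longleftrightarrow>
     (\<forall>A. smooth_on A V \<longrightarrow> (\<forall>p \<in> frontier \<Omega> \<inter> V. 0 \<le> Re (hess \<rho> A A p)))"

text \<open>\<open>L\<close> is a "holomorphic" tangential vector field (smooth, of type \<open>(1,0)\<close>) on the open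
  neighbourhood \<open>W\<close> of \<open>p\<close>.\<close>

definition hol_tangential :: "C2 set \<Rightarrow> (C2 \<Rightarrow> real) \<Rightarrow> C2 \<Rightarrow> C2 set \<Rightarrow> (C2 \<Rightarrow> C2) \<Rightarrow> bool" where
  "hol_tangential \<Omega> r p W L \<longleftrightarrow>
     open W \<and> p \<in> W \<and> smooth_on L W \<and>
     (\<forall>q \<in> frontier \<Omega> \<inter> W. vf_apply L (\<lambda>x. complex_of_real (r x)) q = 0)"

definition nonvanishing_on :: "(C2 \<Rightarrow> C2) \<Rightarrow> C2 set \<Rightarrow> bool" where
  "nonvanishing_on L W \<longleftrightarrow> (\<forall>q\<in>W. L q \<noteq> 0)"

text \<open>The following notions are taken with respect to a given defining function \<open>r\<close> of \<open>\<Omega>\<close>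
  near \<open>p\<close>; they do not depend on its choice.\<close>

definition pseudoconvex_at :: "C2 set \<Rightarrow> (C2 \<Rightarrow> real) \<Rightarrow> C2 \<Rightarrow> bool" where
  "pseudoconvex_at \<Omega> r p \<longleftrightarrow>
     (\<exists>V. local_defining_function \<Omega> r V p) \<and>
     (\<forall>W L. hol_tangential \<Omega> r p W L \<longrightarrow>
        (\<forall>\<^sub>F q in nhds p. q \<in> frontier \<Omega> \<longrightarrow> 0 \<le> Re (hess r L L q)))"

definition strictly_pseudoconvex_at :: "C2 set \<Rightarrow> (C2 \<Rightarrow> real) \<Rightarrow> C2 \<Rightarrow> bool" where
  "strictly_pseudoconvex_at \<Omega> r p \<longleftrightarrow>
     pseudoconvex_at \<Omega> r p \<and>
     (\<forall>W L. hol_tangential \<Omega> r p W L \<and> nonvanishing_on L W \<longrightarrow>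
        (\<forall>\<^sub>F q in nhds p. q \<in> frontier \<Omega> \<longrightarrow> 0 < Re (hess r L L q)))"

definition weakly_pseudoconvex_at :: "C2 set \<Rightarrow> (C2 \<Rightarrow> real) \<Rightarrow> C2 \<Rightarrow> bool" where
  "weakly_pseudoconvex_at \<Omega> r p \<longleftrightarrow>
     pseudoconvex_at \<Omega> r p \<and> \<not> strictly_pseudoconvex_at \<Omega> r p"

text \<open>The entry \<open>True\<close> of the list stands for \<open>L\<close>, \<open>False\<close> for its conjugate; the head of the list
  is applied first. The function \<open>\<lambda>\<close> is represented by \<open>hess r L L\<close> near \<open>p\<close>: as \<open>L\<close> and its conjugate
  are tangential, the values on the boundary of the iterated derivatives only depend on the
  restriction to the boundary.\<close>

definition iter_deriv :: "(C2 \<Rightarrow> C2) \<Rightarrow> bool list \<Rightarrow> (C2 \<Rightarrow> complex) \<Rightarrow> C2 \<Rightarrow> complex" where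
  "iter_deriv L bs f = fold (\<lambda>b g. if b then vf_apply L g else vf_conj_apply L g) bs f"

definition levi_type_wrt :: "(C2 \<Rightarrow> real) \<Rightarrow> (C2 \<Rightarrow> C2) \<Rightarrow> C2 \<Rightarrow> nat \<Rightarrow> bool" where
  "levi_type_wrt r L p m \<longleftrightarrow>
     2 \<le> m \<and>
     (\<exists>bs. length bs = m - 2 \<and> iter_deriv L bs (hess r L L) p \<noteq> 0) \<and>
     (\<forall>j. 2 \<le> j \<and> j < m \<longrightarrow>
        \<not> (\<exists>bs. length bs = j - 2 \<and> iter_deriv L bs (hess r L L) p \<noteq> 0))"

text \<open>The type does not depend on the nonvanishing tangential field \<open>L\<close>, hence the quantification
  over all of them; the second conjunct rules out that this quantification is vacuous.\<close>

definition finite_type_at :: "C2 set \<Rightarrow> (C2 \<Rightarrow> real) \<Rightarrow> C2 \<Rightarrow> nat \<Rightarrow> bool" where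
  "finite_type_at \<Omega> r p m \<longleftrightarrow>
     (\<exists>V. local_defining_function \<Omega> r V p \<and> smooth_on r V) \<and>
     (\<exists>W L. hol_tangential \<Omega> r p W L \<and> nonvanishing_on L W) \<and>
     (\<forall>W L. hol_tangential \<Omega> r p W L \<and> nonvanishing_on L W \<longrightarrow> levi_type_wrt r L p m)"

definition r_fun :: "nat \<Rightarrow> C2 \<Rightarrow> real" where
  "r_fun k p =
     (let z = p $ 1; w = p $ 2; u = Re w; v = Im w in
        u + 1 / (real k)\<^sup>2 * cmod z ^ (2 * k)
          - 2 / (real k - 1)\<^sup>2 * cmod z ^ (2 * k - 2) * v
          + 1 / (real k - 2)\<^sup>2 * cmod z ^ (2 * k - 4) * v\<^sup>2
          + cmod z ^ (4 * k - 2))"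

definition Omega :: "nat \<Rightarrow> C2 set" where
  "Omega k = {p. r_fun k p < 0}"

end

theory Submission
  imports Defs
begin

text \<open>Write \<open>k = n + 3\<close>, \<open>t = |z|\<^sup>2\<close> and \<open>r = u + F(t, v)\<close>. The Hessian entry \<open>r\<^bsub>z zbar\<^esub>\<close> is
  \<open>t\<^sup>n (t - v)\<^sup>2 + (2 n + 5)\<^sup>2 t\<^bsup>2 n + 4\<^esup>\<close>; it dominates the Levi form near \<open>0\<close>, which gives
  pseudoconvexity and the weakly pseudoconvex points. Assigning weight \<open>1\<close> to \<open>z\<close> and at least \<open>2\<close> to \<open>v\<close>,
  the Levi form has leading term \<open>|z|\<^bsup>2 (k - 1)\<^esup>\<close>, so the type is \<open>2 k\<close>.

  For the last assertion, let \<open>h = \<rho>\<^sub>u\<close>, so that \<open>d\<rho> = h dr\<close> along the boundary. On the circle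
  \<open>v = t\<close>, \<open>|z| = s\<close>, \<open>w\<close> constant, the Levi form is only of size \<open>s\<^bsup>4 (k - 1)\<^esup>\<close>. If \<open>\<rho>\<close> is
  plurisubharmonic on the boundary, the Cauchy--Schwarz inequality for its Hessian bounds the mixed entry
  \<open>H\<^sub>\<rho>(L, \<partial>\<^sub>w)\<close> by a multiple of \<open>s\<^bsup>2 (k - 1)\<^esup>\<close>, which is of smaller order than \<open>H\<^sub>r(L, \<partial>\<^sub>w)\<close>. The difference
  is absorbed by \<open>L h\<close>, which forces \<open>\<partial>h / \<partial>\<theta> > 0\<close> on the whole circle: a contradiction to periodicity.\<close>

section \<open>Smooth functions and mixed second derivatives\<close>

text \<open>The double zero of \<open>t ^ n * (t - v)\<^sup>2\<close> at \<open>v = t\<close> makes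
  the Levi form tiny there, but the mixed derivative remembers the integral of that square:
  \<open>\<partial>\<^sub>t (t F\<^sub>t\<^sub>v) = - 2 t ^ n (t - v)\<close>, hence
  \<open>t F\<^sub>t\<^sub>v = 2 (1/(n+1) - 1/(n+2)) t ^ (n+2)\<close> at \<open>v = t\<close>, with
  a fixed sign. The last summand of \<open>r\<close> keeps the Levi form positive on the circle and
  contributes there only the order of \<open>(t ^ (n+2))\<^sup>2\<close>. The margin is therefore a
  single factor \<open>s\<close>: after multiplication by \<open>z\<close>, the Cauchy-Schwarz bound
  has order \<open>s t ^ (n+2)\<close> and the main term has order \<open>t ^ (n+2)\<close>. The two
  Hessians are compared by differentiating \<open>d\<rho> = h dr\<close> once, in a direction
  tangential to the boundary, and the symmetry of second derivatives has to come from C^2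
  alone.\<close>

lemma frechet_derivative_eqI: "(f has_derivative f') (at x) \<Longrightarrow> frechet_derivative f (at x) = f'"
  by (metis frechet_derivative_at)

text \<open>\<open>frechet_derivative\<close> is a choice among the derivatives at \<open>x\<close>,
  so it is enough that \<open>f\<close> and \<open>g\<close> have the same derivatives there; at
  points without a derivative both sides are the same arbitrary choice.\<close>

lemma frechet_derivative_cong_open:
  assumes "open S" "x \<in> S" "\<And>y. y \<in> S \<Longrightarrow> f y = g y"
  shows "frechet_derivative f (at x) = frechet_derivative g (at x)"
proof -
  have "(f has_derivative f') (at x) \<longleftrightarrow> (g has_derivative f') (at x)" for f'
    using assms has_derivative_transform_within_open[of f f' x UNIV S g]
      has_derivative_transform_within_open[of g f' x UNIV S f] by auto
  then show ?thesis unfolding frechet_derivative_def by simp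
qed

text \<open>Derivative formulas hold only at points of \<open>S\<close>, while \<open>Ck_on\<close>
  recurses into globally defined derivative functions; this lemma exchanges one for the
  other.\<close>

lemma Ck_on_cong:
  assumes "open S" "\<And>x. x \<in> S \<Longrightarrow> f x = g x" "Ck_on n f S"
  shows "Ck_on n g S"
  using assms(2,3)
proof (induction n arbitrary: f g)
  case 0
  then show ?case using continuous_on_cong[of S S f g] by simp
next
  case (Suc n)
  have "g differentiable at x" if "x \<in> S" for x
    using Suc.prems that \<open>open S\<close>
    by (meson Ck_on.simps(2) differentiable_def has_derivative_transform_within_open)
  moreover have "Ck_on n (\<lambda>x. frechet_derivative g (at x) v) S" for v
    using Suc.prems Suc.IH[of "\<lambda>x. frechet_derivative f (at x) v"]
      frechet_derivative_cong_open[OF \<open>open S\<close>, of _ f g] by auto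
  ultimately show ?case by simp
qed

lemma Ck_on_linear:
  assumes "open S" "bounded_linear T" "Ck_on n f S"
  shows "Ck_on n (\<lambda>x. T (f x)) S"
  using assms(3)
proof (induction n arbitrary: f)
  case 0
  then show ?case using bounded_linear.continuous_on[OF assms(2)] by simp
next
  case (Suc n)
  have D: "((\<lambda>x. T (f x)) has_derivative (\<lambda>v. T (frechet_derivative f (at x) v))) (at x)" if "x \<in> S" for x
    using Suc.prems that by (auto intro!: bounded_linear.has_derivative[OF assms(2)] simp: frechet_derivative_works)
  have "Ck_on n (\<lambda>x. frechet_derivative (\<lambda>x. T (f x)) (at x) v) S" for v
  proof (rule Ck_on_cong[OF assms(1)])
    show "T (frechet_derivative f (at x) v) = frechet_derivative (\<lambda>x. T (f x)) (at x) v"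
      if "x \<in> S" for x by (simp add: frechet_derivative_eqI[OF D[OF that]])
    show "Ck_on n (\<lambda>x. T (frechet_derivative f (at x) v)) S"
      using Suc by simp
  qed
  moreover have "(\<lambda>x. T (f x)) differentiable (at x)" if "x \<in> S" for x
    using D[OF that] by (rule differentiableI)
  ultimately show ?case by simp
qed

lemma Ck_on_add:
  assumes "open S" "Ck_on n f S" "Ck_on n g S"
  shows "Ck_on n (\<lambda>x. f x + g x) S"
  using assms(2,3)
proof (induction n arbitrary: f g)
  case 0
  then show ?case by (simp add: continuous_on_add)
next
  case (Suc n)
  have D: "((\<lambda>x. f x + g x) has_derivative
      (\<lambda>v. frechet_derivative f (at x) v + frechet_derivative g (at x) v)) (at x)" if "x \<in> S" for x
    using Suc.prems that by (auto simp: frechet_derivative_works intro!: has_derivative_add)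
  have "Ck_on n (\<lambda>x. frechet_derivative (\<lambda>x. f x + g x) (at x) v) S" for v
  proof (rule Ck_on_cong[OF assms(1)])
    show "frechet_derivative f (at x) v + frechet_derivative g (at x) v = frechet_derivative (\<lambda>x. f x + g x) (at x) v"
      if "x \<in> S" for x by (simp add: frechet_derivative_eqI[OF D[OF that]])
    show "Ck_on n (\<lambda>x. frechet_derivative f (at x) v + frechet_derivative g (at x) v) S"
      using Suc by simp
  qed
  moreover have "(\<lambda>x. f x + g x) differentiable (at x)" if "x \<in> S" for x
    using D[OF that] by (rule differentiableI)
  ultimately show ?case by simp
qed

lemma Ck_on_const: "Ck_on n (\<lambda>x. c) S"
  by (induction n arbitrary: c) (auto simp: continuous_on_const)

lemma smooth_on_D:
  assumes "smooth_on f S"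
  shows "Ck_on n f S" "continuous_on S f" "x \<in> S \<Longrightarrow> f differentiable (at x)"
    "smooth_on (\<lambda>x. frechet_derivative f (at x) v) S"
proof -
  have "Ck_on n f S" "Ck_on (Suc n) f S" for n
    using assms unfolding smooth_on_def by blast+
  from this(1)[of n] this(1)[of 0] this(2) show "Ck_on n f S" "continuous_on S f"
    "x \<in> S \<Longrightarrow> f differentiable (at x)" "smooth_on (\<lambda>x. frechet_derivative f (at x) v) S"
    by (auto simp: smooth_on_def)
qed

text \<open>The product rule leaves one factor undifferentiated while the order drops. Taking the
  factors smooth keeps the induction hypothesis applicable to both factors and their
  derivatives.\<close>

lemma Ck_on_bilinear:
  assumes "open S" "bounded_bilinear B" "smooth_on f S" "smooth_on g S"
  shows "Ck_on n (\<lambda>x. B (f x) (g x)) S"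
  using assms(3,4)
proof (induction n arbitrary: f g)
  case 0
  then show ?case by (simp add: bounded_bilinear.continuous_on[OF assms(2)] smooth_on_D(2))
next
  case (Suc n)
  have D: "((\<lambda>x. B (f x) (g x)) has_derivative
      (\<lambda>v. B (f x) (frechet_derivative g (at x) v) + B (frechet_derivative f (at x) v) (g x))) (at x)"
    if "x \<in> S" for x
    using smooth_on_D(3)[OF Suc.prems(1) that] smooth_on_D(3)[OF Suc.prems(2) that]
      bounded_bilinear.FDERIV[OF assms(2)] by (auto simp: frechet_derivative_works)
  have "Ck_on n (\<lambda>x. frechet_derivative (\<lambda>x. B (f x) (g x)) (at x) v) S" for v
  proof (rule Ck_on_cong[OF assms(1)])
    show "B (f x) (frechet_derivative g (at x) v) + B (frechet_derivative f (at x) v) (g x) = frechet_derivative (\<lambda>x. B (f x) (g x)) (at x) v"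
      if "x \<in> S" for x by (simp add: frechet_derivative_eqI[OF D[OF that]])
    show "Ck_on n (\<lambda>x. B (f x) (frechet_derivative g (at x) v) + B (frechet_derivative f (at x) v) (g x)) S"
      by (rule Ck_on_add[OF assms(1) Suc.IH[OF Suc.prems(1) smooth_on_D(4)[OF Suc.prems(2)]]
          Suc.IH[OF smooth_on_D(4)[OF Suc.prems(1)] Suc.prems(2)]])
  qed
  moreover have "(\<lambda>x. B (f x) (g x)) differentiable (at x)" if "x \<in> S" for x
    using D[OF that] by (rule differentiableI)
  ultimately show ?case by simp
qed

lemma smooth_on_const [simp]: "smooth_on (\<lambda>x. c) S"
  by (simp add: smooth_on_def Ck_on_const)

lemma smooth_on_linear: "open S \<Longrightarrow> bounded_linear T \<Longrightarrow> smooth_on f S \<Longrightarrow> smooth_on (\<lambda>x. T (f x)) S"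
  by (simp add: smooth_on_def Ck_on_linear)

lemma smooth_on_add: "open S \<Longrightarrow> smooth_on f S \<Longrightarrow> smooth_on g S \<Longrightarrow> smooth_on (\<lambda>x. f x + g x) S"
  by (simp add: smooth_on_def Ck_on_add)

lemma smooth_on_bilinear:
  "open S \<Longrightarrow> bounded_bilinear B \<Longrightarrow> smooth_on f S \<Longrightarrow> smooth_on g S \<Longrightarrow> smooth_on (\<lambda>x. B (f x) (g x)) S"
  using Ck_on_bilinear unfolding smooth_on_def by blast

lemma smooth_on_ident:
  assumes "open S"
  shows "smooth_on (\<lambda>x. x) S"
  unfolding smooth_on_def
proof
  fix n show "Ck_on n (\<lambda>x. x) S"
    by (cases n) (auto simp: Ck_on_const)
qed

lemma smooth_on_mult:
  fixes f g :: "'a::euclidean_space \<Rightarrow> 'b::real_normed_algebra"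
  shows "open S \<Longrightarrow> smooth_on f S \<Longrightarrow> smooth_on g S \<Longrightarrow> smooth_on (\<lambda>x. f x * g x) S"
  by (rule smooth_on_bilinear[OF _ bounded_bilinear_mult])

lemma smooth_on_power:
  fixes f :: "'a::euclidean_space \<Rightarrow> 'b::real_normed_algebra_1"
  shows "open S \<Longrightarrow> smooth_on f S \<Longrightarrow> smooth_on (\<lambda>x. f x ^ n) S"
  by (induction n) (simp_all add: smooth_on_mult)

lemma smooth_on_diff:
  assumes "open S" "smooth_on f S" "smooth_on g S"
  shows "smooth_on (\<lambda>x. f x - g x) S"
  using smooth_on_add[OF assms(1,2) smooth_on_linear[OF assms(1) bounded_linear_minus[OF bounded_linear_ident] assms(3)]]
  by simp

text \<open>The left-hand side is symmetric in \<open>u\<close> and \<open>v\<close>, hence the symmetry of the second derivative as \<open>h\<close> tends to \<open>0\<close>.\<close>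

lemma second_difference_mean_value:
  fixes f :: "'a::euclidean_space \<Rightarrow> real"
  assumes C: "Ck_on 2 f S" and h: "h > 0"
    and S: "\<And>s t. 0 \<le> s \<Longrightarrow> s \<le> h \<Longrightarrow> 0 \<le> t \<Longrightarrow> t \<le> h \<Longrightarrow> x + s *\<^sub>R u + t *\<^sub>R v \<in> S"
  shows "\<exists>s t. 0 < s \<and> s < h \<and> 0 < t \<and> t < h \<and>
    f (x + h *\<^sub>R u + h *\<^sub>R v) - f (x + h *\<^sub>R u) - f (x + h *\<^sub>R v) + f x
      = h * h * frechet_derivative (\<lambda>y. frechet_derivative f (at y) u) (at (x + s *\<^sub>R u + t *\<^sub>R v)) v"
proof -
  have d1: "(f has_derivative frechet_derivative f (at y)) (at y)" if "y \<in> S" for y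
    using C that by (simp add: numeral_2_eq_2 frechet_derivative_works)
  have d2: "((\<lambda>y. frechet_derivative f (at y) u) has_derivative
      frechet_derivative (\<lambda>y. frechet_derivative f (at y) u) (at y)) (at y)" if "y \<in> S" for y
    using C that by (simp add: numeral_2_eq_2 frechet_derivative_works)
  have lin: "frechet_derivative f (at y) (a *\<^sub>R w) = frechet_derivative f (at y) w * a" if "y \<in> S" for y a w
    using linear_scale[OF has_derivative_linear[OF d1[OF that]]] by (simp add: mult.commute)
  have lin2: "frechet_derivative (\<lambda>y. frechet_derivative f (at y) u) (at y) (a *\<^sub>R w) =
     frechet_derivative (\<lambda>y. frechet_derivative f (at y) u) (at y) w * a" if "y \<in> S" for y a w
    using linear_scale[OF has_derivative_linear[OF d2[OF that]]] by (simp add: mult.commute)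
  \<comment> \<open>The second difference is an increment in \<open>s\<close> of an increment in
    direction \<open>v\<close>: the mean value theorem is applied to \<open>\<phi>\<close> and then
    to the derivative of \<open>f\<close> along the segment in direction \<open>v\<close>.\<close>
  define \<phi> where "\<phi> s = f (x + s *\<^sub>R u + h *\<^sub>R v) - f (x + s *\<^sub>R u)" for s
  have "(\<phi> has_derivative (\<lambda>a. (frechet_derivative f (at (x + s *\<^sub>R u + h *\<^sub>R v)) u
       - frechet_derivative f (at (x + s *\<^sub>R u)) u) * a)) (at s)" if "0 \<le> s" "s \<le> h" for s
  proof -
    have m: "x + s *\<^sub>R u + h *\<^sub>R v \<in> S" "x + s *\<^sub>R u \<in> S"
      using S[of s h] S[of s 0] that h by auto
    have "((\<lambda>s. f (x + s *\<^sub>R u + h *\<^sub>R v)) has_derivative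
       (\<lambda>a. frechet_derivative f (at (x + s *\<^sub>R u + h *\<^sub>R v)) (a *\<^sub>R u))) (at s)"
      by (rule has_derivative_compose[where f="\<lambda>s. x + s *\<^sub>R u + h *\<^sub>R v" and g=f, OF _ d1[OF m(1)]]) (auto intro!: derivative_eq_intros)
    moreover have "((\<lambda>s. f (x + s *\<^sub>R u)) has_derivative
       (\<lambda>a. frechet_derivative f (at (x + s *\<^sub>R u)) (a *\<^sub>R u))) (at s)"
      by (rule has_derivative_compose[where f="\<lambda>s. x + s *\<^sub>R u" and g=f, OF _ d1[OF m(2)]]) (auto intro!: derivative_eq_intros)
    ultimately show ?thesis
      unfolding \<phi>_def lin[OF m(1)] lin[OF m(2)] left_diff_distrib by (rule has_derivative_diff)
  qed
  then obtain s where s: "0 < s" "s < h" and e1: "\<phi> h - \<phi> 0 = h * (frechet_derivative f (at (x + s *\<^sub>R u + h *\<^sub>R v)) u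
       - frechet_derivative f (at (x + s *\<^sub>R u)) u)"
    using MVT2[of 0 h \<phi> "\<lambda>s. frechet_derivative f (at (x + s *\<^sub>R u + h *\<^sub>R v)) u
       - frechet_derivative f (at (x + s *\<^sub>R u)) u"] h
    by (auto simp: has_field_derivative_def)
  define \<psi> where "\<psi> t = frechet_derivative f (at (x + s *\<^sub>R u + t *\<^sub>R v)) u" for t
  have "(\<psi> has_derivative (\<lambda>a. frechet_derivative (\<lambda>y. frechet_derivative f (at y) u) (at (x + s *\<^sub>R u + t *\<^sub>R v)) v * a)) (at t)"
    if "0 \<le> t" "t \<le> h" for t
  proof -
    have m: "x + s *\<^sub>R u + t *\<^sub>R v \<in> S" using S[of s t] that h s by auto
    have "((\<lambda>t. frechet_derivative f (at (x + s *\<^sub>R u + t *\<^sub>R v)) u) has_derivative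
       (\<lambda>a. frechet_derivative (\<lambda>y. frechet_derivative f (at y) u) (at (x + s *\<^sub>R u + t *\<^sub>R v)) (a *\<^sub>R v))) (at t)"
      by (rule has_derivative_compose[where f="\<lambda>t. x + s *\<^sub>R u + t *\<^sub>R v" and g="\<lambda>y. frechet_derivative f (at y) u", OF _ d2[OF m]]) (auto intro!: derivative_eq_intros)
    then show ?thesis unfolding \<psi>_def by (simp add: lin2 m)
  qed
  then obtain t where t: "0 < t" "t < h" and e2: "\<psi> h - \<psi> 0 = h * frechet_derivative (\<lambda>y. frechet_derivative f (at y) u) (at (x + s *\<^sub>R u + t *\<^sub>R v)) v"
    using MVT2[of 0 h \<psi> "\<lambda>t. frechet_derivative (\<lambda>y. frechet_derivative f (at y) u) (at (x + s *\<^sub>R u + t *\<^sub>R v)) v"] h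
    by (auto simp: has_field_derivative_def)
  have "f (x + h *\<^sub>R u + h *\<^sub>R v) - f (x + h *\<^sub>R u) - f (x + h *\<^sub>R v) + f x = \<phi> h - \<phi> 0"
    by (simp add: \<phi>_def)
  also have "\<dots> = h * (\<psi> h - \<psi> 0)" using e1 by (simp add: \<psi>_def)
  finally show ?thesis using e2 s t by (metis mult.assoc)
qed

text \<open>Schwarz's theorem. Both mixed derivatives, taken at suitable points of one small
  parallelogram, equal the same second difference divided by \<open>h * h\<close>; continuity moves
  these points to \<open>x\<close>. It serves to make the complex Hessian of \<open>\<rho>\<close>
  Hermitian.\<close>

lemma frechet_derivative_commute:
  fixes f :: "'a::euclidean_space \<Rightarrow> real"
  assumes C: "Ck_on 2 f S" and S: "open S" and x: "x \<in> S"
  shows "frechet_derivative (\<lambda>y. frechet_derivative f (at y) u) (at x) v =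
         frechet_derivative (\<lambda>y. frechet_derivative f (at y) v) (at x) u"
proof -
  define D where "D u v y = frechet_derivative (\<lambda>y. frechet_derivative f (at y) u) (at y) v" for u v y
  have cont: "continuous_on S (D u v)" for u v
    using C by (simp add: numeral_2_eq_2 D_def)
  have close: "\<bar>D u v x - D v u x\<bar> \<le> e" if e: "e > 0" for e
  proof -
    have "isCont (D a b) x" for a b
      using cont S x by (simp add: continuous_on_eq_continuous_at)
    then have "\<forall>\<^sub>F y in nhds x. dist (D a b y) (D a b x) < e/2" for a b
      using tendstoD[of "D a b" "D a b x" "at x" "e/2"] e
      by (simp only: isCont_def eventually_nhds_conv_at dist_self half_gt_zero)
    then have "\<forall>\<^sub>F y in nhds x. y \<in> S \<and> dist (D u v y) (D u v x) < e/2 \<and> dist (D v u y) (D v u x) < e/2"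
      using S x by (simp add: eventually_conj eventually_nhds_in_open)
    then obtain d where d: "d > 0" and ball: "\<And>y. dist y x < d \<Longrightarrow>
        y \<in> S \<and> dist (D u v y) (D u v x) < e/2 \<and> dist (D v u y) (D v u x) < e/2"
      by (auto simp: eventually_nhds_metric)
    \<comment> \<open>This size keeps the parallelogram spanned by \<open>h *\<^sub>R u\<close> and
      \<open>h *\<^sub>R v\<close> inside the ball of radius \<open>d\<close>; the summand
      \<open>1\<close> covers \<open>u = v = 0\<close>.\<close>
    define h where "h = d / (2 * (norm u + norm v + 1))"
    have h: "h > 0" using d by (simp add: h_def add_nonneg_pos)
    have near: "dist (x + s *\<^sub>R u + t *\<^sub>R v) x < d" if "0 \<le> s" "s \<le> h" "0 \<le> t" "t \<le> h" for s t
    proof -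
      have "dist (x + s *\<^sub>R u + t *\<^sub>R v) x \<le> s * norm u + t * norm v"
        using that norm_triangle_ineq[of "s *\<^sub>R u" "t *\<^sub>R v"] by (simp add: dist_norm algebra_simps)
      also have "\<dots> \<le> h * norm u + h * norm v" using that by (simp add: add_mono mult_right_mono)
      also have "\<dots> < h * (2 * (norm u + norm v + 1))"
        unfolding distrib_left[symmetric]
        by (intro mult_strict_left_mono[OF _ h]) (smt (verit) norm_ge_zero)
      also have "\<dots> = d"
        unfolding h_def by (intro nonzero_eq_divide_eq[THEN iffD1, OF _ refl]) (smt (verit) norm_ge_zero)
      finally show ?thesis .
    qed
    obtain s t where st: "0 < s" "s < h" "0 < t" "t < h"
      "f (x + h *\<^sub>R u + h *\<^sub>R v) - f (x + h *\<^sub>R u) - f (x + h *\<^sub>R v) + f x = h * h * D u v (x + s *\<^sub>R u + t *\<^sub>R v)"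
      using second_difference_mean_value[OF C h, of x u v] ball near unfolding D_def by blast
    have near': "dist (x + t *\<^sub>R v + s *\<^sub>R u) x < d" if "0 \<le> s" "s \<le> h" "0 \<le> t" "t \<le> h" for s t
      using near[OF that] by (simp add: add_ac)
    obtain s' t' where st': "0 < s'" "s' < h" "0 < t'" "t' < h"
      "f (x + h *\<^sub>R v + h *\<^sub>R u) - f (x + h *\<^sub>R v) - f (x + h *\<^sub>R u) + f x = h * h * D v u (x + s' *\<^sub>R v + t' *\<^sub>R u)"
      using second_difference_mean_value[OF C h, of x v u] ball near' unfolding D_def by blast
    have "h * h * D u v (x + s *\<^sub>R u + t *\<^sub>R v) = h * h * D v u (x + s' *\<^sub>R v + t' *\<^sub>R u)"
      unfolding st(5)[symmetric] st'(5)[symmetric] by (simp add: add_ac)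
    then have "D u v (x + s *\<^sub>R u + t *\<^sub>R v) = D v u (x + s' *\<^sub>R v + t' *\<^sub>R u)" using h by simp
    moreover have "dist (D u v (x + s *\<^sub>R u + t *\<^sub>R v)) (D u v x) < e/2"
      using ball near st by (meson less_imp_le)
    moreover have "dist (D v u (x + s' *\<^sub>R v + t' *\<^sub>R u)) (D v u x) < e/2"
      using ball near' st' by (meson less_imp_le)
    ultimately show ?thesis unfolding dist_real_def by linarith
  qed
  have "\<bar>D u v x - D v u x\<bar> \<le> 0"
    by (rule field_le_epsilon) (unfold add_0, rule close)
  then show ?thesis by (simp add: D_def)
qed

section \<open>The defining function and its complex Hessian\<close>

lemma UNIV_2_sum: "(\<Sum>j\<in>UNIV. f (j::2)) = f 1 + f 2"
  by (simp add: UNIV_2)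

lemma d_z_eqI: "(f has_derivative f') (at p) \<Longrightarrow> d_z j f p = (f' (axis j 1) - \<i> * f' (axis j \<i>)) / 2"
  by (simp add: d_z_def frechet_derivative_eqI)

lemma d_zbar_eqI: "(f has_derivative f') (at p) \<Longrightarrow> d_zbar j f p = (f' (axis j 1) + \<i> * f' (axis j \<i>)) / 2"
  by (simp add: d_zbar_def frechet_derivative_eqI)

lemma has_derivative_complex_of_real:
  "(f has_derivative f') F \<Longrightarrow> ((\<lambda>x. complex_of_real (f x)) has_derivative (\<lambda>h. complex_of_real (f' h))) F"
  by (rule bounded_linear.has_derivative[OF bounded_linear_of_real])

lemma has_derivative_vec_nth:
  "(f has_derivative f') F \<Longrightarrow> ((\<lambda>x. f x $ i) has_derivative (\<lambda>h. f' h $ i)) F"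
  by (rule bounded_linear.has_derivative[OF bounded_linear_vec_nth])

text \<open>The names of the following polynomials in \<open>(t, v)\<close> indicate partial derivatives of
  \<open>Fpoly\<close>; \<open>Fzz\<close> is \<open>\<partial>\<^sub>t (t \<partial>\<^sub>t F)\<close>, the coefficient of \<open>dz dzbar\<close> in the complex Hessian.
  The truncated exponent \<open>n - 1\<close> in \<open>Ftt\<close> is harmless because of the factor \<open>n\<close>.\<close>

definition rc :: "nat \<Rightarrow> nat \<Rightarrow> real" where "rc n j = inverse (real n + real j)"

lemma rc_mult: "j > 0 \<Longrightarrow> rc n j * (real n + real j) = 1"
  by (simp add: rc_def add_nonneg_pos)

text \<open>With \<open>k = n + 3\<close> the numbers \<open>rc n 3\<close>, \<open>rc n 2\<close>,
  \<open>rc n 1\<close> are \<open>1/k\<close>, \<open>1/(k-1)\<close>, \<open>1/(k-2)\<close>, and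
  \<open>2 * n + 5\<close> is half of \<open>4 * k - 2\<close>.\<close>

definition Fpoly :: "nat \<Rightarrow> real \<Rightarrow> real \<Rightarrow> real" where
  "Fpoly n t v = (rc n 3)\<^sup>2 * t ^ (n+3) - 2 * (rc n 2)\<^sup>2 * t ^ (n+2) * v + (rc n 1)\<^sup>2 * t ^ (n+1) * v\<^sup>2 + t ^ (2*n+5)"

definition Ft :: "nat \<Rightarrow> real \<Rightarrow> real \<Rightarrow> real" where
  "Ft n t v = rc n 3 * t ^ (n+2) - 2 * rc n 2 * t ^ (n+1) * v + rc n 1 * t ^ n * v\<^sup>2 + (2*n+5) * t ^ (2*n+4)"

definition Fv :: "nat \<Rightarrow> real \<Rightarrow> real \<Rightarrow> real" where
  "Fv n t v = - 2 * (rc n 2)\<^sup>2 * t ^ (n+2) + 2 * (rc n 1)\<^sup>2 * t ^ (n+1) * v"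

definition Ftt :: "nat \<Rightarrow> real \<Rightarrow> real \<Rightarrow> real" where
  "Ftt n t v = (n+2) * rc n 3 * t ^ (n+1) - 2 * (n+1) * rc n 2 * t ^ n * v + n * rc n 1 * t ^ (n-1) * v\<^sup>2
     + (2*n+5) * (2*n+4) * t ^ (2*n+3)"

definition Ftv :: "nat \<Rightarrow> real \<Rightarrow> real \<Rightarrow> real" where
  "Ftv n t v = - 2 * rc n 2 * t ^ (n+1) + 2 * rc n 1 * t ^ n * v"

definition Fvv :: "nat \<Rightarrow> real \<Rightarrow> real" where
  "Fvv n t = 2 * (rc n 1)\<^sup>2 * t ^ (n+1)"

definition Fzz :: "nat \<Rightarrow> real \<Rightarrow> real \<Rightarrow> real" where
  "Fzz n t v = t ^ n * (t - v)\<^sup>2 + (2*n+5)\<^sup>2 * t ^ (2*n+4)"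

lemma rc_eqs: "rc n 3 * (real n + 3) = 1" "rc n 2 * (real n + 2) = 1" "rc n 1 * (real n + 1) = 1"
  using rc_mult[of 3 n] rc_mult[of 2 n] rc_mult[of 1 n] by simp_all

text \<open>Differentiation in \<open>t\<close> brings down an exponent that cancels one factor
  \<open>rc\<close>. The left-hand sides have exactly the shape of the terms produced by
  \<open>has_derivative_monomial\<close>.\<close>

lemma rc_cancel:
  "(rc n 3)\<^sup>2 * (real (n + 3) * x * y) = rc n 3 * x * y"
  "- 2 * (rc n 2)\<^sup>2 * (real (n + 2) * x * y) = - 2 * rc n 2 * x * y"
  "(rc n 1)\<^sup>2 * (real (n + 1) * x * y) = rc n 1 * x * y"
  "2 * (rc n 1)\<^sup>2 * (real (n + 1) * x * y) = 2 * rc n 1 * x * y"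
proof -
  have "(rc n 3)\<^sup>2 * (real n + 3) = rc n 3" "(rc n 2)\<^sup>2 * (real n + 2) = rc n 2" "(rc n 1)\<^sup>2 * (real n + 1) = rc n 1"
    using rc_eqs[of n] by (simp_all add: power2_eq_square mult.assoc)
  then show "(rc n 3)\<^sup>2 * (real (n + 3) * x * y) = rc n 3 * x * y"
    "- 2 * (rc n 2)\<^sup>2 * (real (n + 2) * x * y) = - 2 * rc n 2 * x * y"
    "(rc n 1)\<^sup>2 * (real (n + 1) * x * y) = rc n 1 * x * y"
    "2 * (rc n 1)\<^sup>2 * (real (n + 1) * x * y) = 2 * rc n 1 * x * y"
    by (auto simp: mult.assoc[symmetric] add.commute)
qed

lemma power_shift:
  fixes t :: real
  shows "t ^ (n+1) = t * t ^ n" "t ^ (n+2) = t * t * t ^ n" "t ^ (n+3) = t * t * t * t ^ n"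
    "t ^ (2*n+3) = t * t * t * (t ^ n * t ^ n)" "t ^ (2*n+4) = t * t * t * t * (t ^ n * t ^ n)"
    "t ^ (2*n+5) = t * t * t * t * t * (t ^ n * t ^ n)"
  by (simp_all add: power_add mult_2 eval_nat_numeral)

text \<open>The operator \<open>\<partial>\<^sub>t (t \<partial>\<^sub>t)\<close> multiplies
  \<open>t ^ m\<close> by \<open>m\<^sup>2\<close>. The squared reciprocals in \<open>r\<close> are
  chosen to cancel this, leaving the perfect square \<open>t ^ n * (t - v)\<^sup>2\<close>; the last
  power has coefficient \<open>1\<close> and keeps its factor.\<close>

lemma Ft_plus_t_Ftt: "Ft n t v + t * Ftt n t v = Fzz n t v"
proof -
  have e: "t * (real n * t ^ (n-1)) = real n * t ^ n" "t * t ^ (n+1) = t ^ (n+2)" "t * t ^ n = t ^ (n+1)"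
    "t * t ^ (2*n+3) = t ^ (2*n+4)"
    by (cases n) (simp_all add: eval_nat_numeral)
  have "t * Ftt n t v = (real n+2) * rc n 3 * (t * t ^ (n+1)) - 2 * (real n+1) * rc n 2 * (t * t ^ n) * v
     + rc n 1 * (t * (real n * t ^ (n-1))) * v\<^sup>2 + (2*real n+5) * (2*real n+4) * (t * t ^ (2*n+3))"
    by (simp add: Ftt_def algebra_simps)
  then have "Ft n t v + t * Ftt n t v = rc n 3 * (real n + 3) * t ^ (n+2) - 2 * (rc n 2 * (real n + 2)) * t ^ (n+1) * v
      + rc n 1 * (real n + 1) * t ^ n * v\<^sup>2 + (2*real n+5)\<^sup>2 * t ^ (2*n+4)"
    unfolding e by (simp add: Ft_def power2_eq_square algebra_simps)
  also have "\<dots> = Fzz n t v"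
    unfolding rc_eqs Fzz_def by (simp add: power_shift power2_eq_square algebra_simps)
  finally show ?thesis .
qed

text \<open>One rule for all coefficient polynomials: they are rewritten as sums of terms
  \<open>c * t ^ i * v ^ j\<close>, with exponents \<open>0\<close> and \<open>1\<close> written out
  so that every term matches.\<close>

lemma has_derivative_monomial:
  fixes c :: real
  assumes "(a has_derivative a') (at x)" "(b has_derivative b') (at x)"
  shows "((\<lambda>x. c * a x ^ i * b x ^ j) has_derivative
    (\<lambda>h. c * (i * a x ^ (i-1) * b x ^ j) * a' h + c * (a x ^ i * (j * b x ^ (j-1))) * b' h)) (at x)"
  by (rule has_derivative_eq_rhs, (rule assms derivative_intros)+) (simp add: fun_eq_iff algebra_simps)

lemma has_derivative_Fpoly:
  assumes "(a has_derivative a') (at x)" "(b has_derivative b') (at x)"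
  shows "((\<lambda>x. Fpoly n (a x) (b x)) has_derivative (\<lambda>h. Ft n (a x) (b x) * a' h + Fv n (a x) (b x) * b' h)) (at x)"
proof -
  have F: "Fpoly n t v = (rc n 3)\<^sup>2 * t ^ (n+3) * v ^ 0 + (- 2 * (rc n 2)\<^sup>2) * t ^ (n+2) * v ^ 1
     + (rc n 1)\<^sup>2 * t ^ (n+1) * v ^ 2 + 1 * t ^ (2*n+5) * v ^ 0" for t v
    by (simp add: Fpoly_def)
  have eqs: "n + 3 - 1 = n + 2" "n + 2 - 1 = n + 1" "n + 1 - 1 = n" "2 * n + 5 - 1 = 2 * n + 4"
    "2 - 1 = (1::nat)" "1 - 1 = (0::nat)" by simp_all
  show ?thesis
    unfolding F
  proof (rule has_derivative_eq_rhs, (rule has_derivative_add has_derivative_monomial assms)+, rule ext)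
    fix h
    show "(rc n 3)\<^sup>2 * (real (n + 3) * a x ^ (n + 3 - 1) * b x ^ 0) * a' h +
       (rc n 3)\<^sup>2 * (a x ^ (n + 3) * (real 0 * b x ^ (0 - 1))) * b' h +
       (- 2 * (rc n 2)\<^sup>2 * (real (n + 2) * a x ^ (n + 2 - 1) * b x ^ 1) * a' h +
       - 2 * (rc n 2)\<^sup>2 * (a x ^ (n + 2) * (real 1 * b x ^ (1 - 1))) * b' h) +
       ((rc n 1)\<^sup>2 * (real (n + 1) * a x ^ (n + 1 - 1) * b x ^ 2) * a' h +
       (rc n 1)\<^sup>2 * (a x ^ (n + 1) * (real 2 * b x ^ (2 - 1))) * b' h) +
       (1 * (real (2 * n + 5) * a x ^ (2 * n + 5 - 1) * b x ^ 0) * a' h +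
       1 * (a x ^ (2 * n + 5) * (real 0 * b x ^ (0 - 1))) * b' h)
      = Ft n (a x) (b x) * a' h + Fv n (a x) (b x) * b' h"
      unfolding Ft_def Fv_def rc_cancel
      unfolding of_nat_add of_nat_mult of_nat_numeral of_nat_1 of_nat_0 eqs power_0 power_one_right

      by (simp add: algebra_simps)
  qed
qed

lemma has_derivative_Ft:
  assumes "(a has_derivative a') (at x)" "(b has_derivative b') (at x)"
  shows "((\<lambda>x. Ft n (a x) (b x)) has_derivative (\<lambda>h. Ftt n (a x) (b x) * a' h + Ftv n (a x) (b x) * b' h)) (at x)"
proof -
  have F: "Ft n t v = rc n 3 * t ^ (n+2) * v ^ 0 + (- 2 * rc n 2) * t ^ (n+1) * v ^ 1
     + rc n 1 * t ^ n * v ^ 2 + real (2*n+5) * t ^ (2*n+4) * v ^ 0" for t v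
    by (simp add: Ft_def)
  have eqs: "n + 2 - 1 = n + 1" "n + 1 - 1 = n" "2 * n + 4 - 1 = 2 * n + 3"
    "2 - 1 = (1::nat)" "1 - 1 = (0::nat)" by simp_all
  show ?thesis
    unfolding F
  proof (rule has_derivative_eq_rhs, (rule has_derivative_add has_derivative_monomial assms)+, rule ext)
    fix h
    show "rc n 3 * (real (n + 2) * a x ^ (n + 2 - 1) * b x ^ 0) * a' h +
       rc n 3 * (a x ^ (n + 2) * (real 0 * b x ^ (0 - 1))) * b' h +
       (- 2 * rc n 2 * (real (n + 1) * a x ^ (n + 1 - 1) * b x ^ 1) * a' h +
       - 2 * rc n 2 * (a x ^ (n + 1) * (real 1 * b x ^ (1 - 1))) * b' h) +
       (rc n 1 * (real n * a x ^ (n - 1) * b x ^ 2) * a' h +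
       rc n 1 * (a x ^ n * (real 2 * b x ^ (2 - 1))) * b' h) +
       (real (2 * n + 5) * (real (2 * n + 4) * a x ^ (2 * n + 4 - 1) * b x ^ 0) * a' h +
       real (2 * n + 5) * (a x ^ (2 * n + 4) * (real 0 * b x ^ (0 - 1))) * b' h)
      = Ftt n (a x) (b x) * a' h + Ftv n (a x) (b x) * b' h"
      unfolding Ftt_def Ftv_def of_nat_add of_nat_mult of_nat_numeral of_nat_1 of_nat_0 eqs power_0 power_one_right

      by (simp add: algebra_simps)
  qed
qed

lemma has_derivative_Fv:
  assumes "(a has_derivative a') (at x)" "(b has_derivative b') (at x)"
  shows "((\<lambda>x. Fv n (a x) (b x)) has_derivative (\<lambda>h. Ftv n (a x) (b x) * a' h + Fvv n (a x) * b' h)) (at x)"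
proof -
  have F: "Fv n t v = (- 2 * (rc n 2)\<^sup>2) * t ^ (n+2) * v ^ 0 + (2 * (rc n 1)\<^sup>2) * t ^ (n+1) * v ^ 1" for t v
    by (simp add: Fv_def)
  have eqs: "n + 2 - 1 = n + 1" "n + 1 - 1 = n" "1 - 1 = (0::nat)" by simp_all
  show ?thesis
    unfolding F
  proof (rule has_derivative_eq_rhs, (rule has_derivative_add has_derivative_monomial assms)+, rule ext)
    fix h
    show "- 2 * (rc n 2)\<^sup>2 * (real (n + 2) * a x ^ (n + 2 - 1) * b x ^ 0) * a' h +
       - 2 * (rc n 2)\<^sup>2 * (a x ^ (n + 2) * (real 0 * b x ^ (0 - 1))) * b' h +
       (2 * (rc n 1)\<^sup>2 * (real (n + 1) * a x ^ (n + 1 - 1) * b x ^ 1) * a' h +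
       2 * (rc n 1)\<^sup>2 * (a x ^ (n + 1) * (real 1 * b x ^ (1 - 1))) * b' h)
      = Ftv n (a x) (b x) * a' h + Fvv n (a x) * b' h"
      unfolding Fvv_def Ftv_def rc_cancel
      unfolding of_nat_add of_nat_mult of_nat_numeral of_nat_1 of_nat_0 eqs power_0 power_one_right

      by (simp add: algebra_simps)
  qed
qed

section \<open>The variables \<open>|z|^2\<close> and \<open>Im w\<close>, and the Hessian of
  \<open>r\<close>\<close>

definition tt :: "C2 \<Rightarrow> real" where "tt p = (cmod (p $ 1))\<^sup>2"
lemma tt_alt: "tt p = Re (p $ 1) * Re (p $ 1) + Im (p $ 1) * Im (p $ 1)"
  unfolding tt_def cmod_power2 by (simp add: power2_eq_square)

definition vv :: "C2 \<Rightarrow> real" where "vv p = Im (p $ 2)"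

lemma has_derivative_tt: "(tt has_derivative (\<lambda>h. 2 * Re (cnj (p $ 1) * h $ 1))) (at p)"
proof -
  have "((\<lambda>p::C2. (Re (p $ 1))\<^sup>2 + (Im (p $ 1))\<^sup>2) has_derivative
     (\<lambda>h. 2 * Re (p $ 1) * Re (h $ 1) + 2 * Im (p $ 1) * Im (h $ 1))) (at p)"
    by (rule has_derivative_eq_rhs, (rule derivative_intros has_derivative_vec_nth)+) (simp add: fun_eq_iff)
  then show ?thesis by (simp add: tt_def[abs_def] cmod_power2 algebra_simps)
qed

lemma has_derivative_vv: "(vv has_derivative (\<lambda>h. Im (h $ 2))) (at p)"
  unfolding vv_def[abs_def]
  by (rule has_derivative_eq_rhs, (rule derivative_intros has_derivative_vec_nth)+) simp

text \<open>All powers of \<open>|z|\<close> in \<open>r\<close> are even, so apart from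
  \<open>u\<close> the function depends on \<open>t\<close> and \<open>v\<close> only. In particular
  \<open>r\<close> is invariant under rotations of \<open>z\<close>.\<close>

lemma r_fun_eq: "r_fun (n+3) p = Re (p $ 2) + Fpoly n (tt p) (vv p)"
proof -
  have e: "2 * (n+3) - 2 = 2 * (n+2)" "2 * (n+3) - 4 = 2 * (n+1)" "4 * (n+3) - 2 = 2 * (2*n+5)"
    by simp_all
  have t: "cmod (p $ 1) ^ (2 * m) = tt p ^ m" for m by (simp only: tt_def power_mult)
  have "1 / (real (n+3))\<^sup>2 = (rc n 3)\<^sup>2" "2 / (real (n+3) - 1)\<^sup>2 = 2 * (rc n 2)\<^sup>2" "1 / (real (n+3) - 2)\<^sup>2 = (rc n 1)\<^sup>2"
    by (simp_all add: rc_def power_inverse divide_inverse add.commute)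
  then show ?thesis
    unfolding r_fun_def Let_def e t Fpoly_def vv_def by simp
qed

lemma has_derivative_r:
  "(r_fun (n+3) has_derivative (\<lambda>h. Re (h $ 2) + (Ft n (tt p) (vv p) * (2 * Re (cnj (p $ 1) * h $ 1))
     + Fv n (tt p) (vv p) * Im (h $ 2)))) (at p)"
proof -
  have *: "r_fun (n+3) = (\<lambda>p. Re (p $ 2) + Fpoly n (tt p) (vv p))" by (simp add: r_fun_eq fun_eq_iff)
  show ?thesis
    unfolding * by (intro has_derivative_add has_derivative_Fpoly has_derivative_tt has_derivative_vv)
      (rule has_derivative_eq_rhs, (rule derivative_intros has_derivative_vec_nth)+, simp)
qed

lemma axis_simps [simp]: "(axis 1 a :: C2) $ 1 = a" "(axis 1 a :: C2) $ 2 = 0" "(axis 2 a :: C2) $ 1 = 0" "(axis 2 a :: C2) $ 2 = a"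
  by (simp_all add: axis_def)

lemma r_derivatives:
  "d_zbar 1 (\<lambda>q. complex_of_real (r_fun (n+3) q)) p = of_real (Ft n (tt p) (vv p)) * p $ 1"
  "d_zbar 2 (\<lambda>q. complex_of_real (r_fun (n+3) q)) p = (1 + \<i> * of_real (Fv n (tt p) (vv p))) / 2"
  "d_z 1 (\<lambda>q. complex_of_real (r_fun (n+3) q)) p = of_real (Ft n (tt p) (vv p)) * cnj (p $ 1)"
  "d_z 2 (\<lambda>q. complex_of_real (r_fun (n+3) q)) p = (1 - \<i> * of_real (Fv n (tt p) (vv p))) / 2"
  unfolding d_zbar_eqI[OF has_derivative_complex_of_real[OF has_derivative_r]]
    d_z_eqI[OF has_derivative_complex_of_real[OF has_derivative_r]]
  by (simp_all add: complex_eq_iff)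

text \<open>Chain rule for a function of \<open>t = z zbar\<close> and
  \<open>v = (w - wbar) / (2 i)\<close>; the summand \<open>u\<close> is pluriharmonic and leaves no
  trace. The four terms are the entries \<open>r\<^sub>z\<^sub>z\<^sub>b\<^sub>a\<^sub>r\<close>,
  the two mixed ones and the one in \<open>w\<close>.\<close>

lemma hess_r:
  "hess (r_fun (n+3)) A B p =
     of_real (Fzz n (tt p) (vv p)) * A p $ 1 * cnj (B p $ 1)
     + \<i> / 2 * of_real (Ftv n (tt p) (vv p)) * cnj (p $ 1) * A p $ 1 * cnj (B p $ 2)
     - \<i> / 2 * of_real (Ftv n (tt p) (vv p)) * (p $ 1) * A p $ 2 * cnj (B p $ 1)
     + of_real (Fvv n (tt p)) / 4 * A p $ 2 * cnj (B p $ 2)"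
proof -
  have d1: "((\<lambda>q. complex_of_real (Ft n (tt q) (vv q)) * q $ 1) has_derivative
     (\<lambda>h. complex_of_real (Ft n (tt p) (vv p)) * h $ 1
       + complex_of_real (Ftt n (tt p) (vv p) * (2 * Re (cnj (p $ 1) * h $ 1)) + Ftv n (tt p) (vv p) * Im (h $ 2)) * p $ 1)) (at p)"
    by (intro has_derivative_mult has_derivative_complex_of_real has_derivative_Ft has_derivative_tt
        has_derivative_vv has_derivative_vec_nth has_derivative_ident)
  have d2: "((\<lambda>q. (1 + \<i> * complex_of_real (Fv n (tt q) (vv q))) / 2) has_derivative
     (\<lambda>h. \<i> * complex_of_real (Ftv n (tt p) (vv p) * (2 * Re (cnj (p $ 1) * h $ 1)) + Fvv n (tt p) * Im (h $ 2)) / 2)) (at p)"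
    by (rule has_derivative_eq_rhs, (rule derivative_intros has_derivative_complex_of_real has_derivative_Fv has_derivative_tt has_derivative_vv | simp)+)
  have t: "complex_of_real (tt p) = p $ 1 * cnj (p $ 1)"
    by (simp add: tt_def complex_norm_square flip: of_real_power)
  have 1: "d_z 1 (\<lambda>q. complex_of_real (Ft n (tt q) (vv q)) * q $ 1) p = of_real (Fzz n (tt p) (vv p))"
    unfolding d_z_eqI[OF d1] Ft_plus_t_Ftt[symmetric] by (simp add: complex_eq_iff tt_alt algebra_simps)
  have 2: "d_z 2 (\<lambda>q. complex_of_real (Ft n (tt q) (vv q)) * q $ 1) p = - \<i> / 2 * of_real (Ftv n (tt p) (vv p)) * (p $ 1)"
    unfolding d_z_eqI[OF d1] by (simp add: complex_eq_iff)
  have 3: "d_z 1 (\<lambda>q. (1 + \<i> * complex_of_real (Fv n (tt q) (vv q))) / 2) p = \<i> / 2 * of_real (Ftv n (tt p) (vv p)) * cnj (p $ 1)"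
    unfolding d_z_eqI[OF d2] by (simp add: complex_eq_iff)
  have 4: "d_z 2 (\<lambda>q. (1 + \<i> * complex_of_real (Fv n (tt q) (vv q))) / 2) p = of_real (Fvv n (tt p)) / 4"
    unfolding d_z_eqI[OF d2] by (simp add: complex_eq_iff)
  show ?thesis
    unfolding hess_def UNIV_2_sum r_derivatives 1 2 3 4 by (simp add: algebra_simps)
qed

section \<open>The boundary and tangential derivatives\<close>

text \<open>The direction of \<open>u\<close>, in which \<open>r\<close> is affine with slope
  \<open>1\<close>. Every line in this direction meets the zero set of \<open>r\<close> exactly
  once, so points can be projected to the boundary explicitly, without an implicit function
  theorem.\<close>

definition real_dir :: "real \<Rightarrow> C2" where "real_dir a = axis 2 (complex_of_real a)"

lemma real_dir_simps [simp]: "real_dir a $ 1 = 0" "real_dir a $ 2 = complex_of_real a"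
  by (simp_all add: real_dir_def)

lemma C2_eqI: "p $ 1 = q $ 1 \<Longrightarrow> p $ 2 = q $ 2 \<Longrightarrow> p = (q::C2)"
  by (simp add: vec_eq_iff forall_2)

lemma bounded_linear_real_dir: "bounded_linear real_dir"
proof -
  have "linear real_dir" by (rule linearI) (auto intro!: C2_eqI simp: scaleR_conv_of_real[where 'a=complex])
  then show ?thesis by (simp add: linear_linear)
qed

lemma r_fun_real_dir: "r_fun (n+3) (p + real_dir a) = r_fun (n+3) p + a"
  by (simp add: r_fun_eq tt_def vv_def)

lemma continuous_on_r: "continuous_on S (r_fun (n+3))"
  by (meson continuous_at_imp_continuous_on has_derivative_continuous has_derivative_r)

text \<open>A zero of \<open>r\<close> is approached from inside by decreasing \<open>u\<close>,
  which decreases \<open>r\<close> by the same amount; the remaining inclusions are continuity of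
  \<open>r\<close>.\<close>

lemma frontier_Omega: "frontier (Omega (n+3)) = {p. r_fun (n+3) p = 0}"
proof -
  have op: "open (Omega (n+3))"
    unfolding Omega_def using continuous_on_r[of UNIV n] by (simp add: open_Collect_less)
  have "closed {p. r_fun (n+3) p \<le> 0}"
    using continuous_on_r[of UNIV n] by (simp add: closed_Collect_le)
  then have cl: "closure (Omega (n+3)) \<subseteq> {p. r_fun (n+3) p \<le> 0}"
    by (intro closure_minimal) (auto simp: Omega_def)
  have "p \<in> closure (Omega (n+3))" if "r_fun (n+3) p = 0" for p
    unfolding closure_sequential
  proof (intro exI conjI allI)
    show "p + real_dir (- inverse (Suc m)) \<in> Omega (n+3)" for m
      using that by (simp add: Omega_def r_fun_real_dir)
    have "(\<lambda>m. p + real_dir (- inverse (real (Suc m)))) \<longlonglongrightarrow> p + real_dir (- 0)"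
      by (intro tendsto_intros bounded_linear.tendsto[OF bounded_linear_real_dir] LIMSEQ_inverse_real_of_nat)
    then show "(\<lambda>m. p + real_dir (- inverse (real (Suc m)))) \<longlonglongrightarrow> p"
      by (simp add: linear_0[OF bounded_linear.linear[OF bounded_linear_real_dir]])
  qed
  with cl op show ?thesis by (auto simp: frontier_def interior_open Omega_def)
qed

text \<open>Test on the curve \<open>q + s X - r(q + s X) e\<close>, which lies in the boundary because \<open>r\<close> is
  affine in the direction \<open>e\<close>.\<close>

lemma derivative_of_vanishing_on_boundary:
  fixes f :: "C2 \<Rightarrow> 'b::real_normed_vector"
  assumes f: "(f has_derivative f') (at q)" and W: "open W" "q \<in> W"
    and 0: "\<And>p. p \<in> frontier (Omega (n+3)) \<inter> W \<Longrightarrow> f p = 0"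
    and q: "q \<in> frontier (Omega (n+3))" and r: "(r_fun (n+3) has_derivative r') (at q)"
  shows "f' X = r' X *\<^sub>R f' (real_dir 1)"
proof -
  define \<gamma> where "\<gamma> s = (q + s *\<^sub>R X) - real_dir (r_fun (n+3) (q + s *\<^sub>R X))" for s
  have \<gamma>0: "\<gamma> 0 = q" using q by (simp add: \<gamma>_def frontier_Omega linear_0[OF bounded_linear.linear[OF bounded_linear_real_dir]])
  have d\<gamma>: "(\<gamma> has_derivative (\<lambda>s. s *\<^sub>R X - real_dir (r' (s *\<^sub>R X)))) (at 0)"
    unfolding \<gamma>_def[abs_def]
  proof (intro has_derivative_diff bounded_linear.has_derivative[OF bounded_linear_real_dir])
    show A: "((\<lambda>s. q + s *\<^sub>R X) has_derivative (\<lambda>s. s *\<^sub>R X)) (at 0)"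
      by (auto intro!: derivative_eq_intros)
    show "((\<lambda>x. r_fun (n+3) (q + x *\<^sub>R X)) has_derivative (\<lambda>x. r' (x *\<^sub>R X))) (at 0)"
      by (rule has_derivative_compose[OF A, where g="r_fun (n+3)"]) (use r in simp)
  qed
  have dc: "((\<lambda>s. f (\<gamma> s)) has_derivative (\<lambda>s. f' (s *\<^sub>R X - real_dir (r' (s *\<^sub>R X))))) (at 0)"
    by (rule has_derivative_compose[OF d\<gamma>, where g=f]) (use f \<gamma>0 in simp)
  have "isCont \<gamma> 0" using d\<gamma> has_derivative_continuous by blast
  then have "(\<gamma> \<longlongrightarrow> \<gamma> 0) (nhds 0)" unfolding isCont_def tendsto_at_iff_tendsto_nhds .
  then have "\<forall>\<^sub>F s in nhds 0. \<gamma> s \<in> W" by (rule topological_tendstoD) (simp_all add: W \<gamma>0)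
  moreover have "\<gamma> s \<in> frontier (Omega (n+3))" for s
  proof -
    have "\<gamma> s = (q + s *\<^sub>R X) + real_dir (- r_fun (n+3) (q + s *\<^sub>R X))"
      by (simp add: \<gamma>_def vec_eq_iff forall_2)
    then show ?thesis by (simp add: frontier_Omega r_fun_real_dir)
  qed
  ultimately have "\<forall>\<^sub>F s in nhds 0. f (\<gamma> s) = 0" using 0 by (auto elim: eventually_mono)
  then obtain S where S: "open S" "0 \<in> S" "\<And>s. s \<in> S \<Longrightarrow> f (\<gamma> s) = 0"
    by (auto simp: eventually_nhds)
  have "((\<lambda>s. 0) has_derivative (\<lambda>s. f' (s *\<^sub>R X - real_dir (r' (s *\<^sub>R X))))) (at (0::real))"
    using has_derivative_transform_within_open[OF dc S(1,2)] S(3) by simp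
  then have "(\<lambda>s. f' (s *\<^sub>R X - real_dir (r' (s *\<^sub>R X)))) = (\<lambda>s. 0)"
    using has_derivative_unique has_derivative_const by blast
  then have "f' (1 *\<^sub>R X - real_dir (r' (1 *\<^sub>R X))) = 0" by meson
  moreover have "real_dir (r' X) = r' X *\<^sub>R real_dir 1"
    by (rule C2_eqI) (simp_all add: scaleR_conv_of_real[where 'a=complex])
  ultimately show ?thesis
    using has_derivative_linear[OF f] by (simp add: linear_diff linear_scale)
qed

abbreviation cr :: "nat \<Rightarrow> C2 \<Rightarrow> complex" where "cr n \<equiv> \<lambda>x. complex_of_real (r_fun (n+3) x)"

text \<open>The differential of such an \<open>f\<close> is a multiple of \<open>dr\<close>, the
  factor being its derivative in the direction of \<open>u\<close>, where \<open>dr\<close> equals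
  \<open>1\<close>. Both complex parts inherit the factor.\<close>

lemma d_z_of_vanishing_on_boundary:
  fixes f :: "C2 \<Rightarrow> complex"
  assumes f: "(f has_derivative f') (at q)" and W: "open W" "q \<in> W"
    and 0: "\<And>p. p \<in> frontier (Omega (n+3)) \<inter> W \<Longrightarrow> f p = 0"
    and q: "q \<in> frontier (Omega (n+3))"
  shows "d_z j f q = d_z j (cr n) q * f' (real_dir 1)" "d_zbar j f q = d_zbar j (cr n) q * f' (real_dir 1)"
proof -
  obtain r' where r': "(r_fun (n+3) has_derivative r') (at q)" using has_derivative_r by blast
  have e: "f' X = of_real (r' X) * f' (real_dir 1)" for X
    using derivative_of_vanishing_on_boundary[OF f W 0 q r', of X] by (simp add: scaleR_conv_of_real)
  show "d_z j f q = d_z j (cr n) q * f' (real_dir 1)"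
    unfolding d_z_eqI[OF has_derivative_complex_of_real[OF r']] d_z_eqI[OF f] e[of "axis j 1"] e[of "axis j \<i>"]
    by (simp add: algebra_simps)
  show "d_zbar j f q = d_zbar j (cr n) q * f' (real_dir 1)"
    unfolding d_zbar_eqI[OF has_derivative_complex_of_real[OF r']] d_zbar_eqI[OF f] e[of "axis j 1"] e[of "axis j \<i>"]
    by (simp add: algebra_simps)
qed

lemma vf_apply_cr: "vf_apply A (cr n) q = A q $ 1 * of_real (Ft n (tt q) (vv q)) * cnj (q $ 1)
    + A q $ 2 * (1 - \<i> * of_real (Fv n (tt q) (vv q))) / 2"
  by (simp add: vf_apply_def UNIV_2_sum r_derivatives)

lemma vf_conj_apply_cr: "vf_conj_apply A (cr n) q = cnj (vf_apply A (cr n) q)"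
  by (simp add: vf_conj_apply_def vf_apply_def UNIV_2_sum r_derivatives)

text \<open>A tangential field and its conjugate annihilate \<open>dr\<close>, hence every multiple
  of it. So they only see the boundary values of a function, which is used both for the type and for
  differentiating \<open>d\<rho> = h dr\<close>.\<close>

lemma vf_apply_vanishing_on_boundary:
  fixes f :: "C2 \<Rightarrow> complex"
  assumes f: "f differentiable (at q)" and W: "open W" "q \<in> W"
    and 0: "\<And>p. p \<in> frontier (Omega (n+3)) \<inter> W \<Longrightarrow> f p = 0"
    and q: "q \<in> frontier (Omega (n+3))" and A: "vf_apply A (cr n) q = 0"
  shows "vf_apply A f q = 0" "vf_conj_apply A f q = 0"
proof -
  obtain f' where f': "(f has_derivative f') (at q)" using f by (auto simp: differentiable_def)
  note d = d_z_of_vanishing_on_boundary[OF f' W 0 q]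
  have "vf_apply A f q = vf_apply A (cr n) q * f' (real_dir 1)"
    by (simp add: vf_apply_def UNIV_2_sum d(1)[of 1, simplified] d(1)[of 2, simplified] algebra_simps)
  then show "vf_apply A f q = 0" using A by simp
  have "vf_conj_apply A f q = vf_conj_apply A (cr n) q * f' (real_dir 1)"
    by (simp add: vf_conj_apply_def UNIV_2_sum d(2)[of 1, simplified] d(2)[of 2, simplified] algebra_simps)
  then show "vf_conj_apply A f q = 0" using A by (simp add: vf_conj_apply_cr)
qed

text \<open>The Levi form after eliminating the second component of a tangential field, with the
  denominator \<open>1 + F\<^sub>v\<^sup>2\<close> cleared and \<open>|A\<^sup>1|\<^sup>2\<close>
  divided out. For the field
  \<open>r\<^sub>w \<partial>\<^sub>z - r\<^sub>z \<partial>\<^sub>w\<close> it is four times the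
  Levi form.\<close>

definition levi_num :: "nat \<Rightarrow> real \<Rightarrow> real \<Rightarrow> real" where
  "levi_num n t v = (1 + (Fv n t v)\<^sup>2) * Fzz n t v - 2 * t * Ft n t v * Ftv n t v * Fv n t v + Fvv n t * t * (Ft n t v)\<^sup>2"

lemma hess_tangential:
  assumes A: "vf_apply A (cr n) q = 0"
  shows "of_real (1 + (Fv n (tt q) (vv q))\<^sup>2) * hess (r_fun (n+3)) A A q
    = of_real ((cmod (A q $ 1))\<^sup>2 * levi_num n (tt q) (vv q))"
proof -
  define a b z f fv ftv fvv lev where defs: "a = A q $ 1" "b = A q $ 2" "z = q $ 1"
    "f = complex_of_real (Ft n (tt q) (vv q))" "fv = complex_of_real (Fv n (tt q) (vv q))"
    "ftv = complex_of_real (Ftv n (tt q) (vv q))" "fvv = complex_of_real (Fvv n (tt q))"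
    "lev = complex_of_real (Fzz n (tt q) (vv q))"
  \<comment> \<open>\<open>m / 2\<close> is \<open>r\<^sub>w\<close> and \<open>m' / 2\<close> its
    conjugate. Multiplying the form by \<open>m * m'\<close> allows tangency to be used as a formula
    for \<open>b * m\<close>, without division.\<close>
  define m m' where "m = 1 - \<i> * fv" and "m' = 1 + \<i> * fv"
  have b: "b * m = - 2 * a * f * cnj z"
    using A by (simp add: vf_apply_cr defs m_def field_simps add_eq_0_iff)
  have "cnj (b * m) = cnj (- 2 * a * f * cnj z)" using b by simp
  then have b': "cnj b * m' = - 2 * cnj a * f * z"
    by (simp add: defs m_def m'_def)
  have t: "complex_of_real (tt q) = z * cnj z"
    by (simp add: tt_def defs complex_norm_square flip: of_real_power)
  have mm: "m * m' = 1 + fv\<^sup>2" by (simp add: m_def m'_def algebra_simps power2_eq_square)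
  have md: "\<i> * (m' - m) = - 2 * fv" by (simp add: m_def m'_def algebra_simps)
  have "m * m' * (lev * a * cnj a + \<i> / 2 * ftv * cnj z * a * cnj b - \<i> / 2 * ftv * z * b * cnj a + fvv / 4 * b * cnj b)
    = m * m' * lev * a * cnj a + \<i> / 2 * ftv * cnj z * a * m * (cnj b * m') - \<i> / 2 * ftv * z * (b * m) * cnj a * m'
      + fvv / 4 * (b * m) * (cnj b * m')"
    by (simp add: algebra_simps)
  also have "\<dots> = a * cnj a * (m * m' * lev + (\<i> * (m' - m)) * ftv * f * (z * cnj z) + fvv * (z * cnj z) * f\<^sup>2)"
    unfolding b b' by (simp add: algebra_simps power2_eq_square)
  also have "\<dots> = a * cnj a * of_real (levi_num n (tt q) (vv q))"
    unfolding md mm t[symmetric] by (simp add: levi_num_def defs algebra_simps)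
  finally show ?thesis
    unfolding hess_r defs[symmetric] mm by (simp add: defs complex_norm_square flip: of_real_power)
qed

lemma Re_hess_tangential:
  assumes A: "vf_apply A (cr n) q = 0"
  shows "Re (hess (r_fun (n+3)) A A q)
    = (cmod (A q $ 1))\<^sup>2 * levi_num n (tt q) (vv q) / (1 + (Fv n (tt q) (vv q))\<^sup>2)"
proof -
  have "1 + (Fv n (tt q) (vv q))\<^sup>2 > 0" by (simp add: add_pos_nonneg)
  moreover have "Re (of_real (1 + (Fv n (tt q) (vv q))\<^sup>2) * hess (r_fun (n+3)) A A q)
     = (cmod (A q $ 1))\<^sup>2 * levi_num n (tt q) (vv q)"
    unfolding hess_tangential[OF A] by simp
  ultimately show ?thesis by (simp add: field_simps)
qed

text \<open>Since \<open>r\<^sub>w\<close> has real part \<open>1/2\<close>, a tangential vector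
  with first component \<open>0\<close> is \<open>0\<close>. Hence the sign of the Levi form is that
  of \<open>levi_num\<close>, whichever nonvanishing field is used.\<close>

lemma Re_hess_tangential_nonzero:
  assumes A: "vf_apply A (cr n) q = 0" and nz: "A q \<noteq> 0"
  shows "A q $ 1 \<noteq> 0" "Re (hess (r_fun (n+3)) A A q) > 0 \<longleftrightarrow> levi_num n (tt q) (vv q) > 0"
proof -
  show *: "A q $ 1 \<noteq> 0"
  proof
    assume a: "A q $ 1 = 0"
    have "1 - \<i> * complex_of_real (Fv n (tt q) (vv q)) \<noteq> 0" by (simp add: complex_eq_iff)
    then have "A q $ 2 = 0" using A a by (simp add: vf_apply_cr)
    then show False using a nz by (simp add: vec_eq_iff forall_2)
  qed
  have "1 + (Fv n (tt q) (vv q))\<^sup>2 > 0" by (simp add: add_pos_nonneg)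
  then show "Re (hess (r_fun (n+3)) A A q) > 0 \<longleftrightarrow> levi_num n (tt q) (vv q) > 0"
    using * by (simp add: Re_hess_tangential[OF A] zero_less_divide_iff zero_less_mult_iff)
qed

section \<open>The Levi form near the origin\<close>

lemma smooth_on_vec_nth: "open S \<Longrightarrow> smooth_on f S \<Longrightarrow> smooth_on (\<lambda>p. f p $ i) S"
  by (rule smooth_on_linear[OF _ bounded_linear_vec_nth])

lemma smooth_on_of_real: "open S \<Longrightarrow> smooth_on f S \<Longrightarrow> smooth_on (\<lambda>p. complex_of_real (f p)) S"
  by (rule smooth_on_linear[OF _ bounded_linear_of_real])

lemma smooth_on_cnj: "open S \<Longrightarrow> smooth_on f S \<Longrightarrow> smooth_on (\<lambda>p. cnj (f p)) S"
  by (rule smooth_on_linear[OF _ bounded_linear_cnj])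

lemma smooth_on_Re: "open S \<Longrightarrow> smooth_on f S \<Longrightarrow> smooth_on (\<lambda>p. Re (f p)) S"
  by (rule smooth_on_linear[OF _ bounded_linear_Re])

lemma smooth_on_Im: "open S \<Longrightarrow> smooth_on f S \<Longrightarrow> smooth_on (\<lambda>p. Im (f p)) S"
  by (rule smooth_on_linear[OF _ bounded_linear_Im])

lemma bounded_linear_axis: "bounded_linear (\<lambda>a::complex. axis i a :: C2)"
proof -
  have "linear (\<lambda>a::complex. axis i a :: C2)"
    by (rule linearI) (auto simp: vec_eq_iff axis_def)
  then show ?thesis by (simp add: linear_linear)
qed

lemma smooth_on_tt: "open S \<Longrightarrow> smooth_on tt S"
  unfolding tt_alt[abs_def]
  by (intro smooth_on_add smooth_on_mult smooth_on_Re smooth_on_Im smooth_on_vec_nth smooth_on_ident)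

lemma smooth_on_vv: "open S \<Longrightarrow> smooth_on vv S"
  unfolding vv_def[abs_def] by (intro smooth_on_Im smooth_on_vec_nth smooth_on_ident)

lemmas smooth_intros = smooth_on_add smooth_on_diff smooth_on_mult smooth_on_power smooth_on_const

lemma smooth_on_F:
  assumes S: "open S"
  shows "smooth_on (\<lambda>p. Fpoly n (tt p) (vv p)) S" "smooth_on (\<lambda>p. Ft n (tt p) (vv p)) S"
    "smooth_on (\<lambda>p. Fv n (tt p) (vv p)) S" "smooth_on (\<lambda>p. Ftv n (tt p) (vv p)) S"
    "smooth_on (\<lambda>p. Fvv n (tt p)) S" "smooth_on (\<lambda>p. Fzz n (tt p) (vv p)) S"
  unfolding Fpoly_def Ft_def Fv_def Ftv_def Fvv_def Fzz_def
  by (intro smooth_intros smooth_on_tt smooth_on_vv S)+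

lemma smooth_on_r: "open S \<Longrightarrow> smooth_on (r_fun (n+3)) S"
  unfolding r_fun_eq[abs_def]
  by (intro smooth_intros smooth_on_F smooth_on_Re smooth_on_vec_nth smooth_on_ident)

text \<open>The field \<open>r\<^sub>w \<partial>\<^sub>z - r\<^sub>z \<partial>\<^sub>w\<close>. It
  annihilates \<open>r\<close> everywhere, not just on the boundary, and has no zeros.\<close>

definition L0 :: "nat \<Rightarrow> C2 \<Rightarrow> C2" where
  "L0 n p = axis 1 ((1 - \<i> * of_real (Fv n (tt p) (vv p))) / 2) - axis 2 (of_real (Ft n (tt p) (vv p)) * cnj (p $ 1))"

lemma L0_simps: "L0 n p $ 1 = (1 - \<i> * of_real (Fv n (tt p) (vv p))) / 2"
  "L0 n p $ 2 = - of_real (Ft n (tt p) (vv p)) * cnj (p $ 1)"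
  by (simp_all add: L0_def)

lemma smooth_on_L0:
  assumes "open S" shows "smooth_on (L0 n) S"
  unfolding L0_def[abs_def] divide_inverse
  by (intro smooth_on_diff smooth_on_linear[OF _ bounded_linear_axis] smooth_intros smooth_on_of_real
      smooth_on_cnj smooth_on_vec_nth smooth_on_ident smooth_on_F assms)

lemma L0_tangential: "vf_apply (L0 n) (cr n) q = 0"
  by (simp add: vf_apply_cr L0_simps)

lemma L0_nonzero: "L0 n q \<noteq> 0"
proof
  assume "L0 n q = 0"
  then have "L0 n q $ 1 = 0" by simp
  then show False by (simp add: L0_simps complex_eq_iff)
qed

lemma hol_tangential_L0: "open W \<Longrightarrow> p \<in> W \<Longrightarrow> hol_tangential (Omega (n+3)) (r_fun (n+3)) p W (L0 n)"
  by (simp add: hol_tangential_def smooth_on_L0 L0_tangential)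

lemma local_defining_function_r:
  assumes "p \<in> frontier (Omega (n+3))"
  shows "local_defining_function (Omega (n+3)) (r_fun (n+3)) UNIV p"
proof -
  have "frechet_derivative (r_fun (n+3)) (at q) \<noteq> (\<lambda>v. 0)" for q
  proof
    assume "frechet_derivative (r_fun (n+3)) (at q) = (\<lambda>v. 0)"
    then have "frechet_derivative (r_fun (n+3)) (at q) (real_dir 1) = 0" by simp
    then show False unfolding frechet_derivative_eqI[OF has_derivative_r] by simp
  qed
  then show ?thesis
    using assms smooth_on_D(1)[OF smooth_on_r[OF open_UNIV, of n], of 2]
    by (simp add: local_defining_function_def Omega_def)
qed

section \<open>Estimates for the coefficients and for the Levi form\<close>

lemma rc_bounds: "0 \<le> rc n j" "j > 0 \<Longrightarrow> rc n j \<le> 1"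
  by (auto simp: rc_def inverse_le_1_iff field_simps)

lemma rc_2_le: "rc n 2 \<le> 1/2"
  by (auto simp: rc_def field_simps)

text \<open>For these estimates \<open>t\<close> and \<open>v\<close> get equal weight: the leading
  part of \<open>F\<^sub>t\<close> is \<open>t ^ n\<close> times a quadratic form, those of the
  others follow the same pattern. The constant \<open>2 n + 6\<close> is the coefficient
  \<open>2 n + 5\<close> of the last power plus \<open>1\<close>.\<close>

lemma abs_bounds:
  assumes t: "0 \<le> t" "t \<le> 1" and v: "\<bar>v\<bar> \<le> 1"
  shows "\<bar>Ft n t v\<bar> \<le> (2*real n+6) * t ^ n * (t + \<bar>v\<bar>)\<^sup>2"
    "\<bar>Ftv n t v\<bar> \<le> 2 * t ^ n * (t + \<bar>v\<bar>)"
    "\<bar>Fv n t v\<bar> \<le> 2 * t ^ (n+1) * (t + \<bar>v\<bar>)"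
proof -
  have tn: "0 \<le> t ^ n" using t by simp
  have mul: "c * x \<le> x" if "c \<le> 1" "0 \<le> x" for c x :: real
    using mult_right_mono[OF that] by simp
  have a1: "\<bar>rc n 3 * t ^ (n+2)\<bar> \<le> t ^ n * (t * t)"
    using mul[of "rc n 3" "t ^ n * (t * t)"] rc_bounds(1)[of n 3] rc_bounds(2)[of 3 n] t
    by (simp add: abs_mult power_shift mult_ac)
  have a2: "\<bar>2 * rc n 2 * t ^ (n+1) * v\<bar> \<le> t ^ n * (t * \<bar>v\<bar>)"
    using mul[of "2 * rc n 2" "t ^ n * (t * \<bar>v\<bar>)"] rc_bounds(1)[of n 2] rc_bounds(2)[of 2 n] rc_2_le[of n] t
    by (simp add: abs_mult power_shift mult_ac)
  have "\<bar>rc n 1 * t ^ n * v\<^sup>2\<bar> \<le> t ^ n * v\<^sup>2"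
    using mul[of "rc n 1" "t ^ n * v\<^sup>2"] rc_bounds(1)[of n 1] rc_bounds(2)[of 1 n] t
    by (simp add: abs_mult mult_ac)
  then have a3: "\<bar>rc n 1 * t ^ n * v\<^sup>2\<bar> \<le> t ^ n * (v * v)"
    by (simp only: power2_eq_square)
  have "t ^ (2*n+4) \<le> t ^ (n+2)" using t by (intro power_decreasing) auto
  then have a4: "\<bar>(2*real n+5) * t ^ (2*n+4)\<bar> \<le> (2*real n+5) * (t ^ n * (t * t))"
    using t by (simp add: abs_mult power_shift(2) mult_ac)
  have "\<bar>Ft n t v\<bar> \<le> t ^ n * (t * t) + t ^ n * (t * \<bar>v\<bar>) + t ^ n * (v * v) + (2*real n+5) * (t ^ n * (t * t))"
    unfolding Ft_def using a1 a2 a3 a4 by linarith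
  also have "\<dots> = t ^ n * ((2*real n+6) * (t * t) + t * \<bar>v\<bar> + v * v)" by (simp add: algebra_simps)
  also have "\<dots> \<le> t ^ n * ((2*real n+6) * (t + \<bar>v\<bar>)\<^sup>2)"
  proof (rule mult_left_mono[OF _ tn])
    have "(t + \<bar>v\<bar>)\<^sup>2 = t * t + 2 * (t * \<bar>v\<bar>) + v * v" by (simp add: power2_eq_square algebra_simps)
    moreover have "0 \<le> t * \<bar>v\<bar>" "0 \<le> v * v" "0 \<le> n * (t * \<bar>v\<bar>)" "0 \<le> n * (v * v)" using t by simp_all
    ultimately show "(2*real n+6) * (t * t) + t * \<bar>v\<bar> + v * v \<le> (2*real n+6) * (t + \<bar>v\<bar>)\<^sup>2"
      by (simp add: algebra_simps)
  qed
  finally show "\<bar>Ft n t v\<bar> \<le> (2*real n+6) * t ^ n * (t + \<bar>v\<bar>)\<^sup>2" by (simp add: mult_ac)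
  have b1: "\<bar>- 2 * rc n 2 * t ^ (n+1)\<bar> \<le> 2 * (t ^ n * t)"
    using mul[of "rc n 2" "t ^ n * t"] rc_bounds(1)[of n 2] rc_bounds(2)[of 2 n] t by (simp add: abs_mult power_shift mult_ac)
  have b2: "\<bar>2 * rc n 1 * t ^ n * v\<bar> \<le> 2 * (t ^ n * \<bar>v\<bar>)"
    using mul[of "rc n 1" "t ^ n * \<bar>v\<bar>"] rc_bounds(1)[of n 1] rc_bounds(2)[of 1 n] t by (simp add: abs_mult power_shift mult_ac)
  show "\<bar>Ftv n t v\<bar> \<le> 2 * t ^ n * (t + \<bar>v\<bar>)"
    using b1 b2 unfolding Ftv_def by (simp add: algebra_simps)
  have sq: "(rc n j)\<^sup>2 \<le> 1" if "j > 0" for j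
    using rc_bounds(1)[of n j] rc_bounds(2)[of j n] that by (simp add: power_le_one)
  have c1: "\<bar>- 2 * (rc n 2)\<^sup>2 * t ^ (n+2)\<bar> \<le> 2 * (t ^ (n+1) * t)"
    using mul[of "(rc n 2)\<^sup>2" "t ^ n * t * t"] sq[of 2] t by (simp add: abs_mult power_shift mult_ac)
  have c2: "\<bar>2 * (rc n 1)\<^sup>2 * t ^ (n+1) * v\<bar> \<le> 2 * (t ^ (n+1) * \<bar>v\<bar>)"
    using mul[of "(rc n 1)\<^sup>2" "t ^ n * t * \<bar>v\<bar>"] sq[of 1] t by (simp add: abs_mult power_shift mult_ac)
  show "\<bar>Fv n t v\<bar> \<le> 2 * t ^ (n+1) * (t + \<bar>v\<bar>)"
    using c1 c2 unfolding Fv_def by (simp add: algebra_simps)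
qed

text \<open>This is the only summand of \<open>levi_num\<close> that can be negative. Compared with
  the factor \<open>t ^ n\<close> in \<open>Fzz\<close> it carries the extra factor
  \<open>t ^ (2*n+2)\<close>, which makes it absorbable.\<close>

lemma cross_term_bound:
  assumes t: "0 \<le> t" "t \<le> 1" and v: "\<bar>v\<bar> \<le> 1"
  shows "\<bar>2 * t * Ft n t v * Ftv n t v * Fv n t v\<bar> \<le> 16 * (n+3) * t ^ n * (t ^ (2*n+2) * (t + \<bar>v\<bar>) ^ 4)"
proof -
  have s: "0 \<le> t + \<bar>v\<bar>" using t by simp
  have "\<bar>Ft n t v\<bar> * \<bar>Ftv n t v\<bar> * \<bar>Fv n t v\<bar>
      \<le> ((2*real n+6) * t ^ n * (t + \<bar>v\<bar>)\<^sup>2) * (2 * t ^ n * (t + \<bar>v\<bar>)) * (2 * t ^ (n+1) * (t + \<bar>v\<bar>))"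
    using abs_bounds[OF assms, of n] s t by (intro mult_mono) auto
  then have "2 * t * (\<bar>Ft n t v\<bar> * \<bar>Ftv n t v\<bar> * \<bar>Fv n t v\<bar>)
      \<le> 2 * t * (((2*real n+6) * t ^ n * (t + \<bar>v\<bar>)\<^sup>2) * (2 * t ^ n * (t + \<bar>v\<bar>)) * (2 * t ^ (n+1) * (t + \<bar>v\<bar>)))"
    using t by (intro mult_left_mono) auto
  also have "\<dots> = 8 * (2*n+6) * t ^ n * (t ^ (2*n+2) * (t + \<bar>v\<bar>) ^ 4)"
  proof -
    have "t ^ (2*n+2) = t * t * (t ^ n * t ^ n)" by (simp add: power_add mult_2 power2_eq_square)
    then show ?thesis unfolding power4_eq_xxxx power2_eq_square power_shift(1) by (simp only: mult_ac) simp
  qed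
  finally show ?thesis using t by (simp add: abs_mult algebra_simps)
qed

lemma sum_power4_le: "(a + b) ^ 4 \<le> 8 * (a ^ 4 + b ^ 4)" for a b :: real
proof -
  have "(a + b)\<^sup>2 \<le> 2 * (a\<^sup>2 + b\<^sup>2)" for a b :: real
    using zero_le_power2[of "a - b"] by (simp add: power2_eq_square algebra_simps)
  from this[of a b] this[of "a\<^sup>2" "b\<^sup>2"]
  have 1: "(a + b)\<^sup>2 \<le> 2 * (a\<^sup>2 + b\<^sup>2)" and 2: "(a\<^sup>2 + b\<^sup>2)\<^sup>2 \<le> 2 * (a ^ 4 + b ^ 4)" by simp_all
  have "(a + b) ^ 4 = ((a + b)\<^sup>2)\<^sup>2" by simp
  also have "\<dots> \<le> (2 * (a\<^sup>2 + b\<^sup>2))\<^sup>2" using 1 by (intro power_mono) auto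
  also have "\<dots> \<le> 8 * (a ^ 4 + b ^ 4)" unfolding power_mult_distrib using 2 by simp
  finally show ?thesis .
qed

lemma Fvv_nonneg: "0 \<le> t \<Longrightarrow> 0 \<le> Fvv n t" by (simp add: Fvv_def)

lemma Fzz_nonneg: "0 \<le> t \<Longrightarrow> 0 \<le> Fzz n t v" by (simp add: Fzz_def)

text \<open>By \<open>t + |v| \<le> 2 t + |t - v|\<close> the cross term splits into two parts. The
  part from \<open>2 t\<close> is absorbed by the last power in \<open>Fzz\<close>, the part from
  \<open>|t - v|\<close> by the square; each gains a factor \<open>t\<close>, so small
  \<open>t\<close> suffices.\<close>

lemma levi_num_lower_bound:
  assumes t: "0 \<le> t" "t \<le> 1 / (4096 * (n+3))" and v: "\<bar>v\<bar> \<le> 1"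
  shows "levi_num n t v \<ge> t ^ n * ((t - v)\<^sup>2 + t ^ (n+4)) / 2"
proof -
  \<comment> \<open>\<open>K\<close> is the constant of the cross term. As
    \<open>8 * 2 ^ 4 = 128\<close> arises from the fourth power of the sum,
    \<open>256 * K * t \<le> 1\<close> lets the cross term use up at most half of the lower bound
    for \<open>Fzz\<close>; this is where \<open>4096 = 256 * 16\<close> comes from.\<close>
  define K where "K = 16 * (real n + 3)"
  have K: "K > 0" and tK: "256 * K * t \<le> 1" using t by (simp_all add: K_def field_simps add_pos_nonneg)
  have "1 / real (4096 * (n+3)) \<le> 1" by (simp add: field_simps)
  then have t1: "t \<le> 1" using t by linarith
  have d: "\<bar>t - v\<bar> \<le> 2" using t t1 v by linarith
  have "t + \<bar>v\<bar> \<le> 2 * t + \<bar>t - v\<bar>" using t by linarith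
  then have "(t + \<bar>v\<bar>) ^ 4 \<le> (2 * t + \<bar>t - v\<bar>) ^ 4" using t by (intro power_mono) auto
  also have "\<dots> \<le> 8 * ((2 * t) ^ 4 + \<bar>t - v\<bar> ^ 4)" by (rule sum_power4_le)
  also have "\<bar>t - v\<bar> ^ 4 \<le> 4 * (t - v)\<^sup>2"
  proof -
    have "\<bar>t - v\<bar> ^ 4 = \<bar>t - v\<bar>\<^sup>2 * (t - v)\<^sup>2" by (simp add: power4_eq_xxxx power2_eq_square)
    also have "\<dots> \<le> 2\<^sup>2 * (t - v)\<^sup>2" using d by (intro mult_right_mono power_mono) auto
    finally show ?thesis by simp
  qed
  finally have s4: "(t + \<bar>v\<bar>) ^ 4 \<le> 128 * t ^ 4 + 32 * (t - v)\<^sup>2" by (simp add: power_mult_distrib)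
  have "t ^ (2*n+2) * (t + \<bar>v\<bar>) ^ 4 \<le> t ^ (2*n+2) * (128 * t ^ 4 + 32 * (t - v)\<^sup>2)"
    using s4 t by (intro mult_left_mono) auto
  also have "\<dots> = 128 * (t ^ (n+1) * (t * t ^ (n+4))) + 32 * (t ^ (2*n+2) * (t - v)\<^sup>2)"
  proof -
    have "t ^ ((n+1) + Suc (n+4)) = t ^ ((2*n+2) + 4)" by (rule arg_cong[where f="power t"]) simp
    then have "t ^ (n+1) * (t * t ^ (n+4)) = t ^ (2*n+2) * t ^ 4" by (simp only: power_add power_Suc)
    then show ?thesis by (simp only: distrib_left mult_ac)
  qed
  also have "t ^ (n+1) * (t * t ^ (n+4)) \<le> 1 * (t * t ^ (n+4))"
    using t t1 by (intro mult_right_mono power_le_one) auto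
  also have "t ^ (2*n+2) * (t - v)\<^sup>2 \<le> t * (t - v)\<^sup>2"
    using t t1 power_decreasing[of 1 "2*n+2" t] by (intro mult_right_mono) auto
  finally have "t ^ (2*n+2) * (t + \<bar>v\<bar>) ^ 4 \<le> 128 * (t * t ^ (n+4)) + 32 * (t * (t - v)\<^sup>2)" by simp
  then have "K * (t ^ (2*n+2) * (t + \<bar>v\<bar>) ^ 4) \<le> K * (128 * (t * t ^ (n+4)) + 32 * (t * (t - v)\<^sup>2))"
    using K by (intro mult_left_mono) auto
  also have "\<dots> = (256 * K * t) * t ^ (n+4) / 2 + (64 * K * t) * (t - v)\<^sup>2 / 2" by (simp add: algebra_simps)
  also have "\<dots> \<le> 1 * t ^ (n+4) / 2 + 1 * (t - v)\<^sup>2 / 2"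
    using tK K t by (intro add_mono divide_right_mono mult_right_mono) auto
  finally have "t ^ n * (K * (t ^ (2*n+2) * (t + \<bar>v\<bar>) ^ 4)) \<le> t ^ n * (t ^ (n+4) / 2 + (t - v)\<^sup>2 / 2)"
    using t by (intro mult_left_mono) auto
  then have cross: "\<bar>2 * t * Ft n t v * Ftv n t v * Fv n t v\<bar> \<le> t ^ n * (t ^ (n+4) / 2 + (t - v)\<^sup>2 / 2)"
    using cross_term_bound[OF t(1) t1 v, of n] by (simp add: K_def algebra_simps)
  have "t ^ n * ((t - v)\<^sup>2 + t ^ (n+4)) \<le> Fzz n t v"
  proof -
    have "1 * t ^ (2*n+4) \<le> (2*real n+5)\<^sup>2 * t ^ (2*n+4)"
      using t by (intro mult_right_mono) (auto simp: power2_eq_square algebra_simps add_nonneg_nonneg)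
    moreover have "t ^ n * t ^ (n+4) = t ^ (2*n+4)" unfolding power_add[symmetric] by (rule arg_cong[where f="power t"]) simp
    ultimately show ?thesis unfolding Fzz_def distrib_left by linarith
  qed
  moreover have "0 \<le> (Fv n t v)\<^sup>2 * Fzz n t v" "0 \<le> Fvv n t * t * (Ft n t v)\<^sup>2"
    using t Fzz_nonneg[of t n v] Fvv_nonneg[of t n] by simp_all
  moreover have "2 * t * Ft n t v * Ftv n t v * Fv n t v \<le> t ^ n * ((t - v)\<^sup>2 + t ^ (n+4)) / 2"
    using cross by (simp add: distrib_left add_divide_distrib)
  moreover have "(1 + (Fv n t v)\<^sup>2) * Fzz n t v = Fzz n t v + (Fv n t v)\<^sup>2 * Fzz n t v"
    by (simp add: distrib_right)
  ultimately show ?thesis unfolding levi_num_def by linarith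
qed

lemma levi_num_nonneg:
  assumes "0 \<le> t" "t \<le> 1 / (4096 * (n+3))" "\<bar>v\<bar> \<le> 1"
  shows "levi_num n t v \<ge> 0"
  by (rule order_trans[OF _ levi_num_lower_bound[OF assms]]) (simp add: assms)

text \<open>For \<open>t > 0\<close> the lower bound is positive because of its second summand. At
  \<open>t = 0\<close> only \<open>t ^ n * v\<^sup>2\<close> can survive, and it does so exactly for
  \<open>n = 0\<close>, where \<open>0 ^ 0 = 1\<close>: this is the difference between
  \<open>k = 3\<close> and \<open>k > 3\<close>.\<close>

lemma levi_num_pos_iff:
  assumes "0 \<le> t" "t \<le> 1 / (4096 * (n+3))" "\<bar>v\<bar> \<le> 1"
  shows "levi_num n t v > 0 \<longleftrightarrow> t \<noteq> 0 \<or> (n = 0 \<and> v \<noteq> 0)"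
proof (cases "t = 0")
  case True
  have "levi_num n 0 v = 0" if "n \<noteq> 0 \<or> v = 0"
    using that by (cases n) (auto simp: levi_num_def Fzz_def Fvv_def)
  moreover have "levi_num n 0 v > 0" if "n = 0" "v \<noteq> 0"
  proof -
    have "v\<^sup>2 / 2 \<le> levi_num n 0 v" using that levi_num_lower_bound[OF assms] True by simp
    moreover have "0 < v\<^sup>2" using that by simp
    ultimately show ?thesis by linarith
  qed
  ultimately show ?thesis using True by fastforce
next
  case False
  then have "0 < t ^ n * ((t - v)\<^sup>2 + t ^ (n+4)) / 2" using assms by (simp add: add_nonneg_pos)
  then show ?thesis using levi_num_lower_bound[OF assms] False by linarith
qed

text \<open>The range in which \<open>levi_num\<close> is controlled. The coordinate
  \<open>u\<close> is left free, since the Levi form does not depend on it.\<close>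

definition U0 :: "nat \<Rightarrow> C2 set" where
  "U0 n = {p. tt p < 1 / (4096 * (n+3)) \<and> \<bar>vv p\<bar> < 1}"

lemma open_U0: "open (U0 n)"
proof -
  have "continuous_on UNIV tt" "continuous_on UNIV vv"
    using smooth_on_D(2)[OF smooth_on_tt] smooth_on_D(2)[OF smooth_on_vv] by auto
  then show ?thesis unfolding U0_def
    by (intro open_Collect_conj open_Collect_less continuous_intros) auto
qed

lemma zero_in_U0: "0 \<in> U0 n" by (simp add: U0_def tt_def vv_def)

lemma Fpoly_0: "Fpoly n 0 v = 0"
  by (simp add: Fpoly_def power_0_left)

lemma zero_in_frontier: "0 \<in> frontier (Omega (n+3))"
  by (simp add: frontier_Omega r_fun_eq tt_def vv_def Fpoly_0)

lemma tt_nonneg: "0 \<le> tt p" by (simp add: tt_def)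

lemma pseudoconvex_at_U0:
  assumes p: "p \<in> frontier (Omega (n+3)) \<inter> U0 n"
  shows "pseudoconvex_at (Omega (n+3)) (r_fun (n+3)) p"
  unfolding pseudoconvex_at_def
proof (intro conjI allI impI)
  show "\<exists>V. local_defining_function (Omega (n+3)) (r_fun (n+3)) V p"
    using local_defining_function_r[of p n] p by blast
  fix W L assume H: "hol_tangential (Omega (n+3)) (r_fun (n+3)) p W L"
  have "\<forall>\<^sub>F q in nhds p. q \<in> U0 n \<inter> W"
    using H p open_U0 by (intro eventually_nhds_in_open) (auto simp: hol_tangential_def)
  then show "\<forall>\<^sub>F q in nhds p. q \<in> frontier (Omega (n+3)) \<longrightarrow> 0 \<le> Re (hess (r_fun (n+3)) L L q)"
  proof (rule eventually_mono, intro impI)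
    fix q assume q: "q \<in> U0 n \<inter> W" "q \<in> frontier (Omega (n+3))"
    then have "vf_apply L (cr n) q = 0" using H by (simp add: hol_tangential_def)
    moreover have "levi_num n (tt q) (vv q) \<ge> 0"
      using q by (intro levi_num_nonneg tt_nonneg) (auto simp: U0_def)
    ultimately show "0 \<le> Re (hess (r_fun (n+3)) L L q)"
      by (simp add: Re_hess_tangential)
  qed
qed

text \<open>Strict pseudoconvexity at \<open>p\<close> amounts to \<open>levi_num\<close> being
  positive at \<open>p\<close>: the field \<open>L0\<close> tests necessity, and sufficiency holds
  because positivity persists near \<open>p\<close>.\<close>

lemma weakly_pseudoconvex_at_U0:
  assumes p: "p \<in> frontier (Omega (n+3)) \<inter> U0 n"
  shows "weakly_pseudoconvex_at (Omega (n+3)) (r_fun (n+3)) p \<longleftrightarrow> p $ 1 = 0 \<and> (n = 0 \<longrightarrow> p $ 2 = 0)"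
proof -
  have pos: "levi_num n (tt q) (vv q) > 0 \<longleftrightarrow> q $ 1 \<noteq> 0 \<or> (n = 0 \<and> vv q \<noteq> 0)" if "q \<in> U0 n" for q
    using that levi_num_pos_iff[of "tt q" n "vv q"] tt_nonneg[of q] by (simp add: U0_def) (simp add: tt_def)
  \<comment> \<open>At \<open>z = 0\<close> the equation \<open>r = 0\<close> reads
    \<open>u = 0\<close>, so only \<open>v\<close> remains of \<open>w\<close>.\<close>
  have zero: "p $ 2 = 0 \<longleftrightarrow> vv p = 0" if "p $ 1 = 0"
    using p that by (simp add: frontier_Omega r_fun_eq tt_def vv_def Fpoly_0 complex_eq_iff)
  have "strictly_pseudoconvex_at (Omega (n+3)) (r_fun (n+3)) p \<longleftrightarrow> levi_num n (tt p) (vv p) > 0"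
  proof
    assume S: "strictly_pseudoconvex_at (Omega (n+3)) (r_fun (n+3)) p"
    then have "\<forall>\<^sub>F q in nhds p. q \<in> frontier (Omega (n+3)) \<longrightarrow> 0 < Re (hess (r_fun (n+3)) (L0 n) (L0 n) q)"
      using hol_tangential_L0[of UNIV p n] L0_nonzero[of n]
      unfolding strictly_pseudoconvex_at_def nonvanishing_on_def by blast
    then have "0 < Re (hess (r_fun (n+3)) (L0 n) (L0 n) p)"
      using eventually_nhds_x_imp_x p by fastforce
    then show "levi_num n (tt p) (vv p) > 0"
      using Re_hess_tangential_nonzero(2)[OF L0_tangential L0_nonzero] by blast
  next
    assume P: "levi_num n (tt p) (vv p) > 0"
    show "strictly_pseudoconvex_at (Omega (n+3)) (r_fun (n+3)) p"
      unfolding strictly_pseudoconvex_at_def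
    proof (intro conjI allI impI)
      show "pseudoconvex_at (Omega (n+3)) (r_fun (n+3)) p" using p by (rule pseudoconvex_at_U0)
      fix W L assume H: "hol_tangential (Omega (n+3)) (r_fun (n+3)) p W L \<and> nonvanishing_on L W"
      \<comment> \<open>Inside \<open>U0\<close> this is the set where \<open>levi_num\<close> is
        positive, in a form whose openness is evident.\<close>
      define G where "G = {q :: C2. q $ 1 \<noteq> 0 \<or> (n = 0 \<and> vv q \<noteq> 0)}"
      have "continuous_on UNIV vv" using smooth_on_D(2)[OF smooth_on_vv] by auto
      moreover have "continuous_on UNIV (\<lambda>q::C2. q $ 1)"
        by (intro continuous_intros)
      ultimately have "open G" unfolding G_def
        by (intro open_Collect_disj open_Collect_conj open_Collect_neq continuous_intros) auto
      moreover have "p \<in> G" using P pos[of p] p by (simp add: G_def)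
      ultimately have "\<forall>\<^sub>F q in nhds p. q \<in> U0 n \<inter> W \<inter> G"
        using H p open_U0 by (intro eventually_nhds_in_open) (auto simp: hol_tangential_def)
      then show "\<forall>\<^sub>F q in nhds p. q \<in> frontier (Omega (n+3)) \<longrightarrow> 0 < Re (hess (r_fun (n+3)) L L q)"
      proof (rule eventually_mono, intro impI)
        fix q assume q: "q \<in> U0 n \<inter> W \<inter> G" "q \<in> frontier (Omega (n+3))"
        then have "vf_apply L (cr n) q = 0" "L q \<noteq> 0" using H by (auto simp: hol_tangential_def nonvanishing_on_def)
        moreover have "levi_num n (tt q) (vv q) > 0" using q pos[of q] by (simp add: G_def)
        ultimately show "0 < Re (hess (r_fun (n+3)) L L q)"
          using Re_hess_tangential_nonzero(2) by blast
      qed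
    qed
  qed
  then show ?thesis
    using pseudoconvex_at_U0[OF p] pos[of p] p zero unfolding weakly_pseudoconvex_at_def by auto
qed

section \<open>The type at the origin\<close>

text \<open>Order of vanishing at \<open>0\<close> with respect to the operators \<open>L\<close> and its conjugate. By the Leibniz
  rule it is additive on products, and for tangential \<open>L\<close> it only depends on the values on the
  boundary.\<close>

primrec vanish_order :: "(C2 \<Rightarrow> C2) \<Rightarrow> C2 set \<Rightarrow> nat \<Rightarrow> (C2 \<Rightarrow> complex) \<Rightarrow> bool" where
  "vanish_order L W 0 f \<longleftrightarrow> smooth_on f W"
| "vanish_order L W (Suc m) f \<longleftrightarrow> smooth_on f W \<and> f 0 = 0 \<and>
     vanish_order L W m (vf_apply L f) \<and> vanish_order L W m (vf_conj_apply L f)"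

locale tangential_field =
  fixes n :: nat and W :: "C2 set" and L :: "C2 \<Rightarrow> C2"
  assumes W: "open W" "0 \<in> W" and smooth_L: "smooth_on L W"
    and tangential: "q \<in> frontier (Omega (n+3)) \<inter> W \<Longrightarrow> vf_apply L (cr n) q = 0"
begin

abbreviation Vo :: "nat \<Rightarrow> (C2 \<Rightarrow> complex) \<Rightarrow> bool" where "Vo \<equiv> vanish_order L W"

lemma smooth_vf_apply:
  assumes f: "smooth_on f W"
  shows "smooth_on (vf_apply L f) W" "smooth_on (vf_conj_apply L f) W"
proof -
  have 1: "smooth_on (\<lambda>p. L p $ j) W" "smooth_on (\<lambda>p. cnj (L p $ j)) W" for j
    by (intro smooth_on_vec_nth smooth_on_cnj W smooth_L)+
  have "smooth_on (d_z j f) W" "smooth_on (d_zbar j f) W" for j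
    unfolding d_z_def[abs_def] d_zbar_def[abs_def] divide_inverse
    by (intro smooth_intros smooth_on_D(4)[OF f] W)+
  with 1 show "smooth_on (vf_apply L f) W" "smooth_on (vf_conj_apply L f) W"
    unfolding vf_apply_def[abs_def] vf_conj_apply_def[abs_def] UNIV_2_sum by (auto intro!: smooth_intros W)
qed

lemma Vo_smooth: "Vo m f \<Longrightarrow> smooth_on f W" by (cases m) auto

lemma vf_apply_add:
  assumes "smooth_on f W" "smooth_on g W" "p \<in> W"
  shows "vf_apply L (\<lambda>x. f x + g x) p = vf_apply L f p + vf_apply L g p"
    "vf_conj_apply L (\<lambda>x. f x + g x) p = vf_conj_apply L f p + vf_conj_apply L g p"
proof -
  have "(f has_derivative frechet_derivative f (at p)) (at p)" "(g has_derivative frechet_derivative g (at p)) (at p)"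
    using assms by (simp_all add: smooth_on_D(3) flip: frechet_derivative_works)
  note d = frechet_derivative_eqI[OF has_derivative_add[OF this]]
  show "vf_apply L (\<lambda>x. f x + g x) p = vf_apply L f p + vf_apply L g p"
    "vf_conj_apply L (\<lambda>x. f x + g x) p = vf_conj_apply L f p + vf_conj_apply L g p"
    unfolding vf_apply_def vf_conj_apply_def UNIV_2_sum d_z_def d_zbar_def d by (simp_all add: field_simps)
qed

lemma vf_apply_mult:
  assumes "smooth_on f W" "smooth_on g W" "p \<in> W"
  shows "vf_apply L (\<lambda>x. f x * g x) p = vf_apply L f p * g p + f p * vf_apply L g p"
    "vf_conj_apply L (\<lambda>x. f x * g x) p = vf_conj_apply L f p * g p + f p * vf_conj_apply L g p"
proof -
  have "(f has_derivative frechet_derivative f (at p)) (at p)" "(g has_derivative frechet_derivative g (at p)) (at p)"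
    using assms by (simp_all add: smooth_on_D(3) flip: frechet_derivative_works)
  note d = frechet_derivative_eqI[OF has_derivative_mult[OF this]]
  show "vf_apply L (\<lambda>x. f x * g x) p = vf_apply L f p * g p + f p * vf_apply L g p"
    "vf_conj_apply L (\<lambda>x. f x * g x) p = vf_conj_apply L f p * g p + f p * vf_conj_apply L g p"
    unfolding vf_apply_def vf_conj_apply_def UNIV_2_sum d_z_def d_zbar_def d by (simp_all add: field_simps)
qed

lemma vf_apply_const: "vf_apply L (\<lambda>x. c) = (\<lambda>p. 0)" "vf_conj_apply L (\<lambda>x. c) = (\<lambda>p. 0)"
  by (simp_all add: fun_eq_iff vf_apply_def vf_conj_apply_def d_z_def d_zbar_def)

lemma vf_apply_cnj:
  assumes "smooth_on f W" "p \<in> W"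
  shows "vf_apply L (\<lambda>x. cnj (f x)) p = cnj (vf_conj_apply L f p)"
    "vf_conj_apply L (\<lambda>x. cnj (f x)) p = cnj (vf_apply L f p)"
proof -
  have "(f has_derivative frechet_derivative f (at p)) (at p)"
    using assms by (simp_all add: smooth_on_D(3) flip: frechet_derivative_works)
  note d = frechet_derivative_eqI[OF bounded_linear.has_derivative[OF bounded_linear_cnj this]]
  show "vf_apply L (\<lambda>x. cnj (f x)) p = cnj (vf_conj_apply L f p)"
    "vf_conj_apply L (\<lambda>x. cnj (f x)) p = cnj (vf_apply L f p)"
    unfolding vf_apply_def vf_conj_apply_def UNIV_2_sum d_z_def d_zbar_def d by simp_all
qed

text \<open>The difference \<open>f - g\<close> vanishes on the boundary, so the tangential
  derivatives of \<open>f\<close> and \<open>g\<close> agree there and the induction continues with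
  them. The value at \<open>0\<close> is covered because \<open>0\<close> is a boundary
  point.\<close>

lemma Vo_cong:
  assumes "Vo m f" "smooth_on g W" "\<And>q. q \<in> frontier (Omega (n+3)) \<inter> W \<Longrightarrow> f q = g q"
  shows "Vo m g"
  using assms
proof (induction m arbitrary: f g)
  case 0
  then show ?case by simp
next
  case (Suc m)
  have sf: "smooth_on f W" using Suc.prems(1) by simp
  have sn: "smooth_on (\<lambda>x. - 1 * g x) W" by (intro smooth_intros W Suc.prems(2))
  have "vf_apply L f q = vf_apply L g q \<and> vf_conj_apply L f q = vf_conj_apply L g q"
    if q: "q \<in> frontier (Omega (n+3)) \<inter> W" for q
  proof -
    have "(\<lambda>x. f x + - 1 * g x) differentiable (at q)"
      using smooth_on_D(3)[OF smooth_on_add[OF W(1) sf sn]] q by blast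
    note v = vf_apply_vanishing_on_boundary[OF this W(1), where A=L and n=n]
    have "vf_apply L (\<lambda>x. f x + - 1 * g x) q = 0" "vf_conj_apply L (\<lambda>x. f x + - 1 * g x) q = 0"
      using v Suc.prems(3) q tangential by auto
    then show ?thesis
      using vf_apply_add[OF sf sn, of q] vf_apply_mult[OF smooth_on_const Suc.prems(2), of q "-1"] q
      by (simp add: vf_apply_const)
  qed
  moreover have "g 0 = 0" using Suc.prems zero_in_frontier W by auto
  ultimately show ?case
    using Suc.prems Suc.IH[of "vf_apply L f" "vf_apply L g"] Suc.IH[of "vf_conj_apply L f" "vf_conj_apply L g"]
      smooth_vf_apply by auto
qed

lemma Vo_Suc: "Vo (Suc m) f \<Longrightarrow> Vo m f"
proof (induction m arbitrary: f)
  case 0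
  then show ?case by simp
next
  case (Suc m)
  have "smooth_on f W" "f 0 = 0" "Vo (Suc m) (vf_apply L f)" "Vo (Suc m) (vf_conj_apply L f)"
    using Suc.prems unfolding vanish_order.simps(2)[of L W "Suc m" f] by blast+
  then show ?case using Suc.IH unfolding vanish_order.simps(2)[of L W m f] by blast
qed

lemma Vo_mono: "Vo m f \<Longrightarrow> m' \<le> m \<Longrightarrow> Vo m' f"
proof (induction m)
  case 0
  then show ?case by simp
next
  case (Suc m)
  then show ?case by (metis Vo_Suc le_Suc_eq)
qed

lemma Vo_add: "Vo m f \<Longrightarrow> Vo m g \<Longrightarrow> Vo m (\<lambda>x. f x + g x)"
proof (induction m arbitrary: f g)
  case 0
  then show ?case by (simp add: smooth_on_add W)
next
  case (Suc m)
  have s: "smooth_on f W" "smooth_on g W" using Suc.prems by simp_all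
  have s': "smooth_on (\<lambda>x. f x + g x) W" using s by (simp add: smooth_on_add W)
  have "Vo m (vf_apply L (\<lambda>x. f x + g x))"
    by (rule Vo_cong[of _ "\<lambda>p. vf_apply L f p + vf_apply L g p"])
      (use Suc s s' in \<open>auto simp: vf_apply_add smooth_vf_apply\<close>)
  moreover have "Vo m (vf_conj_apply L (\<lambda>x. f x + g x))"
    by (rule Vo_cong[of _ "\<lambda>p. vf_conj_apply L f p + vf_conj_apply L g p"])
      (use Suc s s' in \<open>auto simp: vf_apply_add smooth_vf_apply\<close>)
  ultimately show ?case using Suc.prems s' by simp
qed

lemma Vo_mult: "Vo m f \<Longrightarrow> Vo m' g \<Longrightarrow> Vo (m + m') (\<lambda>x. f x * g x)"
\<comment> \<open>Each Leibniz term lowers only one of the two orders, so the sum is the quantity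
  that decreases.\<close>
proof (induction "m + m'" arbitrary: m m' f g)
  case 0
  then show ?case by (simp add: smooth_on_mult W)
next
  case (Suc N)
  have s: "smooth_on f W" "smooth_on g W" using Suc.prems Vo_smooth by blast+
  have s': "smooth_on (\<lambda>x. f x * g x) W" using s by (simp add: smooth_on_mult W)
  \<comment> \<open>For \<open>m = 0\<close> a derivative of \<open>f\<close> has no order left to
    lose, but then \<open>g\<close> alone has order \<open>Suc N\<close>, which is more than
    required.\<close>
  have left: "Vo N (\<lambda>x. h x * g x)" if h: "m > 0 \<Longrightarrow> Vo (m - 1) h" "smooth_on h W" for h
  proof (cases "m = 0")
    case True
    then have "Vo N g" using Suc by (metis Vo_Suc add_0)
    then have "Vo (0 + N) (\<lambda>x. h x * g x)" using h by (intro Suc.hyps(1)) auto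
    then show ?thesis by simp
  next
    case False
    have "Vo (m - 1 + m') (\<lambda>x. h x * g x)" using h False Suc by (intro Suc.hyps(1)) auto
    moreover have "m - 1 + m' = N" using False Suc.hyps(2) by simp
    ultimately show ?thesis by simp
  qed
  have right: "Vo N (\<lambda>x. f x * h x)" if h: "m' > 0 \<Longrightarrow> Vo (m' - 1) h" "smooth_on h W" for h
  proof (cases "m' = 0")
    case True
    then have "Vo N f" using Suc by (metis Vo_Suc add_0_right)
    then have "Vo (N + 0) (\<lambda>x. f x * h x)" using h by (intro Suc.hyps(1)) auto
    then show ?thesis by simp
  next
    case False
    have "Vo (m + (m' - 1)) (\<lambda>x. f x * h x)" using h False Suc by (intro Suc.hyps(1)) auto
    moreover have "m + (m' - 1) = N" using False Suc.hyps(2) by simp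
    ultimately show ?thesis by simp
  qed
  have d: "k > 0 \<Longrightarrow> Vo (k - 1) (vf_apply L h) \<and> Vo (k - 1) (vf_conj_apply L h)" if "Vo k h" for k h
    using that by (cases k) auto
  have "Vo N (vf_apply L (\<lambda>x. f x * g x))"
    by (rule Vo_cong[of _ "\<lambda>p. vf_apply L f p * g p + f p * vf_apply L g p"])
      (use s s' d Suc.prems in \<open>auto simp: vf_apply_mult smooth_vf_apply intro!: Vo_add left right\<close>)
  moreover have "Vo N (vf_conj_apply L (\<lambda>x. f x * g x))"
    by (rule Vo_cong[of _ "\<lambda>p. vf_conj_apply L f p * g p + f p * vf_conj_apply L g p"])
      (use s s' d Suc.prems in \<open>auto simp: vf_apply_mult smooth_vf_apply intro!: Vo_add left right\<close>)
  moreover have "f 0 * g 0 = 0"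
    using Suc.prems Suc.hyps(2) by (cases m; cases m') auto
  ultimately show ?case using s' unfolding Suc.hyps(2)[symmetric] by simp
qed

lemma Vo_mult_smooth: "smooth_on f W \<Longrightarrow> Vo m g \<Longrightarrow> Vo m (\<lambda>x. f x * g x)"
  using Vo_mult[of 0 f m g] by simp

lemma Vo_diff: "Vo m f \<Longrightarrow> Vo m g \<Longrightarrow> Vo m (\<lambda>x. f x - g x)"
  using Vo_add[of m f "\<lambda>x. - 1 * g x"] Vo_mult_smooth[OF smooth_on_const, of m g "-1"] by simp

lemma Vo_cnj: "Vo m f \<Longrightarrow> Vo m (\<lambda>x. cnj (f x))"
proof (induction m arbitrary: f)
  case 0
  then show ?case by (simp add: smooth_on_cnj W)
next
  case (Suc m)
  have s: "smooth_on f W" using Suc.prems by simp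
  have s': "smooth_on (\<lambda>x. cnj (f x)) W" using s by (simp add: smooth_on_cnj W)
  have "Vo m (vf_apply L (\<lambda>x. cnj (f x)))"
    by (rule Vo_cong[of _ "\<lambda>p. cnj (vf_conj_apply L f p)"])
      (use Suc s s' in \<open>auto simp: vf_apply_cnj smooth_vf_apply\<close>)
  moreover have "Vo m (vf_conj_apply L (\<lambda>x. cnj (f x)))"
    by (rule Vo_cong[of _ "\<lambda>p. cnj (vf_apply L f p)"])
      (use Suc s s' in \<open>auto simp: vf_apply_cnj smooth_vf_apply\<close>)
  ultimately show ?case using Suc.prems s' by simp
qed

lemma Vo_power: "Vo m f \<Longrightarrow> Vo (k * m) (\<lambda>x. f x ^ k)"
  by (induction k) (auto intro: Vo_mult simp del: vanish_order.simps(2))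

lemma iter_deriv_Cons: "iter_deriv L (b # bs) f = iter_deriv L bs (if b then vf_apply L f else vf_conj_apply L f)"
  by (simp add: iter_deriv_def)

lemma iter_deriv_Vo: "Vo m f \<Longrightarrow> length bs < m \<Longrightarrow> iter_deriv L bs f 0 = 0"
proof (induction bs arbitrary: m f)
  case Nil
  then show ?case by (cases m) (auto simp: iter_deriv_def)
next
  case (Cons b bs)
  then show ?case by (cases m) (auto simp: iter_deriv_Cons)
qed

section \<open>Monomials in \<open>z\<close> and its conjugate under iterated derivatives\<close>

lemma smooth_coordinate: "smooth_on (\<lambda>p::C2. p $ i) W"
  by (intro smooth_on_vec_nth smooth_on_ident W)

lemma has_derivative_coordinate: "((\<lambda>p::C2. p $ i) has_derivative (\<lambda>h. h $ i)) (at p)"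
  by (rule has_derivative_vec_nth[OF has_derivative_ident])

lemma Vo_z: "Vo 1 (\<lambda>p. p $ 1)" "Vo 1 (\<lambda>p. cnj (p $ 1))"
proof -
  show z: "Vo 1 (\<lambda>p. p $ 1)" by (simp add: smooth_coordinate smooth_vf_apply)
  show "Vo 1 (\<lambda>p. cnj (p $ 1))" by (rule Vo_cnj[OF z])
qed

lemma Vo_monomial: "Vo (a + b) (\<lambda>p. c * p $ 1 ^ a * cnj (p $ 1) ^ b)"
  using Vo_mult_smooth[OF smooth_on_const Vo_mult[OF Vo_power[OF Vo_z(1), of a] Vo_power[OF Vo_z(2), of b]], of c]
  by (simp add: mult.assoc)

lemma vf_apply_monomial:
  "vf_apply L (\<lambda>p. c * p $ 1 ^ a * cnj (p $ 1) ^ b) p = L p $ 1 * (c * a * p $ 1 ^ (a-1) * cnj (p $ 1) ^ b)"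
  "vf_conj_apply L (\<lambda>p. c * p $ 1 ^ a * cnj (p $ 1) ^ b) p = cnj (L p $ 1) * (c * b * p $ 1 ^ a * cnj (p $ 1) ^ (b-1))"
proof -
  have d: "((\<lambda>p::C2. c * p $ 1 ^ a * cnj (p $ 1) ^ b) has_derivative
     (\<lambda>h. c * a * p $ 1 ^ (a-1) * cnj (p $ 1) ^ b * h $ 1 + c * b * p $ 1 ^ a * cnj (p $ 1) ^ (b-1) * cnj (h $ 1))) (at p)"
    by (rule has_derivative_eq_rhs, (rule derivative_intros has_derivative_coordinate)+) (simp add: fun_eq_iff algebra_simps)
  show "vf_apply L (\<lambda>p. c * p $ 1 ^ a * cnj (p $ 1) ^ b) p = L p $ 1 * (c * a * p $ 1 ^ (a-1) * cnj (p $ 1) ^ b)"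
    "vf_conj_apply L (\<lambda>p. c * p $ 1 ^ a * cnj (p $ 1) ^ b) p = cnj (L p $ 1) * (c * b * p $ 1 ^ a * cnj (p $ 1) ^ (b-1))"
    unfolding vf_apply_def vf_conj_apply_def UNIV_2_sum d_z_eqI[OF d] d_zbar_eqI[OF d] by (simp_all add: algebra_simps)
qed

text \<open>Freezing the coefficient of \<open>L\<close> at the origin costs one order of vanishing,
  which is what makes leading terms computable for an arbitrary field.\<close>

lemma Vo_L1_diff: "Vo 1 (\<lambda>p. L p $ 1 - L 0 $ 1)"
proof -
  have "smooth_on (\<lambda>p. L p $ 1 - L 0 $ 1) W" by (intro smooth_intros smooth_on_vec_nth smooth_L W)
  then show ?thesis by (simp add: smooth_vf_apply)
qed

text \<open>Modulo higher order, the conjugate field turns \<open>zbar ^ (b+1)\<close> into the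
  nonzero constant \<open>(b+1) * cnj (L 0 $ 1)\<close> times \<open>zbar ^ b\<close>. The error
  keeps one order more than the leading term, so after all derivatives only a nonzero constant
  remains at \<open>0\<close>.\<close>

lemma iter_deriv_leading_conj:
  assumes L1: "L 0 $ 1 \<noteq> 0"
  shows "smooth_on f W \<Longrightarrow> c \<noteq> 0 \<Longrightarrow> Vo (b + 1) (\<lambda>p. f p - c * cnj (p $ 1) ^ b) \<Longrightarrow>
    iter_deriv L (replicate b False) f 0 \<noteq> 0"
proof (induction b arbitrary: f c)
  case 0
  then show ?case by (simp add: iter_deriv_def)
next
  case (Suc b)
  define c' where "c' = c * of_nat (Suc b) * cnj (L 0 $ 1)"
  have c': "c' \<noteq> 0" using L1 Suc.prems by (simp add: c'_def del: of_nat_Suc)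
  have sm: "smooth_on (\<lambda>p. c * p $ 1 ^ 0 * cnj (p $ 1) ^ Suc b) W" by (rule Vo_smooth[OF Vo_monomial])
  have sd: "smooth_on (\<lambda>p. f p - c * cnj (p $ 1) ^ Suc b) W" using Suc.prems(3) Vo_smooth by blast
  have 1: "Vo (b + 1) (vf_conj_apply L (\<lambda>p. f p - c * cnj (p $ 1) ^ Suc b))"
    using Suc.prems(3) by simp
  have 2: "Vo (1 + (0 + b)) (\<lambda>p. cnj (L p $ 1 - L 0 $ 1) * (c * of_nat (Suc b) * p $ 1 ^ 0 * cnj (p $ 1) ^ b))"
    by (intro Vo_mult Vo_cnj Vo_L1_diff Vo_monomial)
  have "Vo (b + 1) (\<lambda>p. vf_conj_apply L f p - c' * cnj (p $ 1) ^ b)"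
  proof (rule Vo_cong[OF Vo_add[OF 1]])
    show "Vo (b + 1) (\<lambda>p. cnj (L p $ 1 - L 0 $ 1) * (c * of_nat (Suc b) * p $ 1 ^ 0 * cnj (p $ 1) ^ b))"
      using 2 by (simp add: add.commute)
    show "smooth_on (\<lambda>p. vf_conj_apply L f p - c' * cnj (p $ 1) ^ b) W"
      by (intro smooth_intros smooth_on_cnj smooth_coordinate smooth_vf_apply Suc.prems W)
    fix q assume q: "q \<in> frontier (Omega (n+3)) \<inter> W"
    have "vf_conj_apply L f q = vf_conj_apply L (\<lambda>p. f p - c * cnj (p $ 1) ^ Suc b) q
        + cnj (L q $ 1) * (c * of_nat (Suc b) * cnj (q $ 1) ^ b)"
      using vf_apply_add(2)[OF sd sm, of q] q vf_apply_monomial(2)[of c 0 "Suc b" q] by simp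
    then show "vf_conj_apply L (\<lambda>p. f p - c * cnj (p $ 1) ^ Suc b) q
        + cnj (L q $ 1 - L 0 $ 1) * (c * of_nat (Suc b) * q $ 1 ^ 0 * cnj (q $ 1) ^ b)
      = vf_conj_apply L f q - c' * cnj (q $ 1) ^ b"
      by (simp add: c'_def algebra_simps)
  qed
  then have "iter_deriv L (replicate b False) (vf_conj_apply L f) 0 \<noteq> 0"
    using Suc.IH[OF smooth_vf_apply(2)[OF Suc.prems(1)] c'] by blast
  then show ?case by (simp add: iter_deriv_Cons)
qed

text \<open>The powers of \<open>z\<close> are removed by \<open>L\<close>, which leaves
  \<open>zbar\<close> untouched; what remains is the case of the conjugate field.\<close>

lemma iter_deriv_leading:
  assumes L1: "L 0 $ 1 \<noteq> 0"
  shows "smooth_on f W \<Longrightarrow> c \<noteq> 0 \<Longrightarrow> Vo (a + b + 1) (\<lambda>p. f p - c * p $ 1 ^ a * cnj (p $ 1) ^ b) \<Longrightarrow>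
    iter_deriv L (replicate a True @ replicate b False) f 0 \<noteq> 0"
proof (induction a arbitrary: f c)
  case 0
  then show ?case using iter_deriv_leading_conj[OF L1] by simp
next
  case (Suc a)
  define c' where "c' = c * of_nat (Suc a) * L 0 $ 1"
  have c': "c' \<noteq> 0" using L1 Suc.prems by (simp add: c'_def del: of_nat_Suc)
  have sm: "smooth_on (\<lambda>p. c * p $ 1 ^ Suc a * cnj (p $ 1) ^ b) W" by (rule Vo_smooth[OF Vo_monomial])
  have sd: "smooth_on (\<lambda>p. f p - c * p $ 1 ^ Suc a * cnj (p $ 1) ^ b) W" using Suc.prems(3) Vo_smooth by blast
  have 1: "Vo (a + b + 1) (vf_apply L (\<lambda>p. f p - c * p $ 1 ^ Suc a * cnj (p $ 1) ^ b))"
    using Suc.prems(3) by simp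
  have 2: "Vo (1 + (a + b)) (\<lambda>p. (L p $ 1 - L 0 $ 1) * (c * of_nat (Suc a) * p $ 1 ^ a * cnj (p $ 1) ^ b))"
    by (intro Vo_mult Vo_L1_diff Vo_monomial)
  have "Vo (a + b + 1) (\<lambda>p. vf_apply L f p - c' * p $ 1 ^ a * cnj (p $ 1) ^ b)"
  proof (rule Vo_cong[OF Vo_add[OF 1]])
    show "Vo (a + b + 1) (\<lambda>p. (L p $ 1 - L 0 $ 1) * (c * of_nat (Suc a) * p $ 1 ^ a * cnj (p $ 1) ^ b))"
      using 2 by (simp add: add.commute)
    show "smooth_on (\<lambda>p. vf_apply L f p - c' * p $ 1 ^ a * cnj (p $ 1) ^ b) W"
      by (intro smooth_intros smooth_on_cnj smooth_coordinate smooth_vf_apply Suc.prems W)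
    fix q assume q: "q \<in> frontier (Omega (n+3)) \<inter> W"
    have "vf_apply L f q = vf_apply L (\<lambda>p. f p - c * p $ 1 ^ Suc a * cnj (p $ 1) ^ b) q
        + L q $ 1 * (c * of_nat (Suc a) * q $ 1 ^ a * cnj (q $ 1) ^ b)"
      using vf_apply_add(1)[OF sd sm, of q] q vf_apply_monomial(1)[of c "Suc a" b q] by simp
    then show "vf_apply L (\<lambda>p. f p - c * p $ 1 ^ Suc a * cnj (p $ 1) ^ b) q
        + (L q $ 1 - L 0 $ 1) * (c * of_nat (Suc a) * q $ 1 ^ a * cnj (q $ 1) ^ b)
      = vf_apply L f q - c' * q $ 1 ^ a * cnj (q $ 1) ^ b"
      by (simp add: c'_def algebra_simps)
  qed
  then have "iter_deriv L (replicate a True @ replicate b False) (vf_apply L f) 0 \<noteq> 0"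
    using Suc.IH[OF smooth_vf_apply(1)[OF Suc.prems(1)] c'] by blast
  then show ?case by (simp add: iter_deriv_Cons)
qed

end

section \<open>Vanishing orders of the Hessian coefficients, and the type\<close>

declare vanish_order.simps(2) [simp del]

context tangential_field
begin

abbreviation Vr :: "nat \<Rightarrow> (C2 \<Rightarrow> real) \<Rightarrow> bool" where
  "Vr m g \<equiv> Vo m (\<lambda>p. complex_of_real (g p))"

lemma Vr_const: "Vr 0 (\<lambda>p. c)" by simp

lemma Vr_add: "Vr m f \<Longrightarrow> Vr m g \<Longrightarrow> Vr m (\<lambda>p. f p + g p)"
  using Vo_add by simp

lemma Vr_diff: "Vr m f \<Longrightarrow> Vr m g \<Longrightarrow> Vr m (\<lambda>p. f p - g p)"
  using Vo_diff by simp

lemma Vr_mult: "Vr m f \<Longrightarrow> Vr m' g \<Longrightarrow> Vr (m + m') (\<lambda>p. f p * g p)"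
  using Vo_mult by simp

lemma Vr_cmult: "Vr m g \<Longrightarrow> Vr m (\<lambda>p. c * g p)"
  using Vr_mult[OF Vr_const, of m g c] by simp

text \<open>\<open>t\<close> has order \<open>2\<close>. The order \<open>j\<close> of
  \<open>v\<close> stays a parameter because it is improved in several rounds.\<close>

lemma Vr_monomial:
  assumes "Vr j vv"
  shows "Vr (2 * a + b * j) (\<lambda>p. c * (tt p ^ a * vv p ^ b))"
proof -
  have "(\<lambda>p. complex_of_real (tt p)) = (\<lambda>p. p $ 1 * cnj (p $ 1))"
    by (simp add: fun_eq_iff tt_def complex_norm_square flip: of_real_power)
  then have "Vr (1 + 1) tt" using Vo_mult[OF Vo_z] by simp
  then have "Vr (a * (1 + 1)) (\<lambda>p. tt p ^ a)" "Vr (b * j) (\<lambda>p. vv p ^ b)"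
    using Vo_power[of "1 + 1" "\<lambda>p. complex_of_real (tt p)" a] Vo_power[OF assms, of b] by simp_all
  from Vr_cmult[OF Vr_mult[OF this]] show ?thesis by (simp add: mult_2)
qed

lemma Vr_monomial_ge:
  assumes "Vr j vv" "m \<le> 2 * a + b * j"
  shows "Vr m (\<lambda>p. c * (tt p ^ a * vv p ^ b))"
  by (rule Vo_mono[OF Vr_monomial[OF assms(1)] assms(2)])

lemma smooth_L_component: "smooth_on (\<lambda>p. L p $ i) W"
  by (intro smooth_on_vec_nth smooth_L W)

lemma L2_eq:
  assumes "q \<in> frontier (Omega (n+3)) \<inter> W"
  shows "L q $ 2 = - 2 * L q $ 1 * (of_real (Ft n (tt q) (vv q)) * cnj (q $ 1)) + \<i> * (L q $ 2 * of_real (Fv n (tt q) (vv q)))"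
  using tangential[OF assms] by (simp add: vf_apply_cr field_simps add_eq_0_iff)

text \<open>The critical case is \<open>n = 0\<close>, where \<open>t ^ n * v\<^sup>2\<close> in
  \<open>F\<^sub>t\<close> has only order \<open>2\<close> if \<open>v\<close> has order
  \<open>1\<close>; the factor \<open>zbar\<close> in \<open>r\<^sub>z\<close> brings the third
  order.\<close>

lemma Vo_L2_of_vv:
  assumes "Vr 1 vv"
  shows "Vo 3 (\<lambda>p. L p $ 2)"
proof -
  have Ft: "Vr 2 (\<lambda>p. Ft n (tt p) (vv p))"
  proof -
    have "Vr 2 (\<lambda>p. rc n 3 * (tt p ^ (n+2) * vv p ^ 0) - (2 * rc n 2) * (tt p ^ (n+1) * vv p ^ 1)
       + rc n 1 * (tt p ^ n * vv p ^ 2) + (2*n+5) * (tt p ^ (2*n+4) * vv p ^ 0))"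
      by (intro Vr_add Vr_diff Vr_monomial_ge[OF assms]) auto
    then show ?thesis by (simp add: Ft_def mult.assoc)
  qed
  have Fv: "Vr 3 (\<lambda>p. Fv n (tt p) (vv p))"
  proof -
    have "Vr 3 (\<lambda>p. (- 2 * (rc n 2)\<^sup>2) * (tt p ^ (n+2) * vv p ^ 0) + (2 * (rc n 1)\<^sup>2) * (tt p ^ (n+1) * vv p ^ 1))"
      by (intro Vr_add Vr_monomial_ge[OF assms]) auto
    then show ?thesis by (simp add: Fv_def mult.assoc)
  qed
  have "Vo (2 + 1) (\<lambda>p. complex_of_real (Ft n (tt p) (vv p)) * cnj (p $ 1))"
    by (rule Vo_mult[OF Ft Vo_z(2)])
  then have 1: "Vo 3 (\<lambda>p. (- 2 * L p $ 1) * (complex_of_real (Ft n (tt p) (vv p)) * cnj (p $ 1)))"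
    by (intro Vo_mult_smooth[OF smooth_on_mult[OF W(1) smooth_on_const smooth_L_component]]) simp
  have 2: "Vo 3 (\<lambda>p. \<i> * (L p $ 2 * of_real (Fv n (tt p) (vv p))))"
    by (intro Vo_mult_smooth smooth_on_const smooth_L_component Fv)
  show ?thesis
    by (rule Vo_cong[OF Vo_add[OF 1 2] smooth_L_component]) (rule L2_eq[symmetric])
qed

lemma vf_apply_vv:
  "vf_apply L (\<lambda>p. complex_of_real (vv p)) = (\<lambda>p. - \<i> / 2 * L p $ 2)"
  "vf_conj_apply L (\<lambda>p. complex_of_real (vv p)) = (\<lambda>p. \<i> / 2 * cnj (L p $ 2))"
  unfolding vf_apply_def[abs_def] vf_conj_apply_def[abs_def] UNIV_2_sum
    d_z_eqI[OF has_derivative_complex_of_real[OF has_derivative_vv]]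
    d_zbar_eqI[OF has_derivative_complex_of_real[OF has_derivative_vv]] by (simp_all add: mult.commute)

lemma smooth_vv: "smooth_on (\<lambda>p. complex_of_real (vv p)) W"
  by (intro smooth_on_of_real smooth_on_vv W)

lemma Vr_vv_Suc:
  assumes "Vo m (\<lambda>p. L p $ 2)"
  shows "Vr (Suc m) vv"
proof -
  have "Vo m (\<lambda>p. - \<i> / 2 * L p $ 2)" "Vo m (\<lambda>p. \<i> / 2 * cnj (L p $ 2))"
    using Vo_mult_smooth[OF smooth_on_const assms] Vo_mult_smooth[OF smooth_on_const Vo_cnj[OF assms]] by blast+
  then show ?thesis by (simp add: vf_apply_vv smooth_vv vv_def[of 0] vanish_order.simps(2))
qed

text \<open>Bootstrap: mere smoothness of the second component gives \<open>v\<close> order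
  \<open>1\<close>, hence the second component order \<open>3\<close>, and in turn \<open>v\<close>
  order \<open>4\<close>.\<close>

lemma Vo_L2: "Vo 3 (\<lambda>p. L p $ 2)"
  by (rule Vo_L2_of_vv) (use Vr_vv_Suc[of 0] smooth_L_component in simp)

lemma Vr_vv: "Vr 4 vv"
  using Vr_vv_Suc[OF Vo_L2] by (simp add: eval_nat_numeral)

text \<open>As \<open>v\<close> has order \<open>4\<close> and the second component of
  \<open>L\<close> order \<open>3\<close>, the only term of order \<open>2 n + 4\<close> is
  \<open>t ^ (n+2)\<close> in \<open>Fzz\<close>; every term with a mixed or
  \<open>w\<close>-derivative has larger order.\<close>

lemma hess_leading:
  "Vo (2*n+5) (\<lambda>p. hess (r_fun (n+3)) L L p - (L 0 $ 1 * cnj (L 0 $ 1)) * p $ 1 ^ (n+2) * cnj (p $ 1) ^ (n+2))"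
proof -
  have zz: "complex_of_real (tt p) = p $ 1 * cnj (p $ 1)" for p
    by (simp add: tt_def complex_norm_square flip: of_real_power)
  have Fzz: "Vr (2*n+5) (\<lambda>p. Fzz n (tt p) (vv p) - tt p ^ (n+2))"
  proof -
    have "Vr (2*n+5) (\<lambda>p. (- 2) * (tt p ^ (n+1) * vv p ^ 1) + 1 * (tt p ^ n * vv p ^ 2)
       + (2*n+5)\<^sup>2 * (tt p ^ (2*n+4) * vv p ^ 0))"
      by (intro Vr_add Vr_monomial_ge[OF Vr_vv]) auto
    then show ?thesis by (simp add: Fzz_def power_add power2_eq_square algebra_simps)
  qed
  have Ftv: "Vr (2*n+2) (\<lambda>p. Ftv n (tt p) (vv p))"
  proof -
    have "Vr (2*n+2) (\<lambda>p. (- 2 * rc n 2) * (tt p ^ (n+1) * vv p ^ 0) + (2 * rc n 1) * (tt p ^ n * vv p ^ 1))"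
      by (intro Vr_add Vr_monomial_ge[OF Vr_vv]) auto
    then show ?thesis by (simp add: Ftv_def mult.assoc)
  qed
  have Fvv: "Vr (2*n+2) (\<lambda>p. Fvv n (tt p))"
    using Vr_monomial_ge[OF Vr_vv, of "2*n+2" "n+1" 0 "2 * (rc n 1)\<^sup>2"] by (simp add: Fvv_def)
  have L1: "smooth_on (\<lambda>p. L p $ 1) W" "smooth_on (\<lambda>p. cnj (L p $ 1)) W"
    by (intro smooth_on_cnj smooth_L_component W)+
  have 1: "Vo (2*n+5) (\<lambda>p. (L p $ 1 * cnj (L p $ 1)) * complex_of_real (Fzz n (tt p) (vv p) - tt p ^ (n+2)))"
    by (intro Vo_mult_smooth smooth_on_mult L1 Fzz W)
  \<comment> \<open>The bracket is \<open>|L\<^sup>1|\<^sup>2 - |L\<^sup>1(0)|\<^sup>2\<close>,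
    written so that each summand contains a factor of order \<open>1\<close>.\<close>
  have 2: "Vo (2*n+5) (\<lambda>p. (1 * p $ 1 ^ (n+2) * cnj (p $ 1) ^ (n+2)) *
     (cnj (L p $ 1) * (L p $ 1 - L 0 $ 1) + L 0 $ 1 * cnj (L p $ 1 - L 0 $ 1)))"
  proof (rule Vo_mono[OF Vo_mult[OF Vo_monomial]])
    show "Vo 1 (\<lambda>p. cnj (L p $ 1) * (L p $ 1 - L 0 $ 1) + L 0 $ 1 * cnj (L p $ 1 - L 0 $ 1))"
      by (intro Vo_add Vo_mult_smooth Vo_cnj Vo_L1_diff L1 smooth_on_const)
  qed simp
  have 3: "Vo (2*n+5) (\<lambda>p. (\<i> / 2 * L p $ 1) * (complex_of_real (Ftv n (tt p) (vv p)) * (cnj (p $ 1) * cnj (L p $ 2))))"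
    by (rule Vo_mult_smooth[OF smooth_on_mult[OF W(1) smooth_on_const L1(1)] Vo_mono[OF Vo_mult[OF Ftv Vo_mult[OF Vo_z(2) Vo_cnj[OF Vo_L2]]]]]) simp
  have 4: "Vo (2*n+5) (\<lambda>p. (\<i> / 2 * cnj (L p $ 1)) * (complex_of_real (Ftv n (tt p) (vv p)) * (p $ 1 * L p $ 2)))"
    by (rule Vo_mult_smooth[OF smooth_on_mult[OF W(1) smooth_on_const L1(2)] Vo_mono[OF Vo_mult[OF Ftv Vo_mult[OF Vo_z(1) Vo_L2]]]]) simp
  have 5: "Vo (2*n+5) (\<lambda>p. 1 / 4 * (complex_of_real (Fvv n (tt p)) * (L p $ 2 * cnj (L p $ 2))))"
    by (rule Vo_mult_smooth[OF smooth_on_const Vo_mono[OF Vo_mult[OF Fvv Vo_mult[OF Vo_L2 Vo_cnj[OF Vo_L2]]]]]) simp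
  have "(\<lambda>p. hess (r_fun (n+3)) L L p - (L 0 $ 1 * cnj (L 0 $ 1)) * p $ 1 ^ (n+2) * cnj (p $ 1) ^ (n+2)) =
    (\<lambda>p. (L p $ 1 * cnj (L p $ 1)) * complex_of_real (Fzz n (tt p) (vv p) - tt p ^ (n+2))
     + (1 * p $ 1 ^ (n+2) * cnj (p $ 1) ^ (n+2)) * (cnj (L p $ 1) * (L p $ 1 - L 0 $ 1) + L 0 $ 1 * cnj (L p $ 1 - L 0 $ 1))
     + (\<i> / 2 * L p $ 1) * (complex_of_real (Ftv n (tt p) (vv p)) * (cnj (p $ 1) * cnj (L p $ 2)))
     - (\<i> / 2 * cnj (L p $ 1)) * (complex_of_real (Ftv n (tt p) (vv p)) * (p $ 1 * L p $ 2))
     + 1 / 4 * (complex_of_real (Fvv n (tt p)) * (L p $ 2 * cnj (L p $ 2))))"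
  proof
    fix p
    have "complex_of_real (tt p ^ (n+2)) = p $ 1 ^ (n+2) * cnj (p $ 1) ^ (n+2)"
      by (simp only: of_real_power zz power_mult_distrib)
    then show "hess (r_fun (n+3)) L L p - (L 0 $ 1 * cnj (L 0 $ 1)) * p $ 1 ^ (n+2) * cnj (p $ 1) ^ (n+2) =
      (L p $ 1 * cnj (L p $ 1)) * complex_of_real (Fzz n (tt p) (vv p) - tt p ^ (n+2))
     + (1 * p $ 1 ^ (n+2) * cnj (p $ 1) ^ (n+2)) * (cnj (L p $ 1) * (L p $ 1 - L 0 $ 1) + L 0 $ 1 * cnj (L p $ 1 - L 0 $ 1))
     + (\<i> / 2 * L p $ 1) * (complex_of_real (Ftv n (tt p) (vv p)) * (cnj (p $ 1) * cnj (L p $ 2)))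
     - (\<i> / 2 * cnj (L p $ 1)) * (complex_of_real (Ftv n (tt p) (vv p)) * (p $ 1 * L p $ 2))
     + 1 / 4 * (complex_of_real (Fvv n (tt p)) * (L p $ 2 * cnj (L p $ 2)))"
      unfolding hess_r of_real_diff complex_cnj_diff by (simp only: ring_distribs) (simp add: algebra_simps)
  qed
  then show ?thesis using Vo_add[OF Vo_diff[OF Vo_add[OF Vo_add[OF 1 2] 3] 4] 5] by simp
qed

text \<open>The Levi form has order \<open>2 n + 4\<close>, and \<open>n + 2\<close> derivatives of
  each kind detect its leading monomial. The type exceeds this number of derivatives by
  \<open>2\<close>.\<close>

lemma levi_type:
  assumes nz: "L 0 \<noteq> 0"
  shows "levi_type_wrt (r_fun (n+3)) L 0 (2 * (n+3))"
proof -
  let ?h = "hess (r_fun (n+3)) L L"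
  have L1: "L 0 $ 1 \<noteq> 0"
    using Re_hess_tangential_nonzero(1)[of L n 0] tangential[of 0] zero_in_frontier[of n] W nz by blast
  have e: "Vo (2*n+5) (\<lambda>p. ?h p - (L 0 $ 1 * cnj (L 0 $ 1)) * p $ 1 ^ (n+2) * cnj (p $ 1) ^ (n+2))" by (rule hess_leading)
  have m: "Vo ((n+2) + (n+2)) (\<lambda>p. (L 0 $ 1 * cnj (L 0 $ 1)) * p $ 1 ^ (n+2) * cnj (p $ 1) ^ (n+2))"
    by (rule Vo_monomial)
  then have "Vo (2*n+4) (\<lambda>p. (L 0 $ 1 * cnj (L 0 $ 1)) * p $ 1 ^ (n+2) * cnj (p $ 1) ^ (n+2))"
    by (rule Vo_mono) simp
  from Vo_add[OF Vo_mono[OF e, of "2*n+4"] this] have low: "Vo (2*n+4) ?h" by simp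
  have "iter_deriv L (replicate (n+2) True @ replicate (n+2) False) ?h 0 \<noteq> 0"
  proof (rule iter_deriv_leading[OF L1])
    show "smooth_on ?h W" using low by (rule Vo_smooth)
    show "L 0 $ 1 * cnj (L 0 $ 1) \<noteq> 0" using L1 by simp
    show "Vo (n + 2 + (n + 2) + 1) (\<lambda>p. ?h p - (L 0 $ 1 * cnj (L 0 $ 1)) * p $ 1 ^ (n+2) * cnj (p $ 1) ^ (n+2))"
      by (rule Vo_mono[OF e]) simp
  qed
  moreover have "length (replicate (n+2) True @ replicate (n+2) False) = 2 * (n+3) - 2" by simp
  moreover have "iter_deriv L bs ?h 0 = 0" if "length bs = j - 2" "2 \<le> j" "j < 2 * (n+3)" for bs j
    using that by (intro iter_deriv_Vo[OF low]) auto
  ultimately show ?thesis unfolding levi_type_wrt_def by fastforce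
qed

end

lemma finite_type: "finite_type_at (Omega (n+3)) (r_fun (n+3)) 0 (2 * (n+3))"
  unfolding finite_type_at_def
proof (intro conjI allI impI)
  show "\<exists>V. local_defining_function (Omega (n+3)) (r_fun (n+3)) V 0 \<and> smooth_on (r_fun (n+3)) V"
    using local_defining_function_r[OF zero_in_frontier] smooth_on_r by blast
  show "\<exists>W L. hol_tangential (Omega (n+3)) (r_fun (n+3)) 0 W L \<and> nonvanishing_on L W"
    using hol_tangential_L0[of UNIV 0 n] L0_nonzero by (auto simp: nonvanishing_on_def)
  fix W L assume H: "hol_tangential (Omega (n+3)) (r_fun (n+3)) 0 W L \<and> nonvanishing_on L W"
  then interpret tangential_field n W L
    by unfold_locales (auto simp: hol_tangential_def)
  show "levi_type_wrt (r_fun (n+3)) L 0 (2 * (n+3))"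
    using H W by (intro levi_type) (auto simp: nonvanishing_on_def)
qed

section \<open>Defining functions that are plurisubharmonic on the boundary\<close>

text \<open>The field \<open>A\<close> differentiates while \<open>B\<close> enters only through its
  value at \<open>p\<close>. So identities on the boundary may be differentiated as soon as
  \<open>A\<close> is tangential, with \<open>B\<close> transversal.\<close>

lemma hess_vf_apply:
  "hess f A B p = (\<Sum>k\<in>UNIV. vf_apply A (d_zbar k (\<lambda>q. complex_of_real (f q))) p * cnj (B p $ k))"
  by (simp add: hess_def vf_apply_def UNIV_2_sum algebra_simps)

lemma vf_apply_diff_mult:
  assumes f: "f differentiable (at p)" and g: "g differentiable (at p)" and h: "h differentiable (at p)"
  shows "vf_apply A (\<lambda>x. f x - g x * h x) p
    = vf_apply A f p - (vf_apply A g p * h p + g p * vf_apply A h p)"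
proof -
  note fd = f[unfolded frechet_derivative_works] and gd = g[unfolded frechet_derivative_works]
    and hd = h[unfolded frechet_derivative_works]
  show ?thesis
    unfolding vf_apply_def UNIV_2_sum
      d_z_eqI[OF has_derivative_diff[OF fd has_derivative_mult[OF gd hd]]]
      d_z_def[of _ f] d_z_def[of _ g] d_z_def[of _ h]
    by (simp add: field_simps)
qed

lemma d_zbar_r_differentiable:
  "(d_zbar k (cr n)) differentiable (at q)"
proof -
  have 1: "d_zbar 1 (cr n) = (\<lambda>q. of_real (Ft n (tt q) (vv q)) * q $ 1)"
    by (rule ext) (rule r_derivatives)
  have 2: "d_zbar 2 (cr n) = (\<lambda>q. (1 + \<i> * of_real (Fv n (tt q) (vv q))) * inverse 2)"
    unfolding divide_inverse[symmetric] by (rule ext) (rule r_derivatives)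
  have "smooth_on (d_zbar 1 (cr n)) UNIV" unfolding 1
    by (intro smooth_intros smooth_on_of_real smooth_on_F smooth_on_vec_nth smooth_on_ident open_UNIV)
  moreover have "smooth_on (d_zbar 2 (cr n)) UNIV" unfolding 2
    by (intro smooth_intros smooth_on_of_real smooth_on_F open_UNIV)
  ultimately have "smooth_on (d_zbar k (cr n)) UNIV"
    using exhaust_2[of k] by metis
  then show ?thesis by (rule smooth_on_D(3)) simp
qed

section \<open>An arbitrary C^2 defining function along the boundary\<close>

locale defining_function =
  fixes n :: nat and V :: "C2 set" and \<rho> :: "C2 \<Rightarrow> real"
  assumes ldf: "local_defining_function (Omega (n+3)) \<rho> V 0"
begin

lemma V: "open V" "0 \<in> V" using ldf by (auto simp: local_defining_function_def)

definition D :: "C2 \<Rightarrow> C2 \<Rightarrow> real" where "D X q = frechet_derivative \<rho> (at q) X"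

definition D2 :: "C2 \<Rightarrow> C2 \<Rightarrow> C2 \<Rightarrow> real" where "D2 X q Y = frechet_derivative (D X) (at q) Y"

definition h :: "C2 \<Rightarrow> real" where "h = D (real_dir 1)"

lemma C2_rho: "Ck_on 2 \<rho> V" using ldf by (simp add: local_defining_function_def)

lemma has_derivative_\<rho>: "q \<in> V \<Longrightarrow> (\<rho> has_derivative (\<lambda>X. D X q)) (at q)"
  using C2_rho by (simp add: numeral_2_eq_2 D_def frechet_derivative_works)

lemma has_derivative_D: "q \<in> V \<Longrightarrow> (D X has_derivative D2 X q) (at q)"
  using C2_rho by (simp add: numeral_2_eq_2 D_def[abs_def] D2_def[abs_def] frechet_derivative_works)

lemma continuous_on_D2: "continuous_on V (\<lambda>q. D2 X q Y)"
  using C2_rho by (simp add: numeral_2_eq_2 D_def[abs_def] D2_def)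

lemma D2_commute: "q \<in> V \<Longrightarrow> D2 X q Y = D2 Y q X"
  unfolding D2_def D_def by (rule frechet_derivative_commute[OF C2_rho V(1)])

lemma \<rho>_neg_iff: "q \<in> V \<Longrightarrow> \<rho> q < 0 \<longleftrightarrow> r_fun (n+3) q < 0"
  using ldf by (auto simp: local_defining_function_def Omega_def)

text \<open>The definition prescribes only where \<open>\<rho>\<close> is negative. A positive value
  at a boundary point would persist nearby and keep \<open>Omega\<close> away from that
  point.\<close>

lemma \<rho>_frontier:
  assumes q: "q \<in> frontier (Omega (n+3)) \<inter> V"
  shows "\<rho> q = 0"
proof -
  have "\<rho> q \<ge> 0" using q \<rho>_neg_iff[of q] by (simp add: frontier_Omega not_less[symmetric])
  moreover have "\<not> \<rho> q > 0"
  proof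
    assume "\<rho> q > 0"
    have "continuous_on V \<rho>"
      using has_derivative_\<rho> has_derivative_continuous by (blast intro: continuous_at_imp_continuous_on)
    then have op: "open (V \<inter> \<rho> -` {0<..})" using V by (intro continuous_open_preimage) auto
    have "q \<in> closure (Omega (n+3))" using q by (auto simp: frontier_def)
    then have "(V \<inter> \<rho> -` {0<..}) \<inter> Omega (n+3) \<noteq> {}"
      using open_Int_closure_eq_empty[OF op, of "Omega (n+3)"] q \<open>\<rho> q > 0\<close> by blast
    then obtain p where "p \<in> Omega (n+3)" "p \<in> V" "\<rho> p > 0" by auto
    then show False using \<rho>_neg_iff[of p] by (auto simp: Omega_def)
  qed
  ultimately show ?thesis by linarith
qed

lemma D_frontier:
  assumes q: "q \<in> frontier (Omega (n+3)) \<inter> V" and r: "(r_fun (n+3) has_derivative r') (at q)"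
  shows "D X q = r' X * h q"
proof -
  have qV: "q \<in> V" and qf: "q \<in> frontier (Omega (n+3))" using q by simp_all
  have "D X q = r' X *\<^sub>R D (real_dir 1) q"
    by (rule derivative_of_vanishing_on_boundary[OF has_derivative_\<rho>[OF qV] V(1) qV \<rho>_frontier qf r])
  then show ?thesis by (simp add: h_def)
qed

text \<open>\<open>h 0 = 0\<close> would make \<open>d\<rho>\<close> vanish at the origin. If
  \<open>h 0 < 0\<close>, then \<open>\<rho>\<close> would be positive just below the origin in the
  direction of \<open>u\<close>, although these points lie in \<open>Omega\<close>.\<close>

lemma h0_pos: "h 0 > 0"
proof (rule ccontr)
  assume "\<not> h 0 > 0"
  have "D X 0 = 0" if "h 0 = 0" for X
    using D_frontier[OF _ has_derivative_r] zero_in_frontier V that by simp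
  moreover have "frechet_derivative \<rho> (at 0) \<noteq> (\<lambda>v. 0)"
    using ldf zero_in_frontier V by (auto simp: local_defining_function_def)
  ultimately have "h 0 < 0" using \<open>\<not> h 0 > 0\<close> by (force simp: D_def fun_eq_iff)
  have "((\<lambda>s. \<rho> (real_dir s)) has_derivative (\<lambda>s. D (real_dir s) 0)) (at 0)"
  proof (rule has_derivative_compose[where g=\<rho> and f=real_dir])
    show "(real_dir has_derivative real_dir) (at 0)"
      by (rule bounded_linear_imp_has_derivative[OF bounded_linear_real_dir])
    show "(\<rho> has_derivative (\<lambda>X. D X 0)) (at (real_dir 0))"
      using has_derivative_\<rho>[OF V(2)] linear_0[OF bounded_linear.linear[OF bounded_linear_real_dir]] by simp
  qed
  moreover have "D (real_dir s) 0 = h 0 * s" for s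
    using D_frontier[OF _ has_derivative_r, of 0 "real_dir s"] zero_in_frontier V by simp
  ultimately have "((\<lambda>s. \<rho> (real_dir s)) has_real_derivative h 0) (at 0)"
    by (simp add: has_field_derivative_def)
  from DERIV_neg_dec_left[OF this \<open>h 0 < 0\<close>] obtain d where d: "d > 0"
    "\<And>s. s > 0 \<Longrightarrow> s < d \<Longrightarrow> \<rho> (real_dir 0) < \<rho> (real_dir (0 - s))" by blast
  have "((\<lambda>s. real_dir (- s)) \<longlongrightarrow> real_dir (- 0)) (at_right 0)"
    by (intro bounded_linear.tendsto[OF bounded_linear_real_dir] tendsto_intros)
  then have "\<forall>\<^sub>F s in at_right 0. real_dir (- s) \<in> V"
    using V by (intro topological_tendstoD) (auto simp: linear_0[OF bounded_linear.linear[OF bounded_linear_real_dir]])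
  moreover have "\<forall>\<^sub>F s in at_right 0. s \<in> {0<..<d}"
    using d by (intro eventually_at_right_real) simp
  ultimately have "\<forall>\<^sub>F s in at_right 0. s \<in> {0<..<d} \<and> real_dir (- s) \<in> V"
    by eventually_elim simp
  then obtain s where s: "0 < s" "s < d" "real_dir (- s) \<in> V"
    using eventually_happens[of _ "at_right (0::real)"] by (auto simp: trivial_limit_at_right_real)
  have "r_fun (n+3) (0 + real_dir (- s)) < 0"
    unfolding r_fun_real_dir using zero_in_frontier[of n] s by (simp add: frontier_Omega)
  then have "\<rho> (real_dir (- s)) < 0" using s \<rho>_neg_iff by simp
  moreover have "\<rho> 0 = 0" using \<rho>_frontier zero_in_frontier V by simp
  ultimately show False
    using d(2)[OF s(1,2)] linear_0[OF bounded_linear.linear[OF bounded_linear_real_dir]] by simp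
qed

abbreviation c\<rho> :: "C2 \<Rightarrow> complex" where "c\<rho> \<equiv> \<lambda>x. complex_of_real (\<rho> x)"

text \<open>The \<open>zbar\<close>-derivative of \<open>\<rho>\<close> on \<open>V\<close>,
  expressed by real directional derivatives, for which the differentiability from C^2 is available
  directly.\<close>

definition g :: "2 \<Rightarrow> C2 \<Rightarrow> complex" where
  "g k q = (of_real (D (axis k 1) q) + \<i> * of_real (D (axis k \<i>) q)) / 2"

lemma d_zbar_\<rho>: "q \<in> V \<Longrightarrow> d_zbar k c\<rho> q = g k q"
  using d_zbar_eqI[OF has_derivative_complex_of_real[OF has_derivative_\<rho>]] by (simp add: g_def)

lemma has_derivative_g:
  "q \<in> V \<Longrightarrow> (g k has_derivative (\<lambda>Y. (of_real (D2 (axis k 1) q Y) + \<i> * of_real (D2 (axis k \<i>) q Y)) / 2)) (at q)"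
  unfolding g_def[abs_def] divide_inverse
  by (intro has_derivative_mult_left has_derivative_mult_right has_derivative_add has_derivative_complex_of_real has_derivative_D)

lemma d_z_d_zbar_\<rho>:
  assumes "q \<in> V"
  shows "d_z j (d_zbar k c\<rho>) q = d_z j (g k) q"
  using frechet_derivative_cong_open[OF V(1) assms, of "d_zbar k c\<rho>" "g k"] d_zbar_\<rho>
  by (simp add: d_z_def)

lemma vf_apply_d_zbar_\<rho>: "q \<in> V \<Longrightarrow> vf_apply A (d_zbar k c\<rho>) q = vf_apply A (g k) q"
  by (simp add: vf_apply_def d_z_d_zbar_\<rho>)

lemma d_z_g:
  assumes "q \<in> V"
  shows "d_z j (g k) q = (of_real (D2 (axis k 1) q (axis j 1) + D2 (axis k \<i>) q (axis j \<i>))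
    + \<i> * of_real (D2 (axis k \<i>) q (axis j 1) - D2 (axis k 1) q (axis j \<i>))) / 4"
  unfolding d_z_eqI[OF has_derivative_g[OF assms]] by (simp add: complex_eq_iff)

text \<open>This is where the symmetry of the real second derivatives enters.\<close>

lemma hess_hermitian:
  assumes q: "q \<in> V"
  shows "hess \<rho> B A q = cnj (hess \<rho> A B q)"
proof -
  have "d_z j (g k) q = cnj (d_z k (g j) q)" for j k
    unfolding d_z_g[OF q] D2_commute[OF q, of "axis j _"] by (simp add: complex_eq_iff)
  from this[of 1 1] this[of 1 2] this[of 2 1] this[of 2 2] show ?thesis
    unfolding hess_def d_z_d_zbar_\<rho>[OF q] UNIV_2_sum
    by (simp add: algebra_simps complex_eq_iff)
qed

lemma h_differentiable: "q \<in> V \<Longrightarrow> (\<lambda>x. complex_of_real (h x)) differentiable (at q)"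
  using has_derivative_complex_of_real[OF has_derivative_D] by (auto simp: h_def differentiable_def)

lemma g_frontier:
  assumes q: "q \<in> frontier (Omega (n+3)) \<inter> V"
  shows "g k q = of_real (h q) * d_zbar k (cr n) q"
proof -
  obtain r' where r': "(r_fun (n+3) has_derivative r') (at q)" using has_derivative_r by blast
  show ?thesis
    unfolding g_def D_frontier[OF q r'] d_zbar_eqI[OF has_derivative_complex_of_real[OF r']]
    by (simp add: algebra_simps)
qed

text \<open>Tangential derivatives of \<open>d\<rho> = h dr\<close> along the boundary, where \<open>h\<close> is only of class \<open>C\<^sup>1\<close>.\<close>

lemma hess_L0:
  assumes q: "q \<in> frontier (Omega (n+3)) \<inter> V"
  shows "hess \<rho> (L0 n) B q = vf_apply (L0 n) (\<lambda>x. of_real (h x)) q * cnj (vf_apply B (cr n) q)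
    + of_real (h q) * hess (r_fun (n+3)) (L0 n) B q"
proof -
  have qV: "q \<in> V" using q by simp
  have "vf_apply (L0 n) (g k) q = vf_apply (L0 n) (\<lambda>x. of_real (h x)) q * d_zbar k (cr n) q
     + of_real (h q) * vf_apply (L0 n) (d_zbar k (cr n)) q" for k
  proof -
    have gd: "g k differentiable (at q)" using has_derivative_g[OF qV] by (auto simp: differentiable_def)
    note hd = h_differentiable[OF qV] and rd = d_zbar_r_differentiable[of k n q]
    have "vf_apply (L0 n) (\<lambda>x. g k x - of_real (h x) * d_zbar k (cr n) x) q = 0"
    proof (rule vf_apply_vanishing_on_boundary(1)[OF _ V(1) qV _ _ L0_tangential])
      show "(\<lambda>x. g k x - of_real (h x) * d_zbar k (cr n) x) differentiable (at q)"
        by (intro differentiable_diff differentiable_mult gd hd rd)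
      show "q \<in> frontier (Omega (n+3))" using q by simp
      show "g k p - of_real (h p) * d_zbar k (cr n) p = 0" if "p \<in> frontier (Omega (n+3)) \<inter> V" for p
        using g_frontier[OF that] by simp
    qed
    then show ?thesis unfolding vf_apply_diff_mult[OF gd hd rd] by simp
  qed
  then have "hess \<rho> (L0 n) B q = vf_apply (L0 n) (\<lambda>x. of_real (h x)) q * (d_zbar 1 (cr n) q * cnj (B q $ 1) + d_zbar 2 (cr n) q * cnj (B q $ 2))
    + of_real (h q) * hess (r_fun (n+3)) (L0 n) B q"
    unfolding hess_vf_apply vf_apply_d_zbar_\<rho>[OF qV] UNIV_2_sum by (simp add: algebra_simps)
  also have "d_zbar 1 (cr n) q * cnj (B q $ 1) + d_zbar 2 (cr n) q * cnj (B q $ 2) = cnj (vf_apply B (cr n) q)"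
    by (simp add: vf_apply_def UNIV_2_sum r_derivatives algebra_simps)
  finally show ?thesis .
qed

text \<open>The term with the derivative of \<open>h\<close> is multiplied by
  \<open>L0 r = 0\<close> and drops out, and
  \<open>|L0\<^sup>1|\<^sup>2 = (1 + F\<^sub>v\<^sup>2) / 4\<close> cancels the denominator of the
  Levi form.\<close>

lemma Re_hess_L0_L0:
  assumes q: "q \<in> frontier (Omega (n+3)) \<inter> V"
  shows "Re (hess \<rho> (L0 n) (L0 n) q) = h q * levi_num n (tt q) (vv q) / 4"
proof -
  have cm: "(cmod (L0 n q $ 1))\<^sup>2 = (1 + (Fv n (tt q) (vv q))\<^sup>2) / 4"
    unfolding cmod_power2 L0_simps by (simp add: power_divide)
  have "1 + (Fv n (tt q) (vv q))\<^sup>2 \<noteq> 0" by (smt (verit) zero_le_power2)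
  then have "Re (hess (r_fun (n+3)) (L0 n) (L0 n) q) = levi_num n (tt q) (vv q) / 4"
    unfolding Re_hess_tangential[OF L0_tangential] cm times_divide_eq_left divide_divide_eq_left'
    by (intro nonzero_mult_divide_mult_cancel_left)
  then show ?thesis unfolding hess_L0[OF q] L0_tangential by simp
qed

definition ew :: "C2 \<Rightarrow> C2" where "ew = (\<lambda>_. axis 2 1)"

text \<open>The hypothesis is applied to constant fields, which can take any value at
  \<open>q\<close>. Using an upper bound \<open>K > 0\<close> for the entry
  \<open>H(\<partial>\<^sub>w, \<partial>\<^sub>w)\<close> avoids treating the case where this entry
  is \<open>0\<close>.\<close>

lemma psh_cauchy_schwarz:
  assumes psh: "psh_on_boundary (Omega (n+3)) \<rho> V" and q: "q \<in> frontier (Omega (n+3)) \<inter> V"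
    and K: "K > 0" "cmod (hess \<rho> ew ew q) \<le> K"
  shows "(cmod (hess \<rho> (L0 n) ew q))\<^sup>2 \<le> K * Re (hess \<rho> (L0 n) (L0 n) q)"
proof -
  define b where "b = hess \<rho> (L0 n) ew q"
  \<comment> \<open>The minimizer of the quadratic polynomial in \<open>\<zeta>\<close> after
    \<open>H(\<partial>\<^sub>w, \<partial>\<^sub>w)\<close> has been replaced by
    \<open>K\<close>.\<close>
  define \<zeta> where "\<zeta> = - b / of_real K"
  have "hess \<rho> (\<lambda>_. L0 n q + axis 2 \<zeta>) (\<lambda>_. L0 n q + axis 2 \<zeta>) q
    = hess \<rho> (L0 n) (L0 n) q + cnj \<zeta> * b + \<zeta> * hess \<rho> ew (L0 n) q + \<zeta> * cnj \<zeta> * hess \<rho> ew ew q"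
    unfolding hess_def b_def UNIV_2_sum ew_def by (simp add: algebra_simps)
  also have "hess \<rho> ew (L0 n) q = cnj b" unfolding b_def using q by (intro hess_hermitian) simp
  finally have e: "hess \<rho> (\<lambda>_. L0 n q + axis 2 \<zeta>) (\<lambda>_. L0 n q + axis 2 \<zeta>) q
    = hess \<rho> (L0 n) (L0 n) q + cnj \<zeta> * b + \<zeta> * cnj b + \<zeta> * cnj \<zeta> * hess \<rho> ew ew q" .
  have "0 \<le> Re (hess \<rho> (\<lambda>_. L0 n q + axis 2 \<zeta>) (\<lambda>_. L0 n q + axis 2 \<zeta>) q)"
    using psh q unfolding psh_on_boundary_def by (blast intro: smooth_on_const)
  also have "\<dots> = Re (hess \<rho> (L0 n) (L0 n) q) - 2 * (cmod b)\<^sup>2 / K + (cmod b)\<^sup>2 / K\<^sup>2 * Re (hess \<rho> ew ew q)"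
  proof -
    have "cnj \<zeta> * b = of_real (- (cmod b)\<^sup>2 / K)" "\<zeta> * cnj b = of_real (- (cmod b)\<^sup>2 / K)"
      "\<zeta> * cnj \<zeta> = of_real ((cmod b)\<^sup>2 / K\<^sup>2)"
    proof -
      have bb: "b * cnj b = complex_of_real ((cmod b)\<^sup>2)" by (rule complex_norm_square[symmetric])
      have "cnj \<zeta> * b = - (b * cnj b) / of_real K" "\<zeta> * cnj b = - (b * cnj b) / of_real K"
        "\<zeta> * cnj \<zeta> = (b * cnj b) / of_real (K\<^sup>2)"
        by (simp_all add: \<zeta>_def power2_eq_square)
      then show "cnj \<zeta> * b = of_real (- (cmod b)\<^sup>2 / K)" "\<zeta> * cnj b = of_real (- (cmod b)\<^sup>2 / K)"
        "\<zeta> * cnj \<zeta> = of_real ((cmod b)\<^sup>2 / K\<^sup>2)"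
        unfolding bb by simp_all
    qed
    then show ?thesis unfolding e by simp
  qed
  also have "(cmod b)\<^sup>2 / K\<^sup>2 * Re (hess \<rho> ew ew q) \<le> (cmod b)\<^sup>2 / K\<^sup>2 * K"
    using K complex_Re_le_cmod[of "hess \<rho> ew ew q"] by (intro mult_left_mono) auto
  also have "(cmod b)\<^sup>2 / K\<^sup>2 * K = (cmod b)\<^sup>2 / K" using K by (simp add: power2_eq_square)
  finally have "(cmod b)\<^sup>2 / K \<le> Re (hess \<rho> (L0 n) (L0 n) q)" by simp
  then show ?thesis using K by (simp add: b_def field_simps)
qed

end

section \<open>Sizes on the circle \<open>v = t\<close>, and the contradiction\<close>

lemma rc_diff_pos: "rc n 1 - rc n 2 > 0"
proof -
  have "inverse (real n + 2) < inverse (real n + 1)" by (rule less_imp_inverse_less) auto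
  then show ?thesis by (simp add: rc_def)
qed

lemma diagonal_bounds:
  assumes t: "0 \<le> t" "t \<le> 1"
  shows "\<bar>Ft n t t\<bar> \<le> 4 * (2*real n+6) * t ^ (n+2)" "\<bar>Fv n t t\<bar> \<le> 4"
    "t * Ftv n t t = 2 * (rc n 1 - rc n 2) * t ^ (n+2)"
    "levi_num n t t \<le> (17 * (2*real n+5)\<^sup>2 + 256 * (real n+3) + 32 * (2*real n+6)\<^sup>2) * (t ^ (n+2))\<^sup>2"
proof -
  define T where "T = t ^ (n+2)"
  have T: "0 \<le> T" "T \<le> 1" "t ^ n * (t * t) = T" "t ^ (n+1) * t = T" "t ^ (2*n+4) = T * T"
  proof -
    show "0 \<le> T" "T \<le> 1" using t unfolding T_def by (auto intro: power_le_one simp del: power_Suc)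
    show "t ^ n * (t * t) = T" "t ^ (n+1) * t = T" by (simp_all add: T_def power_shift)
    have "2 * n + 4 = (n + 2) + (n + 2)" by simp
    then show "t ^ (2*n+4) = T * T" unfolding T_def power_add[symmetric] by (rule arg_cong[where f="power t"])
  qed
  have ab: "\<bar>Ft n t t\<bar> \<le> (2*real n+6) * t ^ n * (t + \<bar>t\<bar>)\<^sup>2" "\<bar>Fv n t t\<bar> \<le> 2 * t ^ (n+1) * (t + \<bar>t\<bar>)"
    using abs_bounds[of t t n] t by auto
  have "(2*real n+6) * t ^ n * (t + \<bar>t\<bar>)\<^sup>2 = 4 * (2*real n+6) * (t ^ n * (t * t))"
    using t by (simp add: power2_eq_square algebra_simps)
  then have Ft: "\<bar>Ft n t t\<bar> \<le> 4 * (2*real n+6) * T" using ab(1) unfolding T(3) by linarith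
  then show "\<bar>Ft n t t\<bar> \<le> 4 * (2*real n+6) * t ^ (n+2)" by (simp add: T_def)
  have "2 * t ^ (n+1) * (t + \<bar>t\<bar>) = 4 * (t ^ (n+1) * t)" using t by simp
  then show Fv: "\<bar>Fv n t t\<bar> \<le> 4" using ab(2) T by linarith
  show "t * Ftv n t t = 2 * (rc n 1 - rc n 2) * t ^ (n+2)"
    unfolding Ftv_def power_shift by (simp only: ring_distribs mult_ac)
  have F2: "(Fv n t t)\<^sup>2 \<le> 16" using abs_le_square_iff[of "Fv n t t" 4] Fv by simp
  have "(1 + (Fv n t t)\<^sup>2) * Fzz n t t \<le> 17 * Fzz n t t"
    using F2 Fzz_nonneg[OF t(1)] by (intro mult_right_mono) auto
  also have "17 * Fzz n t t = 17 * (2*real n+5)\<^sup>2 * (T * T)" unfolding Fzz_def T(5) by simp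
  finally have 1: "(1 + (Fv n t t)\<^sup>2) * Fzz n t t \<le> 17 * (2*real n+5)\<^sup>2 * (T * T)" .
  have cube: "t ^ n * (t ^ (2*n+2) * (t + \<bar>t\<bar>) ^ 4) = 16 * (T * T * T)"
  proof -
    have "(t + \<bar>t\<bar>) ^ 4 = 16 * (t * t * (t * t))" using t by (simp add: power4_eq_xxxx)
    moreover have "t ^ (2*n+2) = t ^ n * t ^ n * (t * t)" by (simp add: power_add mult_2 power2_eq_square)
    ultimately show ?thesis unfolding T(3)[symmetric] by (simp only: mult_ac)
  qed
  have "- (2 * t * Ft n t t * Ftv n t t * Fv n t t) \<le> 16 * (real n+3) * (t ^ n * (t ^ (2*n+2) * (t + \<bar>t\<bar>) ^ 4))"
  proof -
    have "- (2 * t * Ft n t t * Ftv n t t * Fv n t t) \<le> \<bar>2 * t * Ft n t t * Ftv n t t * Fv n t t\<bar>"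
      by (rule abs_ge_minus_self)
    also have "\<dots> \<le> 16 * (real n+3) * t ^ n * (t ^ (2*n+2) * (t + \<bar>t\<bar>) ^ 4)"
      by (rule cross_term_bound) (use t in auto)
    also have "\<dots> = 16 * (real n+3) * (t ^ n * (t ^ (2*n+2) * (t + \<bar>t\<bar>) ^ 4))" by simp
    finally show ?thesis .
  qed
  also have "\<dots> = 256 * (real n+3) * (T * T * T)" unfolding cube by simp
  \<comment> \<open>The cross term is cubic in \<open>T\<close>; one factor is bounded by
    \<open>1\<close> since quadratic size is all that is needed.\<close>
  also have "\<dots> \<le> 256 * (real n+3) * (T * T * 1)"
    using T by (intro mult_left_mono) auto
  finally have 2: "- (2 * t * Ft n t t * Ftv n t t * Fv n t t) \<le> 256 * (real n+3) * (T * T)" by simp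
  have "(Ft n t t)\<^sup>2 \<le> (4 * (2*real n+6) * T)\<^sup>2"
    using abs_le_square_iff[of "Ft n t t" "4 * (2*real n+6) * T"] Ft T by simp
  moreover have "Fvv n t * t \<le> 2"
  proof -
    have "(rc n 1)\<^sup>2 \<le> 1" using rc_bounds(1)[of n 1] rc_bounds(2)[of 1 n] by (simp add: power_le_one)
    then have "(rc n 1)\<^sup>2 * T \<le> 1 * 1" using T by (intro mult_mono) auto
    then show ?thesis unfolding Fvv_def using T(4) by (simp add: mult.assoc)
  qed
  ultimately have "Fvv n t * t * (Ft n t t)\<^sup>2 \<le> 2 * (4 * (2*real n+6) * T)\<^sup>2"
    using t by (intro mult_mono) auto
  then have 3: "Fvv n t * t * (Ft n t t)\<^sup>2 \<le> 32 * (2*real n+6)\<^sup>2 * (T * T)"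
    by (simp only: power_mult_distrib power2_eq_square[of T]) simp
  have "levi_num n t t \<le> 17 * (2*real n+5)\<^sup>2 * (T * T) + 256 * (real n+3) * (T * T) + 32 * (2*real n+6)\<^sup>2 * (T * T)"
    unfolding levi_num_def using 1 2 3 by linarith
  then show "levi_num n t t \<le> (17 * (2*real n+5)\<^sup>2 + 256 * (real n+3) + 32 * (2*real n+6)\<^sup>2) * (t ^ (n+2))\<^sup>2"
    unfolding T_def[symmetric] power2_eq_square[of T] by (simp add: distrib_right)
qed

context defining_function
begin

abbreviation ch :: "C2 \<Rightarrow> complex" where "ch \<equiv> \<lambda>x. complex_of_real (h x)"

text \<open>The formula for \<open>H\<^sub>\<rho>(L0, \<partial>\<^sub>w)\<close>, multiplied by
  \<open>4 z\<close> and solved for \<open>z h\<^sub>z\<close>. The imaginary part is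
  \<open>- 1/2\<close> times the angular derivative of \<open>h\<close>; in it the
  \<open>F\<^sub>v\<^sub>v\<close> term, being real, disappears, and the
  \<open>F\<^sub>t\<^sub>v\<close> term contributes exactly
  \<open>h t F\<^sub>t\<^sub>v\<close>.\<close>

lemma Im_z_h_z:
  assumes q: "q \<in> frontier (Omega (n+3)) \<inter> V"
  shows "(1 + (Fv n (tt q) (vv q))\<^sup>2) * Im (q $ 1 * d_z 1 ch q) =
    4 * Im (q $ 1 * hess \<rho> (L0 n) ew q)
    + 2 * tt q * Ft n (tt q) (vv q) * Im (d_z 2 ch q * (1 + \<i> * of_real (Fv n (tt q) (vv q))))
    - h q * (tt q * Ftv n (tt q) (vv q))"
proof -
  define z a b where "z = q $ 1" and "a = d_z 1 ch q" and "b = d_z 2 ch q"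
  define f fv ftv fvv hh where "f = complex_of_real (Ft n (tt q) (vv q))"
    and "fv = complex_of_real (Fv n (tt q) (vv q))" and "ftv = complex_of_real (Ftv n (tt q) (vv q))"
    and "fvv = complex_of_real (Fvv n (tt q))" and "hh = complex_of_real (h q)"
  define t where "t = complex_of_real (tt q)"
  have t: "z * cnj z = t"
    unfolding z_def t_def tt_def by (rule complex_norm_square[symmetric])
  have e: "hess \<rho> (L0 n) ew q = ((1 - \<i> * fv) / 2 * a - f * cnj z * b) * ((1 + \<i> * fv) / 2)
     + hh * (\<i> / 2 * ftv * cnj z * ((1 - \<i> * fv) / 2) - fvv / 4 * (f * cnj z))"
    unfolding hess_L0[OF q] hess_r vf_apply_cr
    by (simp add: vf_apply_def UNIV_2_sum L0_simps ew_def a_def b_def z_def f_def fv_def ftv_def fvv_def hh_def)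
  have "4 * (z * hess \<rho> (L0 n) ew q) = (1 + fv\<^sup>2) * (z * a) - 2 * (z * cnj z) * f * (b * (1 + \<i> * fv))
     + hh * (\<i> * ftv * (z * cnj z) * (1 - \<i> * fv) - fvv * f * (z * cnj z))"
    unfolding e by (simp add: power2_eq_square field_simps)
  then have "Im (4 * (z * hess \<rho> (L0 n) ew q)) = Im (of_real (1 + (Fv n (tt q) (vv q))\<^sup>2) * (z * a)
     - of_real (2 * tt q * Ft n (tt q) (vv q)) * (b * (1 + \<i> * fv))
     + of_real (h q * (tt q * Ftv n (tt q) (vv q))) * (\<i> * (1 - \<i> * fv)) - of_real (h q * Fvv n (tt q) * Ft n (tt q) (vv q) * tt q))"
    unfolding t unfolding t_def f_def fv_def ftv_def fvv_def hh_def
    by (intro arg_cong[where f=Im]) (simp add: algebra_simps)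
  also have "\<dots> = (1 + (Fv n (tt q) (vv q))\<^sup>2) * Im (z * a)
     - 2 * tt q * Ft n (tt q) (vv q) * Im (b * (1 + \<i> * fv))
     + h q * (tt q * Ftv n (tt q) (vv q))"
    by (simp add: fv_def algebra_simps)
  finally have "Im (4 * (z * hess \<rho> (L0 n) ew q)) = (1 + (Fv n (tt q) (vv q))\<^sup>2) * Im (z * a)
     - 2 * tt q * Ft n (tt q) (vv q) * Im (b * (1 + \<i> * fv))
     + h q * (tt q * Ftv n (tt q) (vv q))" .
  moreover have "Im (4 * (z * hess \<rho> (L0 n) ew q)) = 4 * Im (z * hess \<rho> (L0 n) ew q)" by simp
  ultimately show ?thesis unfolding z_def a_def b_def fv_def by linarith
qed

lemma continuity_bounds:
  "\<exists>\<epsilon>>0. \<exists>K>0. \<forall>q. norm q < \<epsilon> \<longrightarrow> q \<in> V \<and> h 0 / 2 \<le> h q \<and> h q \<le> 2 * h 0 \<and>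
     cmod (hess \<rho> ew ew q) \<le> K \<and> cmod (d_z 2 ch q) \<le> K"
proof -
  define A where "A q = d_z 2 (g 2) q" for q
  define B where "B q = (complex_of_real (D2 (real_dir 1) q (axis 2 1)) - \<i> * complex_of_real (D2 (real_dir 1) q (axis 2 \<i>))) / 2" for q
  have hA: "hess \<rho> ew ew q = A q" if "q \<in> V" for q
    unfolding hess_def UNIV_2_sum d_z_d_zbar_\<rho>[OF that] by (simp add: ew_def A_def)
  have hB: "d_z 2 ch q = B q" if "q \<in> V" for q
    unfolding B_def by (rule d_z_eqI[OF has_derivative_complex_of_real]) (use has_derivative_D[OF that] in \<open>simp add: h_def\<close>)
  have "continuous_on V A"
  proof -
    have "continuous_on V (\<lambda>q. (of_real (D2 (axis 2 1) q (axis 2 1) + D2 (axis 2 \<i>) q (axis 2 \<i>))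
    + \<i> * of_real (D2 (axis 2 \<i>) q (axis 2 1) - D2 (axis 2 1) q (axis 2 \<i>))) / 4 :: complex)"
      by (intro continuous_intros continuous_on_D2) auto
    then show ?thesis by (rule continuous_on_eq) (simp add: A_def d_z_g)
  qed
  moreover have "continuous_on V B" unfolding B_def by (intro continuous_intros continuous_on_D2) auto
  moreover have "isCont h 0"
    unfolding h_def using has_derivative_D[OF V(2)] has_derivative_continuous by blast
  ultimately have "isCont A 0" "isCont B 0" "isCont h 0"
    using V by (auto simp: continuous_on_eq_continuous_at)
  then have "(A \<longlongrightarrow> A 0) (nhds 0)" "(B \<longlongrightarrow> B 0) (nhds 0)" "(h \<longlongrightarrow> h 0) (nhds 0)"
    unfolding isCont_def tendsto_at_iff_tendsto_nhds by blast+
  from tendstoD[OF this(1), of 1] tendstoD[OF this(2), of 1] tendstoD[OF this(3), of "h 0 / 2"]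
  have "\<forall>\<^sub>F q in nhds 0. dist (A q) (A 0) < 1" "\<forall>\<^sub>F q in nhds 0. dist (B q) (B 0) < 1"
    "\<forall>\<^sub>F q in nhds 0. dist (h q) (h 0) < h 0 / 2" using h0_pos by simp_all
  moreover have "\<forall>\<^sub>F q in nhds 0. q \<in> V" using V by (rule eventually_nhds_in_open)
  ultimately have "\<forall>\<^sub>F q in nhds 0. q \<in> V \<and> dist (A q) (A 0) < 1 \<and> dist (B q) (B 0) < 1 \<and> dist (h q) (h 0) < h 0 / 2"
    by eventually_elim simp
  then obtain \<epsilon> where \<epsilon>: "\<epsilon> > 0"
    "\<And>q. norm q < \<epsilon> \<Longrightarrow> q \<in> V \<and> dist (A q) (A 0) < 1 \<and> dist (B q) (B 0) < 1 \<and> dist (h q) (h 0) < h 0 / 2"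
    by (auto simp: eventually_nhds_metric)
  define K where "K = cmod (A 0) + cmod (B 0) + 1"
  have "K > 0" by (simp add: K_def add_nonneg_pos)
  moreover have "q \<in> V \<and> h 0 / 2 \<le> h q \<and> h q \<le> 2 * h 0 \<and> cmod (hess \<rho> ew ew q) \<le> K \<and> cmod (d_z 2 ch q) \<le> K"
    if "norm q < \<epsilon>" for q
  proof -
    have q: "q \<in> V" "dist (A q) (A 0) < 1" "dist (B q) (B 0) < 1" "dist (h q) (h 0) < h 0 / 2"
      using \<epsilon>(2)[OF that] by auto
    have "cmod (A q) \<le> cmod (A 0) + 1" "cmod (B q) \<le> cmod (B 0) + 1"
      using q(2,3) norm_triangle_sub[of "A q" "A 0"] norm_triangle_sub[of "B q" "B 0"] by (auto simp: dist_norm)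
    then have "cmod (hess \<rho> ew ew q) \<le> K" "cmod (d_z 2 ch q) \<le> K"
      unfolding hA[OF q(1)] hB[OF q(1)] K_def using norm_ge_zero[of "A 0"] norm_ge_zero[of "B 0"] by linarith+
    moreover have "h 0 / 2 \<le> h q" "h q \<le> 2 * h 0"
      using q(4) h0_pos unfolding dist_real_def by linarith+
    ultimately show ?thesis using q(1) by blast
  qed
  ultimately show ?thesis using \<epsilon>(1) by blast
qed

lemma not_psh: "\<not> psh_on_boundary (Omega (n+3)) \<rho> V"
proof
  assume psh: "psh_on_boundary (Omega (n+3)) \<rho> V"
  obtain \<epsilon> K where \<epsilon>: "\<epsilon> > 0" and K: "K > 0" and bd: "\<And>q. norm q < \<epsilon> \<Longrightarrow> q \<in> V \<and> h 0 / 2 \<le> h q \<and> h q \<le> 2 * h 0 \<and>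
     cmod (hess \<rho> ew ew q) \<le> K \<and> cmod (d_z 2 ch q) \<le> K"
    using continuity_bounds by blast
  define C where "C = 17 * (2*real n+5)\<^sup>2 + 256 * (real n+3) + 32 * (2*real n+6)\<^sup>2"
  have C: "C \<ge> 0" by (simp add: C_def)
  \<comment> \<open>\<open>A * T\<^sup>2\<close> will dominate \<open>K\<close> times
    \<open>H\<^sub>\<rho>(L0, L0)\<close> on the circle, by \<open>h \<le> 2 * h 0\<close> and the
    bound \<open>C * T\<^sup>2\<close> for \<open>levi_num\<close>.\<close>
  define A where "A = K * h 0 * C"
  have A: "A \<ge> 0" using K C h0_pos by (simp add: A_def)
  \<comment> \<open>The three summands bound \<open>|z|\<close>, \<open>|u|\<close> and
    \<open>|v|\<close> on the circle of radius \<open>s\<close>.\<close>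
  have "((\<lambda>s. s + \<bar>Fpoly n (s\<^sup>2) (s\<^sup>2)\<bar> + s\<^sup>2) \<longlongrightarrow> 0 + \<bar>Fpoly n (0\<^sup>2) (0\<^sup>2)\<bar> + 0\<^sup>2) (at_right 0)"
    unfolding Fpoly_def by (intro tendsto_intros)
  then have "\<forall>\<^sub>F s in at_right 0. s + \<bar>Fpoly n (s\<^sup>2) (s\<^sup>2)\<bar> + s\<^sup>2 < \<epsilon>"
    using \<epsilon> by (intro order_tendstoD) (auto simp: Fpoly_0)
  \<comment> \<open>After division by \<open>T\<close>, the first term is the Cauchy-Schwarz error
    and the second the error from \<open>h\<^sub>w\<close>, with \<open>40 = 2 * 4 * 5\<close>; both
    must stay below the main term, for which \<open>h \<ge> h 0 / 2\<close> is used.\<close>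
  moreover have "((\<lambda>s. 4 * s * sqrt A + 40 * (2*real n+6) * K * s\<^sup>2) \<longlongrightarrow> 4 * 0 * sqrt A + 40 * (2*real n+6) * K * 0\<^sup>2) (at_right 0)"
    by (intro tendsto_intros)
  then have "\<forall>\<^sub>F s in at_right 0. 4 * s * sqrt A + 40 * (2*real n+6) * K * s\<^sup>2 < h 0 * (rc n 1 - rc n 2)"
    using h0_pos rc_diff_pos[of n] by (intro order_tendstoD) auto
  moreover have "\<forall>\<^sub>F s in at_right (0::real). s \<in> {0<..<1}" by (intro eventually_at_right_real) simp
  ultimately have "\<forall>\<^sub>F s in at_right (0::real). s \<in> {0<..<1} \<and> s + \<bar>Fpoly n (s\<^sup>2) (s\<^sup>2)\<bar> + s\<^sup>2 < \<epsilon> \<and>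
      4 * s * sqrt A + 40 * (2*real n+6) * K * s\<^sup>2 < h 0 * (rc n 1 - rc n 2)"
    by eventually_elim simp
  then obtain s where s: "0 < s" "s < 1" "s + \<bar>Fpoly n (s\<^sup>2) (s\<^sup>2)\<bar> + s\<^sup>2 < \<epsilon>"
      "4 * s * sqrt A + 40 * (2*real n+6) * K * s\<^sup>2 < h 0 * (rc n 1 - rc n 2)"
    using eventually_happens[of _ "at_right (0::real)"] by (auto simp: trivial_limit_at_right_real)
  define t where "t = s\<^sup>2"
  have t: "0 < t" "t \<le> 1" using s by (auto simp: t_def power_le_one)
  define T where "T = t ^ (n+2)"
  have T: "T > 0" using t by (simp add: T_def)
  \<comment> \<open>\<open>v = t\<close> puts the circle on the double zero, and
    \<open>u = - F\<close> puts it on the boundary; one \<open>w\<close> serves all angles because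
    \<open>F\<close> depends only on \<open>|z|\<close> and \<open>v\<close>.\<close>
  define w where "w = Complex (- Fpoly n t t) t"
  define \<gamma> :: "real \<Rightarrow> C2" where "\<gamma> \<theta> = axis 1 (of_real s * exp (\<i> * of_real \<theta>)) + axis 2 w" for \<theta>
  have \<gamma>1: "\<gamma> \<theta> $ 1 = of_real s * exp (\<i> * of_real \<theta>)" and \<gamma>2: "\<gamma> \<theta> $ 2 = w" for \<theta>
    by (simp_all add: \<gamma>_def)
  have cm: "cmod (\<gamma> \<theta> $ 1) = s" for \<theta> using s by (simp add: \<gamma>1 norm_mult)
  have tv: "tt (\<gamma> \<theta>) = t" "vv (\<gamma> \<theta>) = t" for \<theta>
    by (simp_all add: tt_def vv_def cm \<gamma>2 t_def w_def)
  have fr: "\<gamma> \<theta> \<in> frontier (Omega (n+3))" for \<theta>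
    by (simp add: frontier_Omega r_fun_eq tv \<gamma>2) (simp add: w_def)
  have nrm: "norm (\<gamma> \<theta>) < \<epsilon>" for \<theta>
  proof -
    have "norm (\<gamma> \<theta>) \<le> cmod (\<gamma> \<theta> $ 1) + cmod (\<gamma> \<theta> $ 2)"
      unfolding norm_vec_def L2_set_def UNIV_2_sum using sqrt_sum_squares_le_sum[of "norm (\<gamma> \<theta> $ 1)" "norm (\<gamma> \<theta> $ 2)"] by simp
    also have "cmod (\<gamma> \<theta> $ 2) \<le> \<bar>Fpoly n t t\<bar> + t"
      unfolding \<gamma>2 using cmod_le[of w] t by (simp add: w_def)
    finally show ?thesis using s(3) unfolding cm t_def by linarith
  qed
  have neg: "Im (\<gamma> \<theta> $ 1 * d_z 1 ch (\<gamma> \<theta>)) < 0" for \<theta>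
  proof -
    define q where "q = \<gamma> \<theta>"
    have q: "q \<in> frontier (Omega (n+3)) \<inter> V" and b: "h 0 / 2 \<le> h q" "h q \<le> 2 * h 0"
      "cmod (hess \<rho> ew ew q) \<le> K" "cmod (d_z 2 ch q) \<le> K"
      using fr[of \<theta>] bd[OF nrm[of \<theta>]] by (auto simp: q_def)
    have tq: "tt q = t" "vv q = t" "cmod (q $ 1) = s" by (simp_all add: q_def tv cm)
    note dg = diagonal_bounds[of t n, OF less_imp_le[OF t(1)] t(2)]
    have "(cmod (hess \<rho> (L0 n) ew q))\<^sup>2 \<le> K * (h q * levi_num n t t / 4)"
      using psh_cauchy_schwarz[OF psh q K b(3)] unfolding Re_hess_L0_L0[OF q] tq .
    also have "\<dots> \<le> K * (2 * h 0 * (C * T\<^sup>2) / 4)"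
    proof -
      have "levi_num n t t \<le> C * T\<^sup>2" using dg(4) by (simp add: C_def T_def)
      moreover have "0 \<le> h q" using b(1) h0_pos by linarith
      ultimately have "h q * levi_num n t t \<le> h q * (C * T\<^sup>2)" by (intro mult_left_mono)
      also have "\<dots> \<le> 2 * h 0 * (C * T\<^sup>2)" using b(2) C by (intro mult_right_mono) auto
      finally show ?thesis using K by (intro mult_left_mono divide_right_mono) auto
    qed
    also have "\<dots> \<le> A * T\<^sup>2"
    proof -
      have "K * (2 * h 0 * (C * T\<^sup>2) / 4) = (A * T\<^sup>2) / 2" by (simp add: A_def)
      moreover have "0 \<le> A * T\<^sup>2" using A by simp
      ultimately show ?thesis by linarith
    qed
    also have "\<dots> = (sqrt A * T)\<^sup>2" using A by (simp add: power_mult_distrib)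
    finally have "cmod (hess \<rho> (L0 n) ew q) \<le> sqrt A * T"
      by (rule power2_le_imp_le) (use A T in simp)
    then have "s * cmod (hess \<rho> (L0 n) ew q) \<le> s * (sqrt A * T)" using s by (intro mult_left_mono) auto
    moreover have "\<bar>Im (q $ 1 * hess \<rho> (L0 n) ew q)\<bar> \<le> s * cmod (hess \<rho> (L0 n) ew q)"
      using abs_Im_le_cmod[of "q $ 1 * hess \<rho> (L0 n) ew q"] by (simp add: norm_mult tq)
    ultimately have 1: "4 * Im (q $ 1 * hess \<rho> (L0 n) ew q) \<le> T * (4 * s * sqrt A)" by (simp add: mult_ac)
    have "cmod (1 + \<i> * of_real (Fv n t t)) \<le> 5"
      using norm_triangle_ineq[of 1 "\<i> * complex_of_real (Fv n t t)"] dg(2) by (simp add: norm_mult)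
    then have "cmod (d_z 2 ch q * (1 + \<i> * of_real (Fv n t t))) \<le> K * 5"
      unfolding norm_mult using b(4) K by (intro mult_mono) auto
    then have "\<bar>Im (d_z 2 ch q * (1 + \<i> * of_real (Fv n t t)))\<bar> \<le> K * 5"
      using abs_Im_le_cmod order_trans by blast
    then have "\<bar>Ft n t t\<bar> * \<bar>Im (d_z 2 ch q * (1 + \<i> * of_real (Fv n t t)))\<bar> \<le> (4 * (2*real n+6) * T) * (K * 5)"
      using dg(1) K T by (intro mult_mono) (auto simp: T_def)
    then have "2 * t * (\<bar>Ft n t t\<bar> * \<bar>Im (d_z 2 ch q * (1 + \<i> * of_real (Fv n t t)))\<bar>) \<le> 2 * t * ((4 * (2*real n+6) * T) * (K * 5))"
      using t by (intro mult_left_mono) auto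
    moreover have "2 * t * Ft n t t * Im (d_z 2 ch q * (1 + \<i> * of_real (Fv n t t)))
       \<le> 2 * t * (\<bar>Ft n t t\<bar> * \<bar>Im (d_z 2 ch q * (1 + \<i> * of_real (Fv n t t)))\<bar>)"
      unfolding mult.assoc abs_mult[symmetric] using t by (intro mult_left_mono) auto
    ultimately have 2: "2 * t * Ft n t t * Im (d_z 2 ch q * (1 + \<i> * of_real (Fv n t t))) \<le> T * (40 * (2*real n+6) * K * s\<^sup>2)"
      by (simp add: t_def[symmetric] mult_ac)
    have "T * (h 0 * (rc n 1 - rc n 2)) = h 0 / 2 * (2 * (rc n 1 - rc n 2) * T)" by simp
    also have "\<dots> \<le> h q * (2 * (rc n 1 - rc n 2) * T)"
      using b(1) rc_diff_pos[of n] T by (intro mult_right_mono) auto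
    finally have 3: "T * (h 0 * (rc n 1 - rc n 2)) \<le> h q * (t * Ftv n t t)" unfolding dg(3) T_def .
    have "(1 + (Fv n t t)\<^sup>2) * Im (q $ 1 * d_z 1 ch q)
       \<le> T * (4 * s * sqrt A) + T * (40 * (2*real n+6) * K * s\<^sup>2) - T * (h 0 * (rc n 1 - rc n 2))"
      using Im_z_h_z[OF q] 1 2 3 unfolding tq by linarith
    also have "\<dots> = T * ((4 * s * sqrt A + 40 * (2*real n+6) * K * s\<^sup>2) - h 0 * (rc n 1 - rc n 2))"
      by (simp only: right_diff_distrib distrib_left)
    also have "\<dots> < 0" using s(4) T by (intro mult_pos_neg) auto
    finally have "(1 + (Fv n t t)\<^sup>2) * Im (q $ 1 * d_z 1 ch q) < 0" .
    moreover have "1 + (Fv n t t)\<^sup>2 > 0" by (simp add: add_pos_nonneg)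
    ultimately show ?thesis by (simp add: q_def mult_less_0_iff)
  qed
  \<comment> \<open>The velocity of the circle is \<open>i z\<close> in the first coordinate, so the
    derivative is \<open>2 Re (i z h\<^sub>z)\<close>, with only C^1 regularity of \<open>h\<close>
    involved.\<close>
  have deriv: "((\<lambda>\<theta>. h (\<gamma> \<theta>)) has_real_derivative - 2 * Im (\<gamma> \<theta> $ 1 * d_z 1 ch (\<gamma> \<theta>))) (at \<theta>)" for \<theta>
  proof -
    let ?q = "\<gamma> \<theta>"
    define d where "d = D2 (real_dir 1) ?q"
    have hd: "(h has_derivative d) (at ?q)"
      unfolding h_def d_def using bd[OF nrm] by (intro has_derivative_D) simp
    have g1: "((\<lambda>\<theta>. of_real s * exp (\<i> * of_real \<theta>)) has_derivative (\<lambda>x. of_real x * (\<i> * ?q $ 1))) (at \<theta>)"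
    proof -
      have "((\<lambda>\<theta>. exp (\<i> * of_real \<theta>)) has_derivative (\<lambda>x. exp (\<i> * of_real \<theta>) * (\<i> * of_real x))) (at \<theta>)"
      proof (rule has_derivative_compose[where g=exp and f="\<lambda>\<theta>. \<i> * complex_of_real \<theta>"
            and f'="\<lambda>x. \<i> * complex_of_real x" and g'="\<lambda>x. exp (\<i> * complex_of_real \<theta>) * x"])
        show "((\<lambda>\<theta>. \<i> * complex_of_real \<theta>) has_derivative (\<lambda>x. \<i> * of_real x)) (at \<theta>)"
          by (intro has_derivative_mult_right has_derivative_complex_of_real has_derivative_ident)
        show "(exp has_derivative (\<lambda>x. exp (\<i> * complex_of_real \<theta>) * x)) (at (\<i> * complex_of_real \<theta>))"
          using DERIV_exp unfolding has_field_derivative_def .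
      qed
      from has_derivative_mult_right[OF this, of "of_real s"] show ?thesis
        by (simp add: \<gamma>1 mult_ac)
    qed
    have g: "(\<gamma> has_derivative (\<lambda>x. axis 1 (of_real x * (\<i> * ?q $ 1)))) (at \<theta>)"
      unfolding \<gamma>_def[abs_def]
      using has_derivative_add_const[OF bounded_linear.has_derivative[OF bounded_linear_axis g1], of 1 "axis 2 w"] by (simp add: \<gamma>_def)
    have "((\<lambda>\<theta>. h (\<gamma> \<theta>)) has_derivative (\<lambda>x. d (axis 1 (of_real x * (\<i> * ?q $ 1))))) (at \<theta>)"
      by (rule has_derivative_compose[OF g, where g=h]) (rule hd)
    moreover have "d (axis 1 (of_real x * (\<i> * ?q $ 1))) = - 2 * Im (?q $ 1 * d_z 1 ch ?q) * x" for x
    proof -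
      have lin: "linear d" using hd by (rule has_derivative_linear)
      have ax: "axis 1 (of_real x * (\<i> * z)) = x *\<^sub>R ((- Im z) *\<^sub>R axis 1 1 + Re z *\<^sub>R axis 1 \<i> :: C2)" for z
        by (rule C2_eqI) (simp_all add: complex_eq_iff)
      have dz: "d_z 1 ch ?q = (d (axis 1 1) - \<i> * d (axis 1 \<i>)) / 2"
        by (rule d_z_eqI[OF has_derivative_complex_of_real[OF hd]])
      have "Re (d_z 1 ch ?q) = d (axis 1 1) / 2" "Im (d_z 1 ch ?q) = - d (axis 1 \<i>) / 2"
        unfolding dz by simp_all
      then show ?thesis
        unfolding ax using lin by (simp add: linear_add linear_scale linear_diff linear_neg algebra_simps)
    qed
    ultimately show ?thesis unfolding has_field_derivative_def by (simp only:)
  qed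
  have "h (\<gamma> 0) < h (\<gamma> (2 * pi))"
  proof (rule DERIV_pos_imp_increasing[where f="\<lambda>\<theta>. h (\<gamma> \<theta>)"])
    fix \<theta> :: real
    have "- 2 * Im (\<gamma> \<theta> $ 1 * d_z 1 ch (\<gamma> \<theta>)) > 0" using neg[of \<theta>] by linarith
    then show "\<exists>y. ((\<lambda>\<theta>. h (\<gamma> \<theta>)) has_real_derivative y) (at \<theta>) \<and> 0 < y"
      using deriv by blast
  qed (use pi_gt_zero in simp)
  moreover have "\<gamma> (2 * pi) = \<gamma> 0"
    using exp_two_pi_i' by (simp add: \<gamma>_def mult_ac)
  ultimately show False by simp
qed

end

theorem theorem3p1:
  fixes k :: nat
  assumes "k \<ge> 3"
  shows
    "(\<exists>U. open U \<and> 0 \<in> U \<and>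
        (\<forall>p \<in> frontier (Omega k) \<inter> U. pseudoconvex_at (Omega k) (r_fun k) p) \<and>
        (k = 3 \<longrightarrow>
           {p \<in> frontier (Omega k) \<inter> U. weakly_pseudoconvex_at (Omega k) (r_fun k) p} = {0}) \<and>
        (k > 3 \<longrightarrow>
           {p \<in> frontier (Omega k) \<inter> U. weakly_pseudoconvex_at (Omega k) (r_fun k) p}
             = (frontier (Omega k) \<inter> U) \<inter> {p. p $ 1 = 0})) \<and>
     finite_type_at (Omega k) (r_fun k) 0 (2 * k) \<and>
     (\<forall>V \<rho>. local_defining_function (Omega k) \<rho> V 0 \<longrightarrow> \<not> psh_on_boundary (Omega k) \<rho> V)"
proof -
  obtain n where k: "k = n + 3" using assms by (metis add.commute le_Suc_ex)
  have weak: "{p \<in> frontier (Omega (n+3)) \<inter> U0 n. weakly_pseudoconvex_at (Omega (n+3)) (r_fun (n+3)) p}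
      = {p \<in> frontier (Omega (n+3)) \<inter> U0 n. p $ 1 = 0 \<and> (n = 0 \<longrightarrow> p $ 2 = 0)}"
    using weakly_pseudoconvex_at_U0[of _ n] by blast
  have zero: "{p \<in> frontier (Omega (n+3)) \<inter> U0 n. p $ 1 = 0 \<and> p $ 2 = 0} = {0}"
    using zero_in_frontier[of n] zero_in_U0[of n] by (auto intro!: C2_eqI)
  show ?thesis
    unfolding k
  proof (intro conjI allI impI exI[of _ "U0 n"] ballI)
    show "open (U0 n)" "0 \<in> U0 n" by (rule open_U0 zero_in_U0)+
    show "pseudoconvex_at (Omega (n+3)) (r_fun (n+3)) p" if "p \<in> frontier (Omega (n+3)) \<inter> U0 n" for p
      using that by (rule pseudoconvex_at_U0)
    show "{p \<in> frontier (Omega (n+3)) \<inter> U0 n. weakly_pseudoconvex_at (Omega (n+3)) (r_fun (n+3)) p} = {0}"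
      if "n + 3 = 3" using weak zero that by simp
    show "{p \<in> frontier (Omega (n+3)) \<inter> U0 n. weakly_pseudoconvex_at (Omega (n+3)) (r_fun (n+3)) p}
        = frontier (Omega (n+3)) \<inter> U0 n \<inter> {p. p $ 1 = 0}"
      if "n + 3 > 3" using weak that by auto
    show "finite_type_at (Omega (n+3)) (r_fun (n+3)) 0 (2 * (n+3))" by (rule finite_type)
    show "\<not> psh_on_boundary (Omega (n+3)) \<rho> V" if "local_defining_function (Omega (n+3)) \<rho> V 0" for V \<rho>
    proof -
      interpret defining_function n V \<rho> using that by unfold_locales
      show ?thesis by (rule not_psh)
    qed
  qed
qed

end
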